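(* Let $d\ge1$, $m_\mu,m_\nu\in\mathbb R^d$ and $\Sigma_\mu,\Sigma_\nu\in\mathcal S_d^+$. (1) $\mathcal I_2(\mathcal N_d(m_\mu,\Sigma_\mu),\mathcal N_d(m_\nu,\Sigma_\nu))=\mathcal N_d(m_\nu,\Sigma_{\mathcal I})$, where $\Sigma_{\mathcal I}\in\mathcal S_d^+$ is the unique solution (minimizer) of $$\inf_{\Sigma\in\mathcal S_d^+:\,\Sigma\le\Sigma_\nu}\operatorname{tr}\left(\Sigma-2(\Sigma_\mu^{1/2}\Sigma\Sigma_\mu^{1/2})^{1/2}\right).$$ (2) Any $\mathcal W_2$-projection of $\mathcal N_d(m_\nu,\Sigma_\nu)$ on the set of probability measures dominating $\mathcal N_d(m_\mu,\Sigma_\mu)$ in the convex order has mean $m_\mu$ and a covariance matrix solving $$\inf_{\Sigma\in\mathcal S_d^+:\,\Sigma_\mu\le\Sigma}\operatorname{tr}\left(\Sigma-2(\Sigma_\nu^{1/2}\Sigma\Sigma_\nu^{1/2})^{1/2}\right),$$ and for any solution $\Sigma_{\mathcal J}$ of this minimization problem, $\mathcal N_d(m_\mu,\Sigma_{\mathcal J})$ is such a projection. When $d=1$ or $\Sigma_\nu$ is positive definite, this is the unique projection and the solution $\Sigma_{\mathcal J}$ is unique. (3) For all $\mu,\nu\in\mathcal P_2(\mathbb R^d)$ with respective expectations $m_\mu,m_\nu$ and covariance matrices $\Sigma_\mu,\Sigma_\nu$, $$\mathcal W_2^2(\mu,\mathcal I_2(\mu,\nu))\ge|m_\mu-m_\nu|^2+\inf_{\Sigma\in\mathcal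 S_d^+:\,\Sigma\le\Sigma_\nu}\operatorname{tr}\left(\Sigma_\mu+\Sigma-2(\Sigma_\mu^{1/2}\Sigma\Sigma_\mu^{1/2})^{1/2}\right),$$ $$\inf_{\eta\in\mathcal P_2(\mathbb R^d):\,\mu\le_{cx}\eta}\mathcal W_2^2(\nu,\eta)\ge|m_\mu-m_\nu|^2+\inf_{\Sigma\in\mathcal S_d^+:\,\Sigma_\mu\le\Sigma}\operatorname{tr}\left(\Sigma_\nu+\Sigma-2(\Sigma_\nu^{1/2}\Sigma\Sigma_\nu^{1/2})^{1/2}\right).$$
   Context: $\mathcal S_d^+$ is the set of real symmetric positive semi-definite $d\times d$ matrices, $\le$ between symmetric matrices is the positive semi-definite (Loewner) order, and $M^{1/2}$ is the positive semi-definite square root. $\mathcal N_d(m,\Sigma)$ is the (possibly degenerate) Gaussian distribution on $\mathbb R^d$ with mean $m$ and covariance $\Sigma$. $\mathcal P_2(\mathbb R^d)$ is the set of probability measures with finite second moment and $\mathcal W_2$ the quadratic Wasserstein distance. The convex order is defined by $\mu\le_{cx}\nu$ iff $\int f\,d\mu\le\int f\,d\nu$ for every convex $f:\mathbb R^d\to\mathbb R$. $\mathcal I_2(\mu,\nu)$ denotes the (existing and unique) minimizer of $\eta\mapsto\mathcal W_2(\mu,\eta)$ over $\{\eta\in\mathcal P_2(\mathbb R^d):\eta\le_{cx}\nu\}$. A $\mathcal W_2$-projection of $\nu$ on the set of probability measures dominating $\mu$ in the convex order is a minimizer of $\eta\mapsto\mathcal W_2(\nu,\eta)$ over $\{\eta\in\mathcal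 P_2(\mathbb R^d):\mu\le_{cx}\eta\}$; minimizers always exist, and are known to be unique when $d=1$ or $\nu$ is absolutely continuous with respect to the Lebesgue measure. *)

theory Defs
  imports "HOL-Probability.Probability"
begin

definition psd :: "real^'n^'n \<Rightarrow> bool" where
  "psd A \<longleftrightarrow> transpose A = A \<and> (\<forall>x. 0 \<le> x \<bullet> (A *v x))"

definition pos_def :: "real^'n^'n \<Rightarrow> bool" where
  "pos_def A \<longleftrightarrow> transpose A = A \<and> (\<forall>x. x \<noteq> 0 \<longrightarrow> 0 < x \<bullet> (A *v x))"

(* The library order on vectors, hence on real^'n^'n, is componentwise; this is a separate relation. *)
definition loewner_le :: "real^'n^'n \<Rightarrow> real^'n^'n \<Rightarrow> bool" (infix "\<preceq>\<^sub>L" 50) where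
  "A \<preceq>\<^sub>L B \<longleftrightarrow> psd (B - A)"

(* A psd matrix has exactly one psd square root; the value is meaningless for other matrices. *)
definition psd_sqrt :: "real^'n^'n \<Rightarrow> real^'n^'n" where
  "psd_sqrt A = (THE B. psd B \<and> B ** B = A)"

definition std_gaussian :: "(real^'n) measure" where
  "std_gaussian = density lborel (\<lambda>x. ennreal (\<Prod>i\<in>UNIV. std_normal_density (x $ i)))"

(* Image of the standard Gaussian under an affine map, so that singular S is allowed. *)
definition gaussian :: "real^'n \<Rightarrow> real^'n^'n \<Rightarrow> (real^'n) measure" where
  "gaussian m S = distr std_gaussian borel (\<lambda>x. m + psd_sqrt S *v x)"

definition P2 :: "(real^'n) measure set" where
  "P2 = {\<mu>. prob_space \<mu> \<and> sets \<mu> = sets borel \<and> integrable \<mu> (\<lambda>x. (norm x)\<^sup>2)}"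

definition mean :: "(real^'n) measure \<Rightarrow> real^'n" where
  "mean \<mu> = (\<integral>x. x \<partial>\<mu>)"

definition cov_matrix :: "(real^'n) measure \<Rightarrow> real^'n^'n" where
  "cov_matrix \<mu> = (\<chi> i j. \<integral>x. (x $ i - mean \<mu> $ i) * (x $ j - mean \<mu> $ j) \<partial>\<mu>)"

definition couplings ::
  "(real^'n) measure \<Rightarrow> (real^'n) measure \<Rightarrow> ((real^'n) \<times> (real^'n)) measure set" where
  "couplings \<mu> \<nu> =
    {\<pi>. prob_space \<pi> \<and> sets \<pi> = sets borel \<and> distr \<pi> borel fst = \<mu> \<and> distr \<pi> borel snd = \<nu>}"

(* The infimum is finite for measures in P2, so enn2real loses nothing there. *)
definition W2 :: "(real^'n) measure \<Rightarrow> (real^'n) measure \<Rightarrow> real" where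
  "W2 \<mu> \<nu> = sqrt (enn2real
     (INF \<pi>\<in>couplings \<mu> \<nu>. \<integral>\<^sup>+z. ennreal ((norm (fst z - snd z))\<^sup>2) \<partial>\<pi>))"

(* A convex function has an affine minorant, so its integral against a measure with finite first
   moment is well defined in (-\<infinity>, \<infinity>]. The Bochner integral would return 0 for the value \<infinity>. *)
definition ext_integral :: "'a measure \<Rightarrow> ('a \<Rightarrow> real) \<Rightarrow> ereal" where
  "ext_integral \<mu> f =
    enn2ereal (\<integral>\<^sup>+x. ennreal (f x) \<partial>\<mu>) - enn2ereal (\<integral>\<^sup>+x. ennreal (- f x) \<partial>\<mu>)"

definition cx_le :: "(real^'n) measure \<Rightarrow> (real^'n) measure \<Rightarrow> bool" (infix "\<le>\<^sub>c\<^sub>x" 50) where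
  "\<mu> \<le>\<^sub>c\<^sub>x \<nu> \<longleftrightarrow> (\<forall>f. convex_on UNIV f \<longrightarrow> ext_integral \<mu> f \<le> ext_integral \<nu> f)"

definition I2 :: "(real^'n) measure \<Rightarrow> (real^'n) measure \<Rightarrow> (real^'n) measure" where
  "I2 \<mu> \<nu> = (THE \<eta>. is_arg_min (\<lambda>\<eta>. W2 \<mu> \<eta>) (\<lambda>\<eta>. \<eta> \<in> P2 \<and> \<eta> \<le>\<^sub>c\<^sub>x \<nu>) \<eta>)"

(* W2-projection of \<nu> on the measures dominating \<mu>; such a minimizer need not be unique. *)
definition is_dominating_projection ::
  "(real^'n) measure \<Rightarrow> (real^'n) measure \<Rightarrow> (real^'n) measure \<Rightarrow> bool" where
  "is_dominating_projection \<mu> \<nu> \<eta> \<longleftrightarrow>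
    is_arg_min (\<lambda>\<eta>. W2 \<nu> \<eta>) (\<lambda>\<eta>. \<eta> \<in> P2 \<and> \<mu> \<le>\<^sub>c\<^sub>x \<eta>) \<eta>"

end

theory Submission
  imports Defs
begin

text \<open>
  For a coupling of two measures with covariances \<open>A\<close> and \<open>B\<close>, the cross covariance is
  \<open>A\<^sup>1\<^sup>/\<^sup>2 K B\<^sup>1\<^sup>/\<^sup>2\<close> with a contraction \<open>K\<close>, so a singular value decomposition bounds the transport cost from
  below by Gelbrich's expression, with equality for Gaussians. Since \<open>\<eta> \<le>\<^sub>c\<^sub>x \<nu>\<close> forces equal means and
  ordered covariances, and ordered covariances with equal means order the corresponding Gaussians, replacing
  a competitor by the Gaussian with the same moments is admissible and does not increase the distance. This
  reduces both projection problems to the problems for covariances.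

  The order between Gaussians needs no convolution: if \<open>A \<le> B\<close> then \<open>A\<^sup>1\<^sup>/\<^sup>2 = B\<^sup>1\<^sup>/\<^sup>2 K\<close> with a contraction
  \<open>K\<close>, a convex combination of orthogonal matrices, each of which preserves the standard Gaussian; Jensen's
  inequality does the rest.

  Existence and uniqueness of the projection below \<open>\<nu>\<close> need no compactness. Replacing \<open>Y\<close> by \<open>E[Y | X]\<close>
  turns a coupling into a map \<open>T\<close> without raising the cost; the admissible maps are a closed convex subset
  of \<open>L\<^sup>2(\<mu>)\<close>, whose point closest to the identity is unique. The gap in Pythagoras' identity shows that
  almost optimal couplings concentrate near the graph of the optimal map. Uniqueness above a Gaussian comes
  from the equality case of Gelbrich's bound, or, on the line over a Dirac mass, from the fact that
  convex ordered measures with the same variance coincide, because \<open>x\<^sup>2/2 \<plusminus> cos x\<close> and \<open>x\<^sup>2/2 \<plusminus> sin x\<close> are convex.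
\<close>

text \<open>The two covariance problems are settled in opposite directions. Below
  \<open>\<nu>\<close>, the matrix \<open>\<Sigma>\<^sub>\<mu>\<close> may be singular and strict
  convexity of the objective may then fail, so uniqueness of the optimal covariance is read off from
  uniqueness of the projection: a Gaussian determines its covariance. For this reason the projection
  is studied for arbitrary members of \<open>P2\<close>, which also gives \<open>I2\<close> its
  meaning in the last part of the theorem. Above \<open>\<mu>\<close>, projections need not be
  unique, so existence and uniqueness of the optimal covariance are proved on matrices.

  Integrals of convex functions may be infinite. Subtracting a supporting affine function reduces
  the convex order to nonnegative convex functions, for which Fatou's lemma, monotone convergence
  and Jensen's inequality hold in \<open>ennreal\<close> without integrability conditions.

  Couplings within a small error of the infimum take its place, and equality of measures is
  concluded from a vanishing \<open>W2\<close> distance.\<close>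

subsection \<open>The spectral theorem and square roots\<close>

(* As a simp rule this would turn every \<open>transpose A *v x\<close> into \<open>x v* A\<close>. *)
declare transpose_matrix_vector [simp del]

lemma trace_scaleR: "trace (c *\<^sub>R (A::real^'n^'n)) = c * trace A"
  by (simp add: trace_def sum_distrib_left)

lemma transpose_add: "transpose (A + B) = transpose A + transpose (B::real^'n^'m)"
  by (simp add: transpose_def vec_eq_iff)

lemma transpose_minus: "transpose (A - B) = transpose A - transpose (B::real^'n^'m)"
  by (simp add: transpose_def vec_eq_iff)

lemma matrix_diff_ldistrib: "(A::real^'n^'m) ** (B - C) = A ** B - A ** C"
  by (simp add: matrix_matrix_mult_def vec_eq_iff right_diff_distrib sum_subtractf)

lemma matrix_diff_rdistrib: "(B - C) ** (A::real^'n^'m) = B ** A - C ** A"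
  by (simp add: matrix_matrix_mult_def vec_eq_iff left_diff_distrib sum_subtractf)

lemma matrix_add_rdistrib: "(B + C) ** (A::real^'n^'m) = B ** A + C ** A"
  by (simp add: matrix_matrix_mult_def vec_eq_iff distrib_right sum.distrib)

lemmas matrix_algebra = matrix_add_ldistrib matrix_add_rdistrib matrix_diff_ldistrib
  matrix_diff_rdistrib matrix_scalar_ac scalar_matrix_assoc[symmetric] matrix_mul_assoc

lemma matrix_vector_mult_minus_right: "A *v (- x) = - (A *v (x::real^'n))"
  using matrix_vector_mult_scaleR[of A "-1" x] by simp

lemma transpose_dot: "x \<bullet> (transpose A *v y) = (A *v x) \<bullet> (y::real^'n)"
  by (simp add: dot_lmul_matrix flip: vector_transpose_matrix)

lemma trace_transpose: "trace (transpose A) = trace (A :: real^'n^'n)"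
  by (simp add: trace_def transpose_def)

lemma inner_matrix_trace: "(A::real^'n^'m) \<bullet> B = trace (transpose A ** B)"
  by (simp add: inner_vec_def trace_def matrix_matrix_mult_def transpose_def) (rule sum.swap)

text \<open>A maximiser of the quadratic form on the unit sphere of \<open>S\<close> is an
  eigenvector, and self-adjointness makes its orthogonal complement in \<open>S\<close> invariant.
  General invariant subspaces are allowed so that the induction on the dimension applies to that
  complement.\<close>

lemma self_adjoint_eigenbasis:
  fixes f :: "'a::euclidean_space \<Rightarrow> 'a"
  assumes lin: "linear f" and adj: "\<And>x y. f x \<bullet> y = x \<bullet> f y"
    and S: "subspace S" "f ` S \<subseteq> S"
  shows "\<exists>B\<subseteq>S. finite B \<and> pairwise orthogonal B \<and> card B = dim S \<and>
    (\<forall>b\<in>B. norm b = 1 \<and> (\<exists>c. f b = c *\<^sub>R b))"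
  using S
proof (induction "dim S" arbitrary: S)
  case 0
  then show ?case
    by (intro exI[of _ "{}"]) auto
next
  case (Suc n)
  have contf: "continuous_on A f" for A
    using lin by (simp add: linear_continuous_on linear_conv_bounded_linear)
  define K where "K = sphere 0 1 \<inter> S"
  have "compact K"
    unfolding K_def using closed_subspace[OF Suc.prems(1)] by (intro compact_Int_closed) auto
  moreover have "K \<noteq> {}"
  proof -
    obtain x where x: "x \<in> S" "x \<noteq> 0"
      using Suc.hyps(2) dim_eq_0[of S] by (metis nat.distinct(1) singletonI subsetI)
    then have "x /\<^sub>R norm x \<in> K"
      using Suc.prems(1) by (auto simp: K_def subspace_scale)
    then show ?thesis by blast
  qed
  ultimately obtain v where v: "v \<in> K" and vmax: "\<And>x. x \<in> K \<Longrightarrow> x \<bullet> f x \<le> v \<bullet> f v"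
    using continuous_attains_sup[of K "\<lambda>x. x \<bullet> f x", OF _ _ continuous_on_inner[OF continuous_on_id contf]]
    by auto
  define l where "l = v \<bullet> f v"
  have v1: "norm v = 1" "v \<in> S" "v \<bullet> v = 1" using v by (auto simp: K_def norm_eq_1)
  have rq: "x \<bullet> f x \<le> l * (x \<bullet> x)" if "x \<in> S" for x
  proof (cases "x = 0")
    case False
    then have "x /\<^sub>R norm x \<in> K"
      using that Suc.prems(1) by (auto simp: K_def subspace_scale)
    from vmax[OF this] have "(x \<bullet> f x) / (norm x)\<^sup>2 \<le> l"
      using lin by (simp add: linear_scale l_def power2_eq_square field_simps)
    then show ?thesis
      using False by (simp add: divide_le_eq power2_norm_eq_inner)
  qed (use lin linear_0 in auto)
  have fadd: "f (x + y) = f x + f y" and fscale: "f (c *\<^sub>R x) = c *\<^sub>R f x" for x y c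
    using lin by (auto simp: linear_add linear_scale)
  \<comment> \<open>First order condition at the maximum, obtained without derivatives: comparing
    \<open>v\<close> with \<open>v + t *\<^sub>R w\<close> gives a quadratic inequality in
    \<open>t\<close> whose linear coefficient must vanish.\<close>
  have ortho: "w \<bullet> (f v - l *\<^sub>R v) = 0" if w: "w \<in> S" for w
  proof -
    define a b where "a = w \<bullet> (f v - l *\<^sub>R v)" and "b = l * (w \<bullet> w) - w \<bullet> f w"
    have ineq: "2 * t * a \<le> t\<^sup>2 * b" for t
    proof -
      have "v + t *\<^sub>R w \<in> S" using v1 w Suc.prems(1) by (simp add: subspace_add subspace_scale)
      from rq[OF this]
      have "v \<bullet> f v + t * (v \<bullet> f w) + t * (w \<bullet> f v) + t * t * (w \<bullet> f w)
          \<le> l * (1 + 2 * t * (v \<bullet> w) + t * t * (w \<bullet> w))"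
        by (simp add: fadd fscale inner_add_left inner_add_right v1 algebra_simps inner_commute)
      moreover have "v \<bullet> f w = w \<bullet> f v" using adj[of v w] by (simp add: inner_commute)
      ultimately show ?thesis
        by (simp add: a_def b_def l_def[symmetric] inner_diff_right algebra_simps power2_eq_square
            inner_commute)
    qed
    have "a = 0"
    proof (rule ccontr)
      assume a: "a \<noteq> 0"
      \<comment> \<open>The values 1 and -1 of \<open>t\<close> give b >= 2|a| > 0. The value a / b
        used next minimises t^2 b - 2 t a.\<close>
      then have b: "b > 0" using ineq[of 1] ineq[of "-1"] by simp
      have "2 * (a / b) * a \<le> (a / b)\<^sup>2 * b" by (rule ineq)
      then have "2 * a\<^sup>2 \<le> a\<^sup>2" using b by (simp add: power2_eq_square field_simps)
      then show False using a by simp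
    qed
    then show ?thesis by (simp add: a_def)
  qed
  have "f v - l *\<^sub>R v \<in> S"
    using Suc.prems v1 by (auto intro!: subspace_diff subspace_scale)
  then have fv: "f v = l *\<^sub>R v" using ortho inner_eq_zero_iff by force
  define S' where "S' = {x \<in> S. v \<bullet> x = 0}"
  have sub: "subspace S'"
    using Suc.prems(1) by (auto simp: S'_def subspace_def inner_add_right)
  have inv: "f ` S' \<subseteq> S'"
    using Suc.prems(2) by (auto simp: S'_def fv simp flip: adj)
  have "dim S = dim (S' \<union> {v})"
  proof -
    have "span (S' \<union> {v}) = S"
    proof
      show "span (S' \<union> {v}) \<subseteq> S"
        using v1 Suc.prems(1) by (intro span_minimal) (auto simp: S'_def)
      show "S \<subseteq> span (S' \<union> {v})"
      proof
        fix x assume "x \<in> S"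
        then have "x - (v \<bullet> x) *\<^sub>R v \<in> S'"
          using v1 Suc.prems(1) by (auto simp: S'_def inner_diff_right intro!: subspace_diff subspace_scale)
        then have "(x - (v \<bullet> x) *\<^sub>R v) + (v \<bullet> x) *\<^sub>R v \<in> span (S' \<union> {v})"
          by (intro span_add span_mul span_base) auto
        then show "x \<in> span (S' \<union> {v})" by simp
      qed
    qed
    then show ?thesis using dim_span by metis
  qed
  also have "\<dots> = dim S' + dim {v}"
    by (rule dim_orthogonal_sum) (auto simp: S'_def inner_commute)
  also have "dim {v} = 1" using v1 by (auto simp: dim_singleton)
  finally have "n = dim S'" using Suc.hyps(2) by simp
  from Suc.hyps(1)[OF this sub inv] obtain B where B: "B \<subseteq> S'" "finite B" "pairwise orthogonal B"
    "card B = dim S'" "\<forall>b\<in>B. norm b = 1 \<and> (\<exists>c. f b = c *\<^sub>R b)" by blast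
  have "v \<notin> B" using B(1) v1 by (auto simp: S'_def)
  show ?case
  proof (intro exI[of _ "insert v B"] conjI)
    show "insert v B \<subseteq> S" using B(1) v1 by (auto simp: S'_def)
    show "pairwise orthogonal (insert v B)"
      using B(1,3) by (auto simp: pairwise_insert S'_def orthogonal_def inner_commute)
    show "card (insert v B) = dim S"
      using B \<open>v \<notin> B\<close> \<open>n = dim S'\<close> Suc.hyps(2) by simp
    show "\<forall>b\<in>insert v B. norm b = 1 \<and> (\<exists>c. f b = c *\<^sub>R b)" using B(5) fv v1 by auto
  qed (use B in auto)
qed

section \<open>Diagonalisation and positive semi-definite matrices\<close>

definition diag :: "('n \<Rightarrow> real) \<Rightarrow> real^'n^'n" where
  "diag d = (\<chi> i j. if i = j then d i else 0)"

lemma diag_mult_vec: "diag d *v x = (\<chi> i. d i * x $ i)"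
  by (simp add: diag_def matrix_vector_mult_def if_distrib if_distribR vec_eq_iff cong: if_cong)

lemma diag_mult_diag: "diag a ** diag b = diag (\<lambda>i. a i * b i)"
  by (simp add: matrix_eq diag_mult_vec vec_eq_iff mult.assoc flip: matrix_vector_mul_assoc)

lemma transpose_diag [simp]: "transpose (diag d) = diag d"
  by (simp add: diag_def transpose_def vec_eq_iff)

lemma trace_diag [simp]: "trace (diag d) = sum d UNIV"
  by (simp add: diag_def trace_def)

lemma diag_one: "diag (\<lambda>_. 1) = mat 1"
  by (simp add: diag_def mat_def)

lemma orthogonal_matrix_inverse:
  assumes "orthogonal_matrix (U::real^'n^'n)"
  shows "transpose U ** U = mat 1" "U ** transpose U = mat 1"
    "A ** transpose U ** U = A" "A ** U ** transpose U = A"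
  using assms by (auto simp: orthogonal_matrix_def simp flip: matrix_mul_assoc)

lemma orthogonal_matrix_norm:
  assumes "orthogonal_matrix (U::real^'n^'n)"
  shows "norm (U *v x) = norm x"
proof -
  have "(U *v x) \<bullet> (U *v x) = x \<bullet> (transpose U ** U *v x)"
    by (simp add: transpose_dot flip: matrix_vector_mul_assoc)
  then show ?thesis using assms by (simp add: norm_eq orthogonal_matrix_inverse)
qed

lemma family_of_orthonormal_set:
  fixes B :: "(real^'n) set"
  assumes "finite B" "card B = CARD('n)"
  obtains v :: "'n \<Rightarrow> real^'n" where "bij_betw v UNIV B"
  using assms by (metis finite_same_card_bij finite_class.finite_UNIV)

lemma orthogonal_matrix_of_family:
  fixes v :: "'n \<Rightarrow> real^'n"
  assumes "\<And>i. norm (v i) = 1" "\<And>i j. i \<noteq> j \<Longrightarrow> orthogonal (v i) (v j)"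
  shows "orthogonal_matrix (\<chi> i j. v j $ i)"
proof -
  have "column j (\<chi> i j. v j $ i) = v j" for j by (simp add: column_def)
  then show ?thesis using assms by (simp add: orthogonal_matrix_orthonormal_columns)
qed

lemma matrix_columns_eqI:
  fixes A B :: "real^'n^'m"
  assumes "\<And>i. A *v axis i 1 = B *v axis i 1"
  shows "A = B"
  using assms by (simp add: vec_eq_iff matrix_vector_mult_basis column_def)

lemma symmetric_diagonalization:
  fixes A :: "real^'n^'n"
  assumes "transpose A = A"
  obtains U d where "orthogonal_matrix U" "A = U ** diag d ** transpose U"
proof -
  have adj: "(A *v x) \<bullet> y = x \<bullet> (A *v y)" for x y
    using transpose_dot[of x A y] assms by simp
  obtain B where B: "finite B" "pairwise orthogonal B" "card B = dim (UNIV :: (real^'n) set)"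
    "\<forall>b\<in>B. norm b = 1 \<and> (\<exists>c. A *v b = c *\<^sub>R b)"
    using self_adjoint_eigenbasis[of "(*v) A" UNIV, OF matrix_vector_mul_linear adj subspace_UNIV subset_UNIV]
    by blast
  have "card B = CARD('n)" using B(3) by simp
  obtain v :: "'n \<Rightarrow> real^'n" where v: "bij_betw v UNIV B"
    using family_of_orthonormal_set[OF B(1) \<open>card B = CARD('n)\<close>] .
  then have vB: "v i \<in> B" for i using bij_betwE by blast
  then have "\<forall>i. \<exists>c. A *v v i = c *\<^sub>R v i" using B(4) by blast
  then obtain d where d: "\<And>i. A *v v i = d i *\<^sub>R v i" using choice[of "\<lambda>i c. A *v v i = c *\<^sub>R v i"] by blast
  define U :: "real^'n^'n" where "U = (\<chi> i j. v j $ i)"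
  have U: "orthogonal_matrix U"
    unfolding U_def
  proof (rule orthogonal_matrix_of_family)
    show "norm (v i) = 1" for i using vB B(4) by auto
    show "orthogonal (v i) (v j)" if "i \<noteq> j" for i j
      using B(2) vB v that by (metis bij_betw_def injD pairwise_def)
  qed
  have Ui: "U *v axis i 1 = v i" for i
    by (simp add: U_def matrix_vector_mult_basis column_def)
  have "A ** U = U ** diag d"
  proof (rule matrix_columns_eqI)
    fix i :: 'n
    have "diag d *v axis i 1 = d i *\<^sub>R axis i 1"
      by (simp add: diag_mult_vec vec_eq_iff axis_def)
    then show "A ** U *v axis i 1 = U ** diag d *v axis i 1"
      by (simp add: d Ui matrix_vector_mult_scaleR flip: matrix_vector_mul_assoc)
  qed
  then have "A = U ** diag d ** transpose U"
    using orthogonal_matrix_inverse(4)[OF U, of A] by simp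
  with U show thesis using that by blast
qed

lemma diagonalization_dot:
  "x \<bullet> (U ** diag d ** transpose U *v x) = (\<Sum>i\<in>UNIV. d i * ((transpose U *v x) $ i)\<^sup>2)"
proof -
  have "x \<bullet> (U ** diag d ** transpose U *v x) = (transpose U *v x) \<bullet> (diag d *v (transpose U *v x))"
    using transpose_dot[of x "transpose U"] by (simp flip: matrix_vector_mul_assoc)
  then show ?thesis
    by (simp add: diag_mult_vec inner_vec_def power2_eq_square algebra_simps)
qed

lemma transpose_conj_diag: "transpose (U ** diag d ** transpose U) = U ** diag d ** transpose U"
  by (simp add: matrix_transpose_mul matrix_mul_assoc)

lemma psd_conj_diag: "(\<And>i. 0 \<le> d i) \<Longrightarrow> psd (U ** diag d ** transpose U)"
  by (simp add: psd_def transpose_conj_diag diagonalization_dot sum_nonneg)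

lemma psd_diagonalization:
  fixes A :: "real^'n^'n"
  assumes "psd A"
  obtains U d where "orthogonal_matrix U" "\<And>i. 0 \<le> d i" "A = U ** diag d ** transpose U"
proof -
  obtain U d where U: "orthogonal_matrix U" and A: "A = U ** diag d ** transpose U"
    using symmetric_diagonalization assms by (metis psd_def)
  have "0 \<le> d i" for i
  proof -
    have "transpose U *v (U *v axis i 1) = axis i 1"
      using orthogonal_matrix_inverse[OF U] by (simp add: matrix_vector_mul_assoc)
    then have "(U *v axis i 1) \<bullet> (A *v (U *v axis i 1)) = (\<Sum>j\<in>UNIV. d j * (axis i 1 $ j)\<^sup>2)"
      by (simp only: A diagonalization_dot)
    also have "\<dots> = (\<Sum>j\<in>UNIV. if j = i then d j else 0)"
      by (intro sum.cong) (auto simp: axis_def)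
    also have "\<dots> = d i" by simp
    finally show ?thesis using assms by (metis psd_def)
  qed
  then show thesis using that U A by blast
qed

lemma conj_diag_mult:
  "orthogonal_matrix (U::real^'n^'n) \<Longrightarrow>
    (U ** diag a ** transpose U) ** (U ** diag b ** transpose U) = U ** diag (\<lambda>i. a i * b i) ** transpose U"
  by (simp add: matrix_mul_assoc orthogonal_matrix_inverse) (simp add: diag_mult_diag flip: matrix_mul_assoc)

lemma trace_conj_diag:
  "orthogonal_matrix (U::real^'n^'n) \<Longrightarrow> trace (U ** diag d ** transpose U) = sum d UNIV"
  by (subst trace_mul_sym) (simp add: matrix_mul_assoc orthogonal_matrix_inverse)

lemma psd_null_iff:
  assumes "psd B" shows "x \<bullet> (B *v x) = 0 \<longleftrightarrow> B *v x = 0"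
proof
  assume 0: "x \<bullet> (B *v x) = 0"
  obtain U d where U: "orthogonal_matrix U" "\<And>i. 0 \<le> d i" "B = U ** diag d ** transpose U"
    using psd_diagonalization[OF assms] by blast
  have "\<forall>i\<in>UNIV. d i * ((transpose U *v x) $ i)\<^sup>2 = 0"
    using 0 U(2) unfolding U(3) diagonalization_dot by (subst (asm) sum_nonneg_eq_0_iff) auto
  then have "diag d *v (transpose U *v x) = 0" by (simp add: diag_mult_vec vec_eq_iff)
  then show "B *v x = 0" by (simp add: U(3) flip: matrix_vector_mul_assoc)
qed simp

text \<open>No simultaneous diagonalisation is needed. If \<open>v\<close> is an eigenvector of
  \<open>C\<close> for the eigenvalue d, then B (B v) = d^2 v, so w = B v - d v satisfies B w = - d
  w. As \<open>B\<close> has no negative eigenvalue, w = 0 when d > 0.\<close>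

lemma psd_sqrt_unique:
  assumes B: "psd B" and C: "psd C" and eq: "B ** B = C ** C"
  shows "B = (C :: real^'n^'n)"
proof -
  obtain U d where U: "orthogonal_matrix U" "\<And>i. 0 \<le> d i" "C = U ** diag d ** transpose U"
    using psd_diagonalization[OF C] by blast
  have CU: "C ** U = U ** diag d" by (simp add: U(3) orthogonal_matrix_inverse[OF U(1)])
  have "B ** U = U ** diag d"
  proof (rule matrix_columns_eqI)
    fix i
    define v where "v = U *v axis i 1"
    have Di: "diag d *v axis i 1 = d i *\<^sub>R axis i 1"
      by (simp add: diag_mult_vec vec_eq_iff axis_def)
    have Cv: "C *v v = d i *\<^sub>R v"
      using CU Di by (metis matrix_vector_mul_assoc matrix_vector_mult_scaleR v_def)
    have BBv: "B *v (B *v v) = (d i * d i) *\<^sub>R v"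
      using Cv eq by (metis matrix_vector_mul_assoc matrix_vector_mult_scaleR scaleR_scaleR)
    define w where "w = B *v v - d i *\<^sub>R v"
    have "B *v w = - (d i *\<^sub>R w)"
      by (simp add: w_def matrix_vector_mult_diff_distrib BBv matrix_vector_mult_scaleR
          scaleR_diff_right)
    then have "w \<bullet> (B *v w) = - (d i * (w \<bullet> w))" by simp
    moreover have "0 \<le> w \<bullet> (B *v w)" using B by (simp add: psd_def)
    ultimately have z: "d i * (w \<bullet> w) = 0" using U(2)[of i]
      by (smt (verit) inner_ge_zero mult_nonneg_nonneg)
    have "w = 0"
    \<comment> \<open>For eigenvalue 0 the identity \<open>z\<close> is void. Here |B v|^2 = v . B
      (B v) = 0 gives the claim instead.\<close>
    proof (cases "d i = 0")
      case True
      have "(B *v v) \<bullet> (B *v v) = v \<bullet> (B *v (B *v v))"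
        using B transpose_dot[of v B "B *v v"] by (simp add: psd_def)
      then have "(B *v v) \<bullet> (B *v v) = 0" using BBv True by simp
      then show ?thesis by (simp add: w_def True)
    qed (use z in auto)
    then show "B ** U *v axis i 1 = U ** diag d *v axis i 1"
      by (simp add: w_def v_def Di matrix_vector_mult_scaleR flip: matrix_vector_mul_assoc)
  qed
  then show ?thesis
    using CU orthogonal_matrix_inverse[OF U(1)] by metis
qed

lemma psd_sqrt_eqI: "psd B \<Longrightarrow> B ** B = A \<Longrightarrow> psd_sqrt A = B"
  unfolding psd_sqrt_def by (rule the_equality) (auto intro: psd_sqrt_unique)

lemma psd_sqrt:
  assumes "psd (A :: real^'n^'n)"
  shows psd_psd_sqrt: "psd (psd_sqrt A)" and psd_sqrt_mult_self: "psd_sqrt A ** psd_sqrt A = A"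
proof -
  obtain U d where U: "orthogonal_matrix U" "\<And>i. 0 \<le> d i" "A = U ** diag d ** transpose U"
    using psd_diagonalization[OF assms] by blast
  define B where "B = U ** diag (\<lambda>i. sqrt (d i)) ** transpose U"
  have "psd B" unfolding B_def using U(2) by (intro psd_conj_diag) simp
  moreover have "B ** B = A" using U by (simp add: B_def conj_diag_mult)
  ultimately show "psd (psd_sqrt A)" "psd_sqrt A ** psd_sqrt A = A" using psd_sqrt_eqI by metis+
qed

lemma psd_mult_transpose: "psd (B ** transpose (B :: real^'n^'n))"
  using transpose_dot[of _ "transpose B" "transpose B *v _"]
  by (auto simp: psd_def matrix_transpose_mul simp flip: matrix_vector_mul_assoc)

lemma psd_transpose_mult: "psd (transpose B ** (B :: real^'n^'n))"
  using psd_mult_transpose[of "transpose B"] by simp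

lemma psd_congruence: "psd A \<Longrightarrow> psd (transpose B ** A ** (B :: real^'n^'n))"
  using transpose_dot[of _ B "A *v (B *v _)"]
  by (auto simp: psd_def matrix_transpose_mul matrix_mul_assoc simp flip: matrix_vector_mul_assoc)

lemma psd_add: "psd A \<Longrightarrow> psd B \<Longrightarrow> psd (A + B)"
  by (simp add: psd_def transpose_add matrix_vector_mult_add_rdistrib inner_add_right)

lemma psd_scaleR: "psd A \<Longrightarrow> 0 \<le> c \<Longrightarrow> psd (c *\<^sub>R A)"
  by (simp add: psd_def transpose_scalar inner_scaleR_right flip: scaleR_matrix_vector_assoc)

lemma psd_symmetric: "psd A \<Longrightarrow> transpose A = A"
  by (simp add: psd_def)

lemma psd_trace_eq_0:
  assumes "psd (A :: real^'n^'n)" "trace A = 0" shows "A = 0"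
proof -
  obtain U d where U: "orthogonal_matrix U" "\<And>i. 0 \<le> d i" "A = U ** diag d ** transpose U"
    using psd_diagonalization[OF assms(1)] by blast
  have "sum d UNIV = 0" using assms(2) U trace_conj_diag by metis
  then have "\<And>i. d i = 0" using U(2) by (simp add: sum_nonneg_eq_0_iff)
  then have "diag d = 0" by (simp add: diag_def vec_eq_iff)
  then show ?thesis unfolding U(3) by simp
qed

lemma psd_trace_nonneg:
  assumes "psd (A :: real^'n^'n)" shows "0 \<le> trace A"
proof -
  obtain U d where U: "orthogonal_matrix U" "\<And>i. 0 \<le> d i" "A = U ** diag d ** transpose U"
    using psd_diagonalization[OF assms] by blast
  then show ?thesis unfolding U(3) trace_conj_diag[OF U(1)] by (intro sum_nonneg)
qed

subsection \<open>Singular values and contractions\<close>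

text \<open>The nonzero \<open>w i\<close> are normalised, and each zero vector is replaced by a
  unit vector from the orthogonal complement of the others. Counting dimensions shows that exactly
  enough are available. This supplies the left singular vectors for vanishing singular
  values.\<close>

lemma orthogonal_family_normalization:
  fixes w :: "'n \<Rightarrow> real^'n"
  assumes ortho: "\<And>i j. i \<noteq> j \<Longrightarrow> orthogonal (w i) (w j)"
  shows "\<exists>u :: 'n \<Rightarrow> real^'n. (\<forall>i. norm (u i) = 1) \<and> (\<forall>i j. i \<noteq> j \<longrightarrow> orthogonal (u i) (u j)) \<and>
    (\<forall>i. w i = norm (w i) *\<^sub>R u i)"
proof -
  define I where "I = {i. w i \<noteq> 0}"
  define S where "S = span (w ` I)"
  define C where "C = {x. \<forall>y\<in>S. orthogonal y x}"
  have "subspace C" by (auto simp: C_def subspace_def orthogonal_def inner_add_right)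
  then obtain B where B: "B \<subseteq> C" "pairwise orthogonal B" "\<And>x. x \<in> B \<Longrightarrow> norm x = 1"
    "independent B" "card B = dim C" using orthonormal_basis_subspace[of C] by metis
  have inj: "inj_on w I"
  proof (rule inj_onI, rule ccontr)
    fix i j assume "i \<in> I" "w i = w j" "i \<noteq> j"
    then show False using ortho[of i j] by (simp add: I_def orthogonal_def)
  qed
  have po: "pairwise orthogonal (w ` I)"
    unfolding pairwise_def by clarsimp (metis ortho)
  have "independent (w ` I)"
    using po by (rule pairwise_orthogonal_independent) (auto simp: I_def)
  then have "dim S = card I"
    by (simp add: S_def dim_span dim_eq_card_independent card_image inj)
  moreover have "dim C + dim S = CARD('n)"
    using dim_subspace_orthogonal_to_vectors[of S UNIV] by (simp add: C_def S_def)
  ultimately have "card B = card (- I)"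
    using B(5) by (simp add: Compl_eq_Diff_UNIV card_Diff_subset)
  moreover have "finite B" using B(4) independent_imp_finite by blast
  ultimately obtain h where h: "bij_betw h (- I) B"
    by (metis finite finite_same_card_bij)
  define u where "u i = (if i \<in> I then w i /\<^sub>R norm (w i) else h i)" for i
  have hB: "h i \<in> B" if "i \<notin> I" for i using h that by (auto simp: bij_betw_def)
  have wh: "orthogonal (w i) (h j)" if "i \<in> I" "j \<notin> I" for i j
  proof -
    have "w i \<in> S" unfolding S_def using that by (intro span_base) auto
    moreover have "h j \<in> C" using hB[OF that(2)] B(1) by auto
    ultimately show ?thesis by (auto simp: C_def)
  qed
  show ?thesis
  proof (intro exI[of _ u] conjI allI impI)
    show "norm (u i) = 1" for i using hB B(3) by (auto simp: u_def I_def)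
    show "w i = norm (w i) *\<^sub>R u i" for i by (simp add: u_def I_def)
    show "orthogonal (u i) (u j)" if "i \<noteq> j" for i j
    proof (cases "i \<in> I"; cases "j \<in> I")
      assume "i \<notin> I" "j \<notin> I"
      then have "h i \<noteq> h j" using h that by (auto simp: bij_betw_def inj_on_def)
      then show ?thesis using B(2) hB \<open>i \<notin> I\<close> \<open>j \<notin> I\<close> by (auto simp: u_def pairwise_def)
    qed (use wh ortho[OF that] in \<open>auto simp: u_def orthogonal_clauses orthogonal_commute\<close>)
  qed
qed

text \<open>If \<open>V\<close> diagonalises M^T M, the columns of M V are orthogonal. Their lengths
  are the singular values and their directions, completed where the length is 0, are the columns of
  \<open>U\<close>.\<close>

lemma singular_value_decomposition:
  fixes M :: "real^'n^'n"
  obtains U V d where "orthogonal_matrix U" "orthogonal_matrix V" "\<And>i. 0 \<le> d i"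
    "M = U ** diag d ** transpose V"
proof -
  obtain V e where V: "orthogonal_matrix V" and MM: "transpose M ** M = V ** diag e ** transpose V"
    using psd_diagonalization[OF psd_transpose_mult] by blast
  define w where "w i = M *v (V *v axis i 1)" for i
  have dot: "w i \<bullet> w j = diag e $ i $ j" for i j
  proof -
    have "transpose V ** (transpose M ** M) ** V = diag e"
      by (simp add: MM matrix_mul_assoc orthogonal_matrix_inverse[OF V])
    moreover have "w i \<bullet> w j = axis i 1 \<bullet> ((transpose V ** (transpose M ** M) ** V) *v axis j 1)"
      unfolding w_def by (simp add: transpose_dot flip: matrix_vector_mul_assoc)
    ultimately show ?thesis
      by (simp add: inner_axis' matrix_vector_mult_basis column_def)
  qed
  have "orthogonal (w i) (w j)" if "i \<noteq> j" for i j
    using dot[of i j] that by (simp add: orthogonal_def diag_def)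
  from orthogonal_family_normalization[of w, OF this]
  obtain u where u: "\<And>i. norm (u i) = 1" "\<And>i j. i \<noteq> j \<Longrightarrow> orthogonal (u i) (u j)"
    "\<And>i. w i = norm (w i) *\<^sub>R u i" by auto
  define U :: "real^'n^'n" where "U = (\<chi> i j. u j $ i)"
  have U: "orthogonal_matrix U"
    unfolding U_def using u by (intro orthogonal_matrix_of_family)
  have "M ** V = U ** diag (\<lambda>i. norm (w i))"
  proof (rule matrix_columns_eqI)
    fix i
    have "diag (\<lambda>i. norm (w i)) *v axis i 1 = norm (w i) *\<^sub>R axis i 1"
      by (simp add: diag_mult_vec vec_eq_iff axis_def)
    moreover have "U *v axis i 1 = u i"
      by (simp add: U_def matrix_vector_mult_basis column_def)
    ultimately show "M ** V *v axis i 1 = U ** diag (\<lambda>i. norm (w i)) *v axis i 1"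
      using u(3)[of i] by (simp add: w_def matrix_vector_mult_scaleR flip: matrix_vector_mul_assoc)
  qed
  then have "M = U ** diag (\<lambda>i. norm (w i)) ** transpose V"
    using orthogonal_matrix_inverse(4)[OF V, of M] by simp
  then show thesis by (intro that[OF U V]) auto
qed

lemma svd_psd_sqrt_left:
  assumes "orthogonal_matrix U" "orthogonal_matrix V" "\<And>i. 0 \<le> d i" "M = U ** diag d ** transpose V"
  shows "psd_sqrt (M ** transpose M) = U ** diag d ** transpose (U::real^'n^'n)"
proof (rule psd_sqrt_eqI)
  show "psd (U ** diag d ** transpose U)" using assms(3) by (rule psd_conj_diag)
  show "U ** diag d ** transpose U ** (U ** diag d ** transpose U) = M ** transpose M"
    using assms(1,2) by (simp add: assms(4) matrix_transpose_mul matrix_mul_assoc orthogonal_matrix_inverse)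
qed

lemma svd_psd_sqrt_right:
  assumes "orthogonal_matrix U" "orthogonal_matrix V" "\<And>i. 0 \<le> d i" "M = U ** diag d ** transpose V"
  shows "psd_sqrt (transpose M ** M) = V ** diag d ** transpose (V::real^'n^'n)"
proof -
  have "transpose M = V ** diag d ** transpose U"
    by (simp add: assms(4) matrix_transpose_mul matrix_mul_assoc)
  from svd_psd_sqrt_left[OF assms(2,1,3) this] show ?thesis by simp
qed

section \<open>Contractions, traces and factorisations\<close>

definition contraction :: "real^'n^'n \<Rightarrow> bool" where
  "contraction K \<longleftrightarrow> (\<forall>x. norm (K *v x) \<le> norm x)"

lemma contraction_mult: "contraction A \<Longrightarrow> contraction B \<Longrightarrow> contraction (A ** B)"
  unfolding contraction_def by (simp flip: matrix_vector_mul_assoc) (meson order_trans)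

lemma orthogonal_matrix_contraction: "orthogonal_matrix U \<Longrightarrow> contraction U"
  by (simp add: contraction_def orthogonal_matrix_norm)

lemma contraction_diag_le:
  assumes "contraction K" shows "K $ i $ i \<le> 1"
proof -
  have "K $ i $ i = (K *v axis i 1) $ i" by (simp add: matrix_vector_mult_basis column_def)
  also have "\<dots> \<le> norm (K *v axis i 1)" using component_le_norm_cart[of "K *v axis i 1" i] by simp
  also have "\<dots> \<le> norm (axis i 1 :: real^'a)" using assms contraction_def by blast
  finally show ?thesis by (simp add: norm_axis_1)
qed

lemma contractionI_bilinear:
  assumes "\<And>u v. u \<bullet> (K *v v) \<le> norm u * norm v"
  shows "contraction K"
  unfolding contraction_def
proof
  fix x
  have "norm (K *v x) * norm (K *v x) \<le> norm (K *v x) * norm x"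
    using assms[of "K *v x" x] by (simp add: power2_norm_eq_inner[symmetric] power2_eq_square)
  then show "norm (K *v x) \<le> norm x"
    by (cases "norm (K *v x) = 0") (auto simp: mult_le_cancel_left)
qed

lemma contraction_bilinear: "contraction K \<Longrightarrow> u \<bullet> (K *v v) \<le> norm u * norm v"
  unfolding contraction_def
  by (meson mult_left_mono norm_cauchy_schwarz norm_ge_zero order_trans)

lemma contraction_transpose: "contraction K \<Longrightarrow> contraction (transpose K)"
proof (rule contractionI_bilinear)
  fix u v assume K: "contraction K"
  have "u \<bullet> (transpose K *v v) = v \<bullet> (K *v u)" by (simp add: transpose_dot inner_commute)
  then show "u \<bullet> (transpose K *v v) \<le> norm u * norm v"
    using contraction_bilinear[OF K, of v u] by (simp add: mult.commute)
qed

lemma trace_diag_mult: "trace (diag d ** A) = (\<Sum>i\<in>UNIV. d i * A $ i $ i)"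
  by (simp add: trace_def diag_def matrix_matrix_mult_def if_distrib if_distribR cong: if_cong)

text \<open>Duality of nuclear and operator norm: the singular value decomposition turns the trace
  into a sum of singular values weighted by diagonal entries of a contraction. Both products of
  \<open>M\<close> with its transpose occur because they have the same singular values and each is
  met in a later application.\<close>

lemma trace_mult_contraction_le:
  fixes M :: "real^'n^'n"
  assumes "contraction K"
  shows "trace (M ** K) \<le> trace (psd_sqrt (M ** transpose M))"
    and "trace (M ** K) \<le> trace (psd_sqrt (transpose M ** M))"
proof -
  obtain U V d where M: "orthogonal_matrix U" "orthogonal_matrix V" "\<And>i. 0 \<le> d i"
    "M = U ** diag d ** transpose V" using singular_value_decomposition[of M] by blast
  have "trace (M ** K) = trace (U ** (diag d ** (transpose V ** K)))"
    by (simp add: M(4) matrix_mul_assoc)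
  also have "\<dots> = trace (diag d ** (transpose V ** K ** U))"
    by (subst trace_mul_sym) (simp add: matrix_mul_assoc)
  also have "\<dots> = (\<Sum>i\<in>UNIV. d i * (transpose V ** K ** U) $ i $ i)" by (rule trace_diag_mult)
  also have "\<dots> \<le> (\<Sum>i\<in>UNIV. d i * 1)"
    using assms M by (intro sum_mono mult_left_mono contraction_diag_le contraction_mult)
      (auto intro: orthogonal_matrix_contraction)
  finally have *: "trace (M ** K) \<le> sum d UNIV" by simp
  show "trace (M ** K) \<le> trace (psd_sqrt (M ** transpose M))"
    using * unfolding svd_psd_sqrt_left[OF M] trace_conj_diag[OF M(1)] .
  show "trace (M ** K) \<le> trace (psd_sqrt (transpose M ** M))"
    using * unfolding svd_psd_sqrt_right[OF M] trace_conj_diag[OF M(2)] .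
qed

text \<open>Equality in the duality bound: the rotation V U^T undoes the two orthogonal factors of
  \<open>M\<close>.\<close>

lemma trace_mult_orthogonal_attained:
  fixes M :: "real^'n^'n"
  obtains Q where "orthogonal_matrix Q" "trace (M ** Q) = trace (psd_sqrt (M ** transpose M))"
proof -
  obtain U V d where M: "orthogonal_matrix U" "orthogonal_matrix V" "\<And>i. 0 \<le> d i"
    "M = U ** diag d ** transpose V" using singular_value_decomposition[of M] by blast
  have "M ** (V ** transpose U) = U ** diag d ** transpose U"
    using M(1,2) by (simp add: M(4) matrix_mul_assoc orthogonal_matrix_inverse)
  then show thesis
    using that[of "V ** transpose U"] M(1,2) by (simp add: orthogonal_matrix_mul svd_psd_sqrt_left[OF M])
qed

lemma polar_decomposition:
  fixes M :: "real^'n^'n"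
  obtains Q where "orthogonal_matrix Q" "M = psd_sqrt (M ** transpose M) ** Q"
proof -
  obtain U V d where M: "orthogonal_matrix U" "orthogonal_matrix V" "\<And>i. 0 \<le> d i"
    "M = U ** diag d ** transpose V" using singular_value_decomposition[of M] by blast
  have "(U ** diag d ** transpose U) ** (U ** transpose V) = M"
    using M(1,2) by (simp add: M(4) matrix_mul_assoc orthogonal_matrix_inverse)
  then show thesis
    using that[of "U ** transpose V"] M(1,2) by (simp add: orthogonal_matrix_mul svd_psd_sqrt_left[OF M])
qed

text \<open>Since \<open>inverse 0 = 0\<close>, inverting the eigenvalues gives the Moore--Penrose inverse.\<close>

lemma psd_pseudoinverse:
  assumes "psd (S :: real^'n^'n)"
  obtains T where "transpose T = T" "S ** T ** S = S" "contraction (S ** T)" "contraction (T ** S)"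
proof -
  obtain U d where U: "orthogonal_matrix U" "\<And>i. 0 \<le> d i" "S = U ** diag d ** transpose U"
    using psd_diagonalization[OF assms] by blast
  define T where "T = U ** diag (\<lambda>i. inverse (d i)) ** transpose U"
  have T: "transpose T = T" unfolding T_def by (rule transpose_conj_diag)
  have ST: "S ** T = U ** diag (\<lambda>i. d i * inverse (d i)) ** transpose U"
    using U by (simp add: T_def conj_diag_mult)
  have "S ** T ** S = U ** diag (\<lambda>i. d i * inverse (d i) * d i) ** transpose U"
    unfolding ST unfolding U(3) by (rule conj_diag_mult[OF U(1)])
  also have "(\<lambda>i. d i * inverse (d i) * d i) = d"
  proof
    show "d i * inverse (d i) * d i = d i" for i by (cases "d i = 0") auto
  qed
  finally have STS: "S ** T ** S = S" using U(3) by simp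
  have "contraction (diag (\<lambda>i. d i * inverse (d i)))"
    unfolding contraction_def diag_mult_vec
  proof
    fix x :: "real^'n"
    show "norm (\<chi> i. d i * inverse (d i) * x $ i) \<le> norm x"
    proof (rule norm_le_componentwise_cart)
      show "norm ((\<chi> i. d i * inverse (d i) * x $ i) $ i) \<le> norm (x $ i)" for i
        by (cases "d i = 0") auto
    qed
  qed
  then have c: "contraction (S ** T)"
    unfolding ST using U by (intro contraction_mult) (auto intro: orthogonal_matrix_contraction)
  have "transpose (S ** T) = T ** S"
    using T psd_symmetric[OF assms] by (simp add: matrix_transpose_mul)
  then have "contraction (T ** S)" using contraction_transpose[OF c] by simp
  with that T STS c show thesis by blast
qed

lemma matrix_eqI_dot:
  assumes "\<And>u v. u \<bullet> (A *v v) = u \<bullet> (B *v v)" shows "A = (B :: real^'n^'m)"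
proof -
  have "A *v v = B *v v" for v using assms[of _ v] vector_eq_ldot by blast
  then show ?thesis by (simp add: matrix_eq)
qed

text \<open>A two-sided Douglas factorisation. The candidate K = R' C S' uses pseudoinverses. The
  bound forces \<open>C\<close> to vanish whenever one argument lies in the kernel of
  \<open>R\<close> or \<open>S\<close>, so replacing u by R' R u and v by S' S v does not change the
  form.\<close>

lemma contraction_factorization:
  fixes R S C :: "real^'n^'n"
  assumes R: "psd R" and S: "psd S"
    and C: "\<And>u v. u \<bullet> (C *v v) \<le> norm (R *v u) * norm (S *v v)"
  obtains K where "contraction K" "C = R ** K ** S"
proof -
  obtain R' where R': "transpose R' = R'" "R ** R' ** R = R" "contraction (R ** R')"
    using psd_pseudoinverse[OF R] by blast
  obtain S' where S': "transpose S' = S'" "S ** S' ** S = S" "contraction (S ** S')"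
    using psd_pseudoinverse[OF S] by blast
  have Rt: "transpose R = R" using R by (rule psd_symmetric)
  \<comment> \<open>The bound is 0 in this case, and applying it to the opposite sign of
    \<open>u\<close> or \<open>v\<close> gives the reverse inequality.\<close>
  have C0: "u \<bullet> (C *v v) = 0" if "R *v u = 0 \<or> S *v v = 0" for u v
    using C[of u v] C[of "-u" v] that by (auto simp: matrix_vector_mult_minus_right)
  define K where "K = R' ** C ** S'"
  have "contraction K"
  proof (rule contractionI_bilinear)
    fix u v
    have "u \<bullet> (K *v v) = (R' *v u) \<bullet> (C *v (S' *v v))"
      using R'(1) transpose_dot[of u R'] by (simp add: K_def flip: matrix_vector_mul_assoc)
    also have "\<dots> \<le> norm (R *v (R' *v u)) * norm (S *v (S' *v v))" by (rule C)
    also have "\<dots> \<le> norm u * norm v"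
      using R'(3) S'(3) by (intro mult_mono) (auto simp: contraction_def matrix_vector_mul_assoc)
    finally show "u \<bullet> (K *v v) \<le> norm u * norm v" .
  qed
  moreover have "C = R ** K ** S"
  proof -
    have r: "R *v (u - R' *v (R *v u)) = 0" for u
      by (simp add: matrix_vector_mult_diff_distrib matrix_vector_mul_assoc R'(2) matrix_mul_assoc)
    have s: "S *v (v - S' *v (S *v v)) = 0" for v
      by (simp add: matrix_vector_mult_diff_distrib matrix_vector_mul_assoc S'(2) matrix_mul_assoc)
    have "u \<bullet> (C *v v) = u \<bullet> (R ** K ** S *v v)" for u v
    proof -
      have "u \<bullet> (R ** K ** S *v v) = (R' *v (R *v u)) \<bullet> (C *v (S' *v (S *v v)))"
        using transpose_dot[of u R] transpose_dot[of "R *v u" R'] Rt R'(1)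
        by (simp add: K_def flip: matrix_vector_mul_assoc)
      also have "\<dots> = u \<bullet> (C *v (S' *v (S *v v))) - (u - R' *v (R *v u)) \<bullet> (C *v (S' *v (S *v v)))"
        by (simp add: inner_diff_left)
      also have "\<dots> = u \<bullet> (C *v (S' *v (S *v v)))" using C0 r by simp
      also have "\<dots> = u \<bullet> (C *v v) - u \<bullet> (C *v (v - S' *v (S *v v)))"
        by (simp add: inner_diff_right matrix_vector_mult_diff_distrib)
      also have "\<dots> = u \<bullet> (C *v v)" using C0 s by simp
      finally show ?thesis by simp
    qed
    then show ?thesis by (rule matrix_eqI_dot)
  qed
  ultimately show thesis using that by blast
qed

text \<open>Link from covariances to Gelbrich's expression: trace (R K S) = trace (S R K), and (S
  R)^T (S R) = R S^2 R is the matrix under the root.\<close>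

lemma trace_le_of_bilinear_bound:
  fixes R S C :: "real^'n^'n"
  assumes R: "psd R" and S: "psd S"
    and C: "\<And>u v. u \<bullet> (C *v v) \<le> norm (R *v u) * norm (S *v v)"
  shows "trace C \<le> trace (psd_sqrt (R ** (S ** S) ** R))"
proof -
  obtain K where K: "contraction K" "C = R ** K ** S" using contraction_factorization[OF assms] .
  have "trace C = trace ((S ** R) ** K)"
    unfolding K(2) by (subst trace_mul_sym) (simp add: matrix_mul_assoc)
  also have "\<dots> \<le> trace (psd_sqrt (transpose (S ** R) ** (S ** R)))"
    by (rule trace_mult_contraction_le[OF K(1)])
  finally show ?thesis
    using psd_symmetric[OF R] psd_symmetric[OF S] by (simp add: matrix_transpose_mul matrix_mul_assoc)
qed

lemma norm_psd_mult: "psd S \<Longrightarrow> (norm (S *v x))\<^sup>2 = x \<bullet> ((S ** S) *v x)"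
  using transpose_dot[of x S "S *v x"] psd_symmetric[of S]
  by (simp add: power2_norm_eq_inner flip: matrix_vector_mul_assoc)

text \<open>Douglas factorisation with the identity as right factor. For square roots, the
  hypothesis is the Loewner order of their squares.\<close>

lemma contraction_of_mult_le:
  fixes R S :: "real^'n^'n"
  assumes R: "psd R" and S: "psd S" and le: "\<And>x. norm (R *v x) \<le> norm (S *v x)"
  obtains K where "contraction K" "R = S ** K"
proof -
  have id: "psd (mat 1 :: real^'n^'n)" by (simp add: psd_def)
  have "u \<bullet> (R *v v) \<le> norm (S *v u) * norm (mat 1 *v v)" for u v
  proof -
    have "u \<bullet> (R *v v) = (R *v u) \<bullet> v" using transpose_dot[of u R v] psd_symmetric[OF R] by simp
    also have "\<dots> \<le> norm (R *v u) * norm v" by (rule norm_cauchy_schwarz)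
    also have "\<dots> \<le> norm (S *v u) * norm v" by (intro mult_right_mono le) simp
    finally show ?thesis by simp
  qed
  then show thesis
    using contraction_factorization[OF S id, of R] that by auto
qed

lemma sum_scaleR_matrix_mult:
  fixes D :: "'a \<Rightarrow> real^'n^'m" and U :: "real^'m^'k" and W :: "real^'l^'n"
  assumes "finite P"
  shows "(\<Sum>x\<in>P. c x *\<^sub>R (U ** D x ** W)) = U ** (\<Sum>x\<in>P. c x *\<^sub>R D x) ** W"
  using assms by (induction P rule: finite_induct) (simp_all add: matrix_algebra)

text \<open>A cube is the convex hull of its vertices, so a diagonal contraction is a mixture of reflections.\<close>

lemma contraction_convex_combination:
  assumes "contraction (K :: real^'n^'n)"
  obtains S :: "(real^'n^'n) set" and c where "finite S" "\<forall>Q\<in>S. orthogonal_matrix Q"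
    "\<forall>Q\<in>S. 0 \<le> c Q" "sum c S = 1" "K = (\<Sum>Q\<in>S. c Q *\<^sub>R Q)"
proof -
  obtain U V d where K: "orthogonal_matrix U" "orthogonal_matrix V" "\<And>i. 0 \<le> d i"
    "K = U ** diag d ** transpose V" using singular_value_decomposition[of K] by blast
  have d1: "d i \<le> 1" for i
  proof -
    have "diag d = transpose U ** K ** V"
      by (simp add: K(4) matrix_mul_assoc orthogonal_matrix_inverse K(1,2))
    moreover have "contraction (transpose U ** K ** V)"
      using K(1,2) assms by (simp add: contraction_mult orthogonal_matrix_contraction)
    ultimately have "contraction (diag d)" by simp
    from contraction_diag_le[OF this, of i] show ?thesis by (simp add: diag_def)
  qed
  \<comment> \<open>The map x -> 2 x - 1 carries the vertices of the unit cube to sign vectors, so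
    \<open>F\<close> sends each vertex to an orthogonal matrix and is affine in
    \<open>x\<close>.\<close>
  define F where "F x = U ** diag (\<lambda>i. 2 * x $ i - 1) ** transpose V" for x :: "real^'n"
  define P where "P = {x :: real^'n. \<forall>i. x $ i = 0 \<or> x $ i = 1}"
  have "finite P"
  proof -
    have "P \<subseteq> (\<lambda>A. \<chi> i. if i \<in> A then 1 else 0) ` (UNIV :: 'n set set)"
    proof
      fix x assume "x \<in> P"
      then have "x = (\<chi> i. if i \<in> {i. x $ i = 1} then 1 else 0)"
        by (auto simp: P_def vec_eq_iff)
      then show "x \<in> (\<lambda>A. \<chi> i. if i \<in> A then 1 else 0) ` (UNIV :: 'n set set)" by blast
    qed
    then show ?thesis by (rule finite_subset) simp
  qed
  \<comment> \<open>This point of the unit cube is the preimage of the singular values: 2 y - 1 =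
    d.\<close>
  define y :: "real^'n" where "y = (\<chi> i. (d i + 1) / 2)"
  have "0 \<le> y \<bullet> b \<and> y \<bullet> b \<le> 1" if "b \<in> Basis" for b
  proof -
    obtain i where "b = axis i 1" using \<open>b \<in> Basis\<close> by (auto simp: Basis_vec_def)
    then have "y \<bullet> b = (d i + 1) / 2" by (simp add: y_def inner_axis)
    then show ?thesis using K(3)[of i] d1[of i] by simp
  qed
  then have "y \<in> cbox 0 One" by (simp add: mem_box)
  moreover have "P = {x. \<forall>b\<in>Basis. x \<bullet> b = 0 \<or> x \<bullet> b = 1}"
    by (auto simp: P_def Basis_vec_def inner_axis)
  ultimately have "y \<in> convex hull P" by (simp add: unit_interval_convex_hull)
  then obtain c where c: "\<forall>x\<in>P. 0 \<le> c x" "sum c P = 1" "(\<Sum>x\<in>P. c x *\<^sub>R x) = y"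
    by (auto simp: convex_hull_finite[OF \<open>finite P\<close>])
  \<comment> \<open>Injectivity lets the weights move from the vertices to a set of matrices without
    merging terms.\<close>
  have "inj_on F P"
  proof (rule inj_onI)
    fix x x' assume "F x = F x'"
    then have "transpose U ** F x ** V = transpose U ** F x' ** V" by simp
    then have "diag (\<lambda>i. 2 * x $ i - 1) = diag (\<lambda>i. 2 * x' $ i - 1)"
      by (simp add: F_def matrix_mul_assoc orthogonal_matrix_inverse K)
    then show "x = x'" by (simp add: vec_eq_iff diag_def) (metis add_right_cancel diff_add_cancel mult_cancel_left zero_neq_numeral)
  qed
  have orth: "orthogonal_matrix (F x)" if "x \<in> P" for x
  proof -
    have "(2 * x $ i - 1) * (2 * x $ i - 1) = 1" for i
      using that by (cases "x $ i = 0") (auto simp: P_def)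
    then have "diag (\<lambda>i. 2 * x $ i - 1) ** diag (\<lambda>i. 2 * x $ i - 1) = mat 1"
      by (simp add: diag_mult_diag diag_one)
    then have "orthogonal_matrix (diag (\<lambda>i. 2 * x $ i - 1))" by (simp add: orthogonal_matrix)
    then show ?thesis using K by (simp add: F_def orthogonal_matrix_mul)
  qed
  have lin: "(\<Sum>x\<in>P. c x *\<^sub>R F x) = K"
  proof -
    have "(\<Sum>x\<in>P. c x *\<^sub>R (diag (\<lambda>i. 2 * x $ i - 1) :: real^'n^'n)) = diag d"
    proof -
      have "(\<Sum>x\<in>P. c x * (2 * x $ i - 1)) = d i" for i
      proof -
        have "(\<Sum>x\<in>P. c x * x $ i) = (\<Sum>x\<in>P. c x *\<^sub>R x) $ i" by simp
        then have "(\<Sum>x\<in>P. c x * x $ i) = (d i + 1) / 2" using c(3) by (simp add: y_def)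
        moreover have "(\<Sum>x\<in>P. c x * (2 * x $ i - 1)) = 2 * (\<Sum>x\<in>P. c x * x $ i) - sum c P"
          by (simp add: sum_distrib_left sum_subtractf algebra_simps)
        ultimately show ?thesis using c(2) by simp
      qed
      then show ?thesis by (simp add: diag_def vec_eq_iff)
    qed
    then show ?thesis unfolding F_def K(4) sum_scaleR_matrix_mult[OF \<open>finite P\<close>] by simp
  qed
  show thesis
  proof (rule that[of "F ` P" "c \<circ> the_inv_into P F"])
    show "sum (c \<circ> the_inv_into P F) (F ` P) = 1"
      using c(2) by (simp add: sum.reindex \<open>inj_on F P\<close> the_inv_into_f_f)
    show "K = (\<Sum>Q\<in>F ` P. (c \<circ> the_inv_into P F) Q *\<^sub>R Q)"
      using lin by (simp add: sum.reindex \<open>inj_on F P\<close> the_inv_into_f_f)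
  qed (use \<open>finite P\<close> orth c(1) \<open>inj_on F P\<close> the_inv_into_f_f in \<open>auto simp: the_inv_into_f_f\<close>)
qed

subsection \<open>Second moments of random vectors\<close>

definition sq_integrable :: "'a measure \<Rightarrow> ('a \<Rightarrow> real^'n) \<Rightarrow> bool" where
  "sq_integrable M X \<longleftrightarrow> X \<in> borel_measurable M \<and> integrable M (\<lambda>z. (norm (X z))\<^sup>2)"

lemma sq_integrable_bound:
  assumes "integrable M f" "X \<in> borel_measurable M" "\<And>z. (norm (X z))\<^sup>2 \<le> (f z :: real)"
  shows "sq_integrable M X"
  unfolding sq_integrable_def
proof (intro conjI)
  show "integrable M (\<lambda>z. (norm (X z))\<^sup>2)"
    using assms by (intro Bochner_Integration.integrable_bound[OF assms(1)])
      (auto simp: order_trans[OF assms(3) abs_ge_self])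
qed fact

lemma norm_add_sq_le: "(norm (x + y :: 'a::real_normed_vector))\<^sup>2 \<le> 2 * (norm x)\<^sup>2 + 2 * (norm y)\<^sup>2"
proof -
  have "(norm (x + y))\<^sup>2 \<le> (norm x + norm y)\<^sup>2" by (intro power_mono norm_triangle_ineq) simp
  also have "\<dots> \<le> 2 * (norm x)\<^sup>2 + 2 * (norm y)\<^sup>2"
    using sum_squares_ge_zero[of "norm x - norm y" 0] by (simp add: power2_eq_square algebra_simps)
  finally show ?thesis .
qed

lemma sq_integrable_add:
  assumes "sq_integrable M X" "sq_integrable M Y" shows "sq_integrable M (\<lambda>z. X z + Y z)"
  using assms
  by (intro sq_integrable_bound[of M "\<lambda>z. 2 * (norm (X z))\<^sup>2 + 2 * (norm (Y z))\<^sup>2"] norm_add_sq_le)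
     (auto simp: sq_integrable_def)

lemma sq_integrable_scaleR: "sq_integrable M X \<Longrightarrow> sq_integrable M (\<lambda>z. c *\<^sub>R X z)"
  by (auto simp: sq_integrable_def power_mult_distrib)

lemma sq_integrable_diff:
  "sq_integrable M X \<Longrightarrow> sq_integrable M Y \<Longrightarrow> sq_integrable M (\<lambda>z. X z - Y z)"
  using sq_integrable_add[of M X "\<lambda>z. (-1) *\<^sub>R Y z"] sq_integrable_scaleR[of M Y "-1"] by simp

lemma sq_integrable_const: "finite_measure M \<Longrightarrow> sq_integrable M (\<lambda>_. c)"
  by (auto simp: sq_integrable_def intro: finite_measure.integrable_const)

lemma borel_measurable_matrix_vector_mult [measurable (raw)]:
  "X \<in> borel_measurable M \<Longrightarrow> (\<lambda>z. A *v X z) \<in> borel_measurable M" for A :: "real^'n^'m"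
  by (rule borel_measurable_continuous_on[of "(*v) A"])
    (auto intro: linear_continuous_on matrix_vector_mul_bounded_linear)

lemma borel_measurable_matrix_vector_mult' [measurable]: "(*v) A \<in> borel_measurable borel" for A :: "real^'n^'m"
  using borel_measurable_matrix_vector_mult[of "\<lambda>x. x" borel A] by simp

lemma sq_integrable_matrix:
  assumes "sq_integrable M X" shows "sq_integrable M (\<lambda>z. A *v X z)"
proof -
  obtain B where B: "\<And>x. norm (A *v x) \<le> norm x * B"
    using bounded_linear.bounded[OF matrix_vector_mul_bounded_linear[of A]] by blast
  show ?thesis
  proof (rule sq_integrable_bound)
    show "integrable M (\<lambda>z. B\<^sup>2 * (norm (X z))\<^sup>2)" using assms by (auto simp: sq_integrable_def)
    show "(norm (A *v X z))\<^sup>2 \<le> B\<^sup>2 * (norm (X z))\<^sup>2" for z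
      using power_mono[OF B[of "X z"] norm_ge_zero, of 2] by (simp add: power_mult_distrib mult.commute)
  qed (use assms in \<open>auto simp: sq_integrable_def\<close>)
qed

lemma sq_integrable_integrable:
  assumes "finite_measure M" "sq_integrable M X" shows "integrable M X"
proof -
  have "integrable M (\<lambda>z. 1 + (norm (X z))\<^sup>2)"
    using assms by (auto simp: sq_integrable_def intro: finite_measure.integrable_const)
  then show ?thesis
  proof (rule Bochner_Integration.integrable_bound)
    have "norm (X z) \<le> 1 + (norm (X z))\<^sup>2" for z
    proof -
      have "0 \<le> (norm (X z) - 1)\<^sup>2" by simp
      then have "2 * norm (X z) \<le> 1 + (norm (X z))\<^sup>2" by (simp add: power2_diff)
      then show ?thesis using norm_ge_zero[of "X z"] by linarith
    qed
    then show "AE z in M. norm (X z) \<le> norm (1 + (norm (X z))\<^sup>2)" by (simp add: abs_of_nonneg)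
  qed (use assms in \<open>auto simp: sq_integrable_def\<close>)
qed

lemma sq_integrable_inner:
  fixes X Y :: "'a \<Rightarrow> real^'n"
  assumes "sq_integrable M X" "sq_integrable M Y" shows "integrable M (\<lambda>z. X z \<bullet> Y z)"
proof -
  have "integrable M (\<lambda>z. (norm (X z))\<^sup>2 + (norm (Y z))\<^sup>2)"
    using assms by (auto simp: sq_integrable_def)
  then show ?thesis
  proof (rule Bochner_Integration.integrable_bound)
    have "\<bar>x \<bullet> y\<bar> \<le> (norm x)\<^sup>2 + (norm y)\<^sup>2" for x y :: "real^'n"
    proof -
      have "\<bar>x \<bullet> y\<bar> \<le> norm x * norm y" by (rule Cauchy_Schwarz_ineq2)
      also have "2 * (norm x * norm y) \<le> (norm x)\<^sup>2 + (norm y)\<^sup>2"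
        using sum_squares_bound[of "norm x" "norm y"] by simp
      finally show ?thesis by (smt (verit) zero_le_power2)
    qed
    then show "AE z in M. norm (X z \<bullet> Y z) \<le> norm ((norm (X z))\<^sup>2 + (norm (Y z))\<^sup>2)"
      by (simp add: abs_of_nonneg)
  qed (use assms in \<open>auto simp: sq_integrable_def\<close>)
qed

lemma sq_integrable_dot_mult:
  assumes "sq_integrable M X" "sq_integrable M Y" shows "integrable M (\<lambda>z. (u \<bullet> X z) * (v \<bullet> Y z))"
proof -
  have "integrable M (\<lambda>z. (norm u)\<^sup>2 * (norm (X z))\<^sup>2 + (norm v)\<^sup>2 * (norm (Y z))\<^sup>2)"
    using assms by (auto simp: sq_integrable_def)
  then show ?thesis
  proof (rule Bochner_Integration.integrable_bound)
    have "\<bar>(u \<bullet> x) * (v \<bullet> y)\<bar> \<le> (norm u)\<^sup>2 * (norm x)\<^sup>2 + (norm v)\<^sup>2 * (norm y)\<^sup>2" for x y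
    proof -
      have "\<bar>(u \<bullet> x) * (v \<bullet> y)\<bar> \<le> (norm u * norm x) * (norm v * norm y)"
        unfolding abs_mult by (intro mult_mono Cauchy_Schwarz_ineq2) auto
      also have "2 * \<dots> \<le> (norm u * norm x)\<^sup>2 + (norm v * norm y)\<^sup>2"
        using sum_squares_bound[of "norm u * norm x" "norm v * norm y"] by simp
      finally show ?thesis unfolding power_mult_distrib
        by (smt (verit) zero_le_power2 zero_le_mult_iff)
    qed
    then show "AE z in M. norm ((u \<bullet> X z) * (v \<bullet> Y z))
        \<le> norm ((norm u)\<^sup>2 * (norm (X z))\<^sup>2 + (norm v)\<^sup>2 * (norm (Y z))\<^sup>2)"
      by (simp add: abs_of_nonneg)
  qed (use assms in \<open>auto simp: sq_integrable_def\<close>)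
qed

lemma sq_integrable_component_mult:
  assumes "sq_integrable M X" "sq_integrable M Y" shows "integrable M (\<lambda>z. X z $ i * Y z $ j)"
  using sq_integrable_dot_mult[OF assms, of "axis i 1" "axis j 1"] by (simp add: inner_axis')

text \<open>The moments are not centred. Subtracting the means beforehand yields covariances and
  cross covariances.\<close>

definition cross_moment :: "'a measure \<Rightarrow> ('a \<Rightarrow> real^'n) \<Rightarrow> ('a \<Rightarrow> real^'n) \<Rightarrow> real^'n^'n" where
  "cross_moment M X Y = (\<chi> i j. \<integral>z. X z $ i * Y z $ j \<partial>M)"

lemma cross_moment_dot:
  assumes "sq_integrable M X" "sq_integrable M Y"
  shows "u \<bullet> (cross_moment M X Y *v v) = (\<integral>z. (u \<bullet> X z) * (v \<bullet> Y z) \<partial>M)"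
proof -
  have "(u \<bullet> x) * (v \<bullet> y) = (\<Sum>i\<in>UNIV. \<Sum>j\<in>UNIV. u $ i * (v $ j * (x $ i * y $ j)))" for x y
    unfolding inner_vec_def sum_product by (intro sum.cong refl) simp
  then have "(\<integral>z. (u \<bullet> X z) * (v \<bullet> Y z) \<partial>M)
      = (\<integral>z. (\<Sum>i\<in>UNIV. \<Sum>j\<in>UNIV. u $ i * (v $ j * (X z $ i * Y z $ j))) \<partial>M)"
    by simp
  also have "\<dots> = (\<Sum>i\<in>UNIV. \<Sum>j\<in>UNIV. u $ i * (v $ j * (\<integral>z. X z $ i * Y z $ j \<partial>M)))"
    using sq_integrable_component_mult[OF assms]
    by (simp add: Bochner_Integration.integral_sum)
  also have "\<dots> = u \<bullet> (cross_moment M X Y *v v)"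
    unfolding inner_vec_def cross_moment_def matrix_vector_mult_def
    by (simp add: sum_distrib_left) (intro sum.cong refl, simp)
  finally show ?thesis by simp
qed

lemma trace_cross_moment:
  assumes "sq_integrable M X" "sq_integrable M Y"
  shows "trace (cross_moment M X Y) = (\<integral>z. X z \<bullet> Y z \<partial>M)"
  using sq_integrable_component_mult[OF assms]
  by (simp add: trace_def cross_moment_def inner_vec_def Bochner_Integration.integral_sum)

lemma psd_cross_moment:
  assumes "sq_integrable M X" shows "psd (cross_moment M X X)"
  unfolding psd_def cross_moment_dot[OF assms assms]
  by (auto simp: transpose_def cross_moment_def vec_eq_iff mult.commute)

lemma cross_moment_matrix:
  fixes A B :: "real^'n^'n"
  assumes "sq_integrable M X" "sq_integrable M Y"
  shows "cross_moment M (\<lambda>z. A *v X z) (\<lambda>z. B *v Y z) = A ** cross_moment M X Y ** transpose B"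
proof (rule matrix_eqI_dot)
  fix u v
  have d: "w \<bullet> (L *v x) = (transpose L *v w) \<bullet> x" for w x and L :: "real^'n^'n"
    using transpose_dot[of w "transpose L" x] by simp
  have "u \<bullet> (cross_moment M (\<lambda>z. A *v X z) (\<lambda>z. B *v Y z) *v v)
      = (\<integral>z. (u \<bullet> (A *v X z)) * (v \<bullet> (B *v Y z)) \<partial>M)"
    using assms by (intro cross_moment_dot sq_integrable_matrix)
  also have "\<dots> = (transpose A *v u) \<bullet> (cross_moment M X Y *v (transpose B *v v))"
    unfolding cross_moment_dot[OF assms] d[of u A] d[of v B] ..
  also have "\<dots> = u \<bullet> (A ** cross_moment M X Y ** transpose B *v v)"
    unfolding d[of u A, symmetric] by (simp flip: matrix_vector_mul_assoc)
  finally show "u \<bullet> (cross_moment M (\<lambda>z. A *v X z) (\<lambda>z. B *v Y z) *v v)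
      = u \<bullet> (A ** cross_moment M X Y ** transpose B *v v)" .
qed

text \<open>The integral of (s f - t g)^2 is a nonnegative quadratic form in s and t, so its
  discriminant has a sign. Two parameters keep \<open>f\<close> and \<open>g\<close> symmetric, so
  either of them may vanish almost everywhere.\<close>

lemma integral_mult_Cauchy_Schwarz:
  fixes f g :: "'a \<Rightarrow> real"
  assumes f: "integrable M (\<lambda>z. (f z)\<^sup>2)" and g: "integrable M (\<lambda>z. (g z)\<^sup>2)"
    and fg: "integrable M (\<lambda>z. f z * g z)"
  shows "(\<integral>z. f z * g z \<partial>M) \<le> sqrt (\<integral>z. (f z)\<^sup>2 \<partial>M) * sqrt (\<integral>z. (g z)\<^sup>2 \<partial>M)"
proof -
  define a b c where "a = (\<integral>z. (f z)\<^sup>2 \<partial>M)" and "b = (\<integral>z. f z * g z \<partial>M)" and "c = (\<integral>z. (g z)\<^sup>2 \<partial>M)"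
  have quad: "0 \<le> s\<^sup>2 * a - 2 * s * t * b + t\<^sup>2 * c" for s t
  proof -
    have "0 \<le> (\<integral>z. (s * f z - t * g z)\<^sup>2 \<partial>M)" by (rule integral_nonneg_AE) simp
    also have "\<dots> = (\<integral>z. s\<^sup>2 * (f z)\<^sup>2 - (2 * s * t) * (f z * g z) + t\<^sup>2 * (g z)\<^sup>2 \<partial>M)"
      by (intro Bochner_Integration.integral_cong) (auto simp: power2_eq_square algebra_simps)
    also have "\<dots> = s\<^sup>2 * a - 2 * s * t * b + t\<^sup>2 * c"
      using assms by (simp add: a_def b_def c_def)
    finally show ?thesis .
  qed
  have nn: "0 \<le> a" "0 \<le> c" by (auto simp: a_def c_def integral_nonneg_AE)
  have "b\<^sup>2 \<le> a * c"
  proof (cases "a = 0 \<and> c = 0")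
    case True
    then show ?thesis using quad[of 1 1] quad[of 1 "-1"] by simp
  next
    case False
    \<comment> \<open>The pairs (s, t) = (b, a) and (c, b) produce the factor a c - b^2 multiplied
      by a and by c.\<close>
    have 1: "0 \<le> a * (a * c - b\<^sup>2)" using quad[of b a] by (simp add: power2_eq_square algebra_simps)
    have 2: "0 \<le> c * (a * c - b\<^sup>2)" using quad[of c b] by (simp add: power2_eq_square algebra_simps)
    show ?thesis using 1 2 nn False by (auto simp: zero_le_mult_iff)
  qed
  then have "b \<le> sqrt (a * c)" by (rule real_le_rsqrt)
  then show ?thesis by (simp add: a_def b_def c_def real_sqrt_mult)
qed

lemma (in prob_space) norm_expectation_sq_le:
  fixes X :: "'a \<Rightarrow> real^'n"
  assumes "sq_integrable M X"
  shows "(expectation (\<lambda>z. norm (X z)))\<^sup>2 \<le> expectation (\<lambda>z. (norm (X z))\<^sup>2)"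
proof -
  have i: "integrable M (\<lambda>z. norm (X z))"
    using sq_integrable_integrable[OF finite_measure_axioms assms] by simp
  have "expectation (\<lambda>z. norm (X z) * 1)
      \<le> sqrt (expectation (\<lambda>z. (norm (X z))\<^sup>2)) * sqrt (expectation (\<lambda>z. 1\<^sup>2))"
    using assms i by (intro integral_mult_Cauchy_Schwarz) (auto simp: sq_integrable_def)
  then have le: "expectation (\<lambda>z. norm (X z)) \<le> sqrt (expectation (\<lambda>z. (norm (X z))\<^sup>2))"
    by (simp add: prob_space)
  have "(expectation (\<lambda>z. norm (X z)))\<^sup>2 \<le> (sqrt (expectation (\<lambda>z. (norm (X z))\<^sup>2)))\<^sup>2"
    by (rule power_mono[OF le]) (simp add: integral_nonneg_AE)
  then show ?thesis by (simp add: integral_nonneg_AE)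
qed

text \<open>A centred pair whose covariances are \<open>R\<^sup>2\<close> and \<open>S\<^sup>2\<close> has a cross covariance of the
  form \<open>R K S\<close> with a contraction \<open>K\<close>.\<close>

lemma expectation_inner_le:
  assumes X: "sq_integrable M X" and Y: "sq_integrable M Y"
  shows "(\<integral>z. X z \<bullet> Y z \<partial>M)
    \<le> trace (psd_sqrt (psd_sqrt (cross_moment M X X) ** cross_moment M Y Y ** psd_sqrt (cross_moment M X X)))"
proof -
  define R S where "R = psd_sqrt (cross_moment M X X)" and "S = psd_sqrt (cross_moment M Y Y)"
  have R: "psd R" "R ** R = cross_moment M X X" and S: "psd S" "S ** S = cross_moment M Y Y"
    using psd_sqrt psd_cross_moment X Y by (auto simp: R_def S_def)
  have "u \<bullet> (cross_moment M X Y *v v) \<le> norm (R *v u) * norm (S *v v)" for u v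
  proof -
    have "(\<integral>z. (u \<bullet> X z)\<^sup>2 \<partial>M) = (norm (R *v u))\<^sup>2"
      unfolding norm_psd_mult[OF R(1)] R(2) cross_moment_dot[OF X X] by (simp add: power2_eq_square)
    then have nR: "sqrt (\<integral>z. (u \<bullet> X z)\<^sup>2 \<partial>M) = norm (R *v u)" by simp
    have "(\<integral>z. (v \<bullet> Y z)\<^sup>2 \<partial>M) = (norm (S *v v))\<^sup>2"
      unfolding norm_psd_mult[OF S(1)] S(2) cross_moment_dot[OF Y Y] by (simp add: power2_eq_square)
    then have nS: "sqrt (\<integral>z. (v \<bullet> Y z)\<^sup>2 \<partial>M) = norm (S *v v)" by simp
    show ?thesis
      unfolding cross_moment_dot[OF X Y]
      unfolding nR[symmetric] nS[symmetric]
      using sq_integrable_dot_mult[OF X X, of u u] sq_integrable_dot_mult[OF Y Y, of v v]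
        sq_integrable_dot_mult[OF X Y, of u v]
      by (intro integral_mult_Cauchy_Schwarz) (auto simp: power2_eq_square)
  qed
  from trace_le_of_bilinear_bound[OF R(1) S(1) this]
  show ?thesis by (simp add: trace_cross_moment[OF X Y] S(2) R_def)
qed

subsection \<open>Measures with finite second moment\<close>

lemma P2_iff: "\<mu> \<in> P2 \<longleftrightarrow> prob_space \<mu> \<and> sets \<mu> = sets borel \<and> sq_integrable \<mu> (\<lambda>x. x)"
  by (auto simp: P2_def sq_integrable_def measurable_ident_sets)

lemma P2D:
  assumes "\<mu> \<in> P2"
  shows "prob_space \<mu>" "sets \<mu> = sets borel" "sq_integrable \<mu> (\<lambda>x. x)" "finite_measure \<mu>"
    "integrable \<mu> (\<lambda>x. x)" "space \<mu> = UNIV"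
  using assms by (auto simp: P2_iff prob_space.finite_measure sq_integrable_integrable sets_eq_imp_space_eq)

lemma P2_borel_measurable: "\<mu> \<in> P2 \<Longrightarrow> f \<in> borel_measurable borel \<Longrightarrow> f \<in> borel_measurable \<mu>"
  using P2D(2) measurable_cong_sets by blast

lemma distr_P2:
  assumes "prob_space M" "sq_integrable M X" shows "distr M borel X \<in> P2"
  using assms by (auto simp: P2_iff sq_integrable_def integrable_distr_eq prob_space.prob_space_distr)

lemma mean_distr: "X \<in> borel_measurable M \<Longrightarrow> mean (distr M borel X) = (\<integral>z. X z \<partial>M)"
  unfolding mean_def by (rule integral_distr) auto

lemma cov_matrix_cross_moment:
  "cov_matrix \<mu> = cross_moment \<mu> (\<lambda>x. x - mean \<mu>) (\<lambda>x. x - mean \<mu>)"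
  by (simp add: cov_matrix_def cross_moment_def)

lemma cov_matrix_distr:
  assumes "X \<in> borel_measurable M"
  shows "cov_matrix (distr M borel X) = cross_moment M (\<lambda>z. X z - mean (distr M borel X)) (\<lambda>z. X z - mean (distr M borel X))"
  using assms unfolding cov_matrix_def cross_moment_def by (simp add: integral_distr)

lemma P2_centered:
  assumes "\<mu> \<in> P2" shows "sq_integrable \<mu> (\<lambda>x. x - c)"
  using assms by (intro sq_integrable_diff sq_integrable_const P2D)

lemma psd_cov_matrix: "\<mu> \<in> P2 \<Longrightarrow> psd (cov_matrix \<mu>)"
  unfolding cov_matrix_cross_moment by (intro psd_cross_moment P2_centered)

lemma cov_matrix_dot:
  assumes "\<mu> \<in> P2" shows "u \<bullet> (cov_matrix \<mu> *v u) = (\<integral>x. (u \<bullet> (x - mean \<mu>))\<^sup>2 \<partial>\<mu>)"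
  unfolding cov_matrix_cross_moment cross_moment_dot[OF P2_centered P2_centered, OF assms assms]
  by (simp add: power2_eq_square)

subsection \<open>Convex functions as suprema of affine functions\<close>

text \<open>A hyperplane separates the point of the graph from the strict epigraph. It cannot be
  vertical because \<open>f\<close> is finite everywhere, so dividing by its last coefficient gives
  a supporting slope.\<close>

lemma convex_on_subgradient:
  fixes f :: "'a::euclidean_space \<Rightarrow> real"
  assumes f: "convex_on UNIV f"
  obtains g where "\<And>y. f x + g \<bullet> (y - x) \<le> f y"
proof -
  define T where "T = {p :: 'a \<times> real. f (fst p) < snd p}"
  have "convex T"
    unfolding convex_def T_def
  proof clarsimp
    fix y s z t and u v :: real
    assume a: "f y < s" "f z < t" "0 \<le> u" "0 \<le> v" "u + v = 1"
    have "f (u *\<^sub>R y + v *\<^sub>R z) \<le> u * f y + v * f z"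
      using f a by (auto simp: convex_on_def)
    also have "\<dots> < u * s + v * t"
    proof (cases "u = 0")
      case False
      then show ?thesis using a by (intro add_less_le_mono mult_strict_left_mono mult_left_mono) auto
    qed (use a in auto)
    finally show "f (u *\<^sub>R y + v *\<^sub>R z) < u * s + v * t" .
  qed
  moreover have "(x, f x + 1) \<in> T" "{(x, f x)} \<inter> T = {}" by (auto simp: T_def)
  ultimately obtain a b where a: "a \<noteq> 0" "\<forall>p\<in>{(x, f x)}. a \<bullet> p \<le> b" "\<forall>p\<in>T. b \<le> a \<bullet> p"
    using separating_hyperplane_sets[of "{(x, f x)}" T] by blast
  obtain a1 a2 where a12: "a = (a1, a2)" by (cases a)
  have key: "a1 \<bullet> x + a2 * f x \<le> a1 \<bullet> y + a2 * t" if "f y < t" for y t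
    using a(2) bspec[OF a(3), of "(y, t)"] that by (simp add: a12 T_def)
  have "a2 \<ge> 0" using key[of x "f x + 1"] by (simp add: distrib_left)
  \<comment> \<open>A vertical hyperplane would bound \<open>a1 \<bullet> y\<close> below by
    \<open>a1 \<bullet> x\<close> for every y, which fails at y = x - a1 unless the normal vector is
    0.\<close>
  moreover have "a2 \<noteq> 0"
  proof
    assume "a2 = 0"
    then have "a1 \<bullet> a1 \<le> 0" using key[of "x - a1" "f (x - a1) + 1"] by (simp add: inner_diff_right)
    then have "a1 = 0" using inner_ge_zero[of a1] inner_eq_zero_iff[of a1] by linarith
    with \<open>a2 = 0\<close> a(1) a12 show False by (simp add: zero_prod_def)
  qed
  ultimately have pos: "a2 > 0" by simp
  then have cancel: "a2 * (inverse a2 * r) = r" for r by simp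
  have "f x + (- (a1 /\<^sub>R a2)) \<bullet> (y - x) \<le> f y" for y
  \<comment> \<open>Only heights strictly above \<open>f y\<close> belong to the strict epigraph,
    hence the margin \<open>e\<close>.\<close>
  proof (rule field_le_epsilon)
    fix e :: real assume "e > 0"
    then have "a2 * (f x + (- (a1 /\<^sub>R a2)) \<bullet> (y - x)) \<le> a2 * (f y + e)"
      using key[of y "f y + e"] pos by (simp add: inner_diff_right algebra_simps cancel)
    then show "f x + (- (a1 /\<^sub>R a2)) \<bullet> (y - x) \<le> f y + e" using pos by simp
  qed
  then show thesis using that by blast
qed

text \<open>The subgradients at a point \<open>q\<close> near \<open>y\<close> need no bound: testing at the reflected point
  \<open>2q - y\<close> gives \<open>2 f(q) - f(2q - y)\<close> as a lower bound at \<open>y\<close>.\<close>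

lemma convex_on_countable_affine_sup:
  fixes f :: "'a::euclidean_space \<Rightarrow> real"
  assumes f: "convex_on UNIV f"
  obtains a :: "nat \<Rightarrow> real" and b where "\<And>k y. a k + b k \<bullet> y \<le> f y"
    "\<And>y e. 0 < e \<Longrightarrow> \<exists>k. f y - e < a k + b k \<bullet> y"
proof -
  obtain D :: "'a set" where D: "countable D" "\<And>X. open X \<Longrightarrow> X \<noteq> {} \<Longrightarrow> \<exists>d\<in>D. d \<in> X"
    using countable_dense_exists by blast
  then have "D \<noteq> {}" by blast
  define q where "q = from_nat_into D"
  have "\<forall>x. \<exists>g. \<forall>y. f x + g \<bullet> (y - x) \<le> f y"
    using convex_on_subgradient[OF f] by metis
  then obtain g where g: "\<And>x y. f x + g x \<bullet> (y - x) \<le> f y" by metis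
  have cont: "continuous_on UNIV f" using f by (intro convex_on_continuous) auto
  show thesis
  proof (rule that[of "\<lambda>k. f (q k) - g (q k) \<bullet> q k" "\<lambda>k. g (q k)"])
    show "f (q k) - g (q k) \<bullet> q k + g (q k) \<bullet> y \<le> f y" for k y
      using g[of "q k" y] by (simp add: inner_diff_right)
    show "\<exists>k. f y - e < f (q k) - g (q k) \<bullet> q k + g (q k) \<bullet> y" if "0 < e" for y e
    proof -
      \<comment> \<open>At p = y the right side equals \<open>f y\<close>, so \<open>X\<close> is a
        neighbourhood of \<open>y\<close> and meets the dense set.\<close>
      define X where "X = {p. f y - e < 2 * f p - f (2 *\<^sub>R p - y)}"
      have "open X"
        unfolding X_def
        by (intro open_Collect_less continuous_intros continuous_on_compose2[OF cont]) auto
      moreover have "y \<in> X" using that by (simp add: X_def scaleR_2)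
      ultimately obtain p where p: "p \<in> D" "p \<in> X" using D(2) by blast
      then obtain k where k: "q k = p"
        using from_nat_into_surj[OF D(1)] by (auto simp: q_def)
      have "(2 *\<^sub>R p - y) - p = p - y" by (simp add: scaleR_2)
      with g[of p "2 *\<^sub>R p - y"] have "f p + g p \<bullet> (p - y) \<le> f (2 *\<^sub>R p - y)" by (simp only:)
      then have "f y - e < f p - g p \<bullet> p + g p \<bullet> y"
        using p(2) by (simp add: X_def inner_diff_right)
      with k show ?thesis by blast
    qed
  qed
qed

lemma convex_on_borel_measurable:
  fixes f :: "'a::euclidean_space \<Rightarrow> real"
  assumes "convex_on UNIV f" shows "f \<in> borel_measurable borel"
  using assms by (intro borel_measurable_continuous_onI convex_on_continuous) auto

section \<open>Convex test functions\<close>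

lemma convex_on_UNIV_I:
  assumes "\<And>t x y. 0 < t \<Longrightarrow> t < 1 \<Longrightarrow> f ((1 - t) *\<^sub>R x + t *\<^sub>R y) \<le> (1 - t) * f x + t * f y"
  shows "convex_on UNIV f"
  using assms by (intro convex_onI) auto

lemma convex_on_inner_compose:
  assumes "convex_on UNIV (g :: real \<Rightarrow> real)"
  shows "convex_on UNIV (\<lambda>x. g (u \<bullet> x + c))"
proof (rule convex_on_UNIV_I)
  fix t :: real and x y :: 'a assume t: "0 < t" "t < 1"
  have "u \<bullet> ((1 - t) *\<^sub>R x + t *\<^sub>R y) + c = (1 - t) * (u \<bullet> x + c) + t * (u \<bullet> y + c)"
    by (simp add: inner_add_right algebra_simps)
  then show "g (u \<bullet> ((1 - t) *\<^sub>R x + t *\<^sub>R y) + c) \<le> (1 - t) * g (u \<bullet> x + c) + t * g (u \<bullet> y + c)"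
    using convex_onD[OF assms, of t "u \<bullet> x + c" "u \<bullet> y + c"] t by simp
qed

lemma convex_on_square: "convex_on UNIV (\<lambda>x::real. x\<^sup>2)"
proof (rule convex_on_UNIV_I)
  fix t x y :: real assume "0 < t" "t < 1"
  then have "0 \<le> t * (1 - t) * (x - y)\<^sup>2" by simp
  then show "((1 - t) *\<^sub>R x + t *\<^sub>R y)\<^sup>2 \<le> (1 - t) * x\<^sup>2 + t * y\<^sup>2"
    by (simp add: power2_eq_square algebra_simps)
qed

lemma convex_on_pos_part: "convex_on UNIV (\<lambda>x::real. max 0 x)"
proof (rule convex_on_UNIV_I)
  fix t x y :: real assume t: "0 < t" "t < 1"
  have "(1 - t) * x \<le> (1 - t) * max 0 x" "t * y \<le> t * max 0 y" "0 \<le> (1 - t) * max 0 x" "0 \<le> t * max 0 y"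
    using t by (auto intro!: mult_left_mono mult_nonneg_nonneg)
  then show "max 0 ((1 - t) *\<^sub>R x + t *\<^sub>R y) \<le> (1 - t) * max 0 x + t * max 0 y"
    by simp
qed

lemma convex_on_norm_sq: "convex_on UNIV (\<lambda>x::'a::real_inner. (norm x)\<^sup>2)"
proof (rule convex_on_UNIV_I)
  fix t :: real and x y :: 'a assume "0 < t" "t < 1"
  then have "0 \<le> t * (1 - t) * ((x - y) \<bullet> (x - y))" by simp
  then show "(norm ((1 - t) *\<^sub>R x + t *\<^sub>R y))\<^sup>2 \<le> (1 - t) * (norm x)\<^sup>2 + t * (norm y)\<^sup>2"
    by (simp add: power2_norm_eq_inner inner_add_left inner_add_right inner_diff_left inner_diff_right
        inner_commute[of y x] algebra_simps)
qed

subsection \<open>The convex order through nonnegative convex functions\<close>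

text \<open>The negative part of h + l is at most |l|, hence integrable, so the difference defining
  \<open>ext_integral\<close> is never of the form infinity minus infinity. With \<open>l\<close>
  affine this evaluates every convex function.\<close>

lemma ext_integral_nonneg_plus_integrable:
  assumes h: "h \<in> borel_measurable \<mu>" "\<And>x. 0 \<le> h x" and l: "integrable \<mu> l"
  shows "ext_integral \<mu> (\<lambda>x. h x + l x) = enn2ereal (\<integral>\<^sup>+x. ennreal (h x) \<partial>\<mu>) + ereal (\<integral>x. l x \<partial>\<mu>)"
proof (cases "(\<integral>\<^sup>+x. ennreal (h x) \<partial>\<mu>) = \<infinity>")
  case True
  have [measurable]: "h \<in> borel_measurable \<mu>" "l \<in> borel_measurable \<mu>" using h l by auto
  have fin: "(\<integral>\<^sup>+x. ennreal \<bar>l x\<bar> \<partial>\<mu>) < \<infinity>"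
    using l by (simp add: integrable_iff_bounded)
  have N: "(\<integral>\<^sup>+x. ennreal (- (h x + l x)) \<partial>\<mu>) < \<infinity>"
  proof (rule le_less_trans[OF nn_integral_mono fin])
    show "ennreal (- (h x + l x)) \<le> ennreal \<bar>l x\<bar>" for x
      using h(2)[of x] by (intro ennreal_leI) linarith
  qed
  \<comment> \<open>Since h <= (h + l)^+ + |l| and |l| has finite integral, the positive part of h +
    l must carry the infinite mass.\<close>
  have "(\<integral>\<^sup>+x. ennreal (h x) \<partial>\<mu>) \<le> (\<integral>\<^sup>+x. ennreal (h x + l x) + ennreal \<bar>l x\<bar> \<partial>\<mu>)"
  proof (rule nn_integral_mono)
    fix x
    have "ennreal (h x) \<le> ennreal (max 0 (h x + l x) + \<bar>l x\<bar>)" by (intro ennreal_leI) linarith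
    also have "\<dots> = ennreal (h x + l x) + ennreal \<bar>l x\<bar>" by (simp add: ennreal_plus max_def ennreal_neg)
    finally show "ennreal (h x) \<le> ennreal (h x + l x) + ennreal \<bar>l x\<bar>" .
  qed
  also have "\<dots> = (\<integral>\<^sup>+x. ennreal (h x + l x) \<partial>\<mu>) + (\<integral>\<^sup>+x. ennreal \<bar>l x\<bar> \<partial>\<mu>)"
    by (rule nn_integral_add) auto
  finally have "(\<integral>\<^sup>+x. ennreal (h x + l x) \<partial>\<mu>) = \<infinity>"
    using True fin by (auto simp: top_unique)
  then show ?thesis
    using True N unfolding ext_integral_def
    by (cases "\<integral>\<^sup>+x. ennreal (- (h x + l x)) \<partial>\<mu>") (auto simp: top_ennreal.rep_eq enn2ereal_ennreal)
next
  case False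
  then have hi: "integrable \<mu> h"
    using h by (auto simp: integrable_iff_bounded less_top)
  have i: "integrable \<mu> (\<lambda>x. h x + l x)" using hi l by simp
  have fin: "(\<integral>\<^sup>+x. ennreal (h x + l x) \<partial>\<mu>) \<noteq> \<infinity>" "(\<integral>\<^sup>+x. ennreal (- (h x + l x)) \<partial>\<mu>) \<noteq> \<infinity>"
    using i by (auto simp: real_integrable_def)
  have *: "enn2ereal x = ereal (enn2real x)" if "x \<noteq> \<infinity>" for x
    using that by (cases x) (auto simp: enn2ereal_ennreal)
  have "ext_integral \<mu> (\<lambda>x. h x + l x) = ereal (\<integral>x. h x + l x \<partial>\<mu>)"
    unfolding ext_integral_def *[OF fin(1)] *[OF fin(2)] by (simp add: real_lebesgue_integral_def[OF i])
  also have "\<dots> = ereal (\<integral>x. h x \<partial>\<mu>) + ereal (\<integral>x. l x \<partial>\<mu>)" using hi l by simp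
  also have "ereal (\<integral>x. h x \<partial>\<mu>) = enn2ereal (\<integral>\<^sup>+x. ennreal (h x) \<partial>\<mu>)"
    using hi h(2) by (simp add: nn_integral_eq_integral enn2ereal_ennreal integral_nonneg_AE)
  finally show ?thesis .
qed

text \<open>A nonconstant linear form is not nonnegative. It is approximated by the positive part of
  \<open>u \<bullet> x + a\<close>, reduced by \<open>a\<close>; the error as \<open>a\<close> grows
  is controlled by the second moment under \<open>\<eta>\<close>.\<close>

lemma mean_inner_le_of_nonneg_convex:
  assumes \<mu>: "\<mu> \<in> P2" and \<eta>: "\<eta> \<in> P2"
    and le: "\<And>h. convex_on UNIV h \<Longrightarrow> (\<And>x. 0 \<le> h x) \<Longrightarrow> (\<integral>\<^sup>+x. ennreal (h x) \<partial>\<mu>) \<le> (\<integral>\<^sup>+x. ennreal (h x) \<partial>\<eta>)"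
  shows "u \<bullet> mean \<mu> \<le> u \<bullet> mean (\<eta> :: (real^'n) measure)"
proof -
  interpret M: prob_space \<mu> using \<mu> by (rule P2D)
  interpret E: prob_space \<eta> using \<eta> by (rule P2D)
  define v where "v = (\<integral>x. (u \<bullet> x)\<^sup>2 \<partial>\<eta>)"
  have iu: "integrable \<mu> (\<lambda>x. u \<bullet> x)" "integrable \<eta> (\<lambda>x. u \<bullet> x)" "integrable \<eta> (\<lambda>x. (u \<bullet> x)\<^sup>2)"
    using P2D(5)[OF \<mu>] P2D(5)[OF \<eta>] sq_integrable_dot_mult[OF P2D(3)[OF \<eta>] P2D(3)[OF \<eta>], of u u]
    by (auto simp: power2_eq_square)
  have v: "0 \<le> v" by (simp add: v_def integral_nonneg_AE)
  have key: "u \<bullet> mean \<mu> \<le> u \<bullet> mean \<eta> + v / (4 * a)" if a: "a > 0" for a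
  proof -
    define h where "h x = max 0 (u \<bullet> x + a)" for x
    have hc: "convex_on UNIV h"
      unfolding h_def by (rule convex_on_inner_compose[OF convex_on_pos_part])
    have h0: "\<And>x. 0 \<le> h x" by (simp add: h_def)
    have hi: "integrable \<mu> h" "integrable \<eta> h"
      unfolding h_def using iu by (auto intro!: integrable_max)
    have "ennreal (\<integral>x. h x \<partial>\<mu>) \<le> ennreal (\<integral>x. h x \<partial>\<eta>)"
      using le[OF hc h0] hi h0 by (simp add: nn_integral_eq_integral)
    then have h_le: "(\<integral>x. h x \<partial>\<mu>) \<le> (\<integral>x. h x \<partial>\<eta>)"
      using h0 by (simp add: ennreal_le_iff integral_nonneg_AE)
    have "u \<bullet> mean \<mu> + a = (\<integral>x. u \<bullet> x + a \<partial>\<mu>)"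
      using iu P2D(5)[OF \<mu>] by (simp add: mean_def M.prob_space)
    also have "\<dots> \<le> (\<integral>x. h x \<partial>\<mu>)" using iu hi by (intro integral_mono) (auto simp: h_def)
    also note h_le
    also have "(\<integral>x. h x \<partial>\<eta>) \<le> (\<integral>x. (u \<bullet> x + a) + (u \<bullet> x)\<^sup>2 / (4 * a) \<partial>\<eta>)"
    proof (rule integral_mono)
      fix x
      \<comment> \<open>Completing the square shows that t + a + t^2 / (4 a) is nonnegative. As it
        also dominates t + a, it dominates the positive part.\<close>
      have "0 \<le> (u \<bullet> x + 2 * a)\<^sup>2 / (4 * a)" using a by simp
      also have "\<dots> = (u \<bullet> x + a) + (u \<bullet> x)\<^sup>2 / (4 * a)"
        using a by (simp add: power2_eq_square field_simps)
      finally show "h x \<le> (u \<bullet> x + a) + (u \<bullet> x)\<^sup>2 / (4 * a)" using a by (simp add: h_def)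
    qed (use iu hi in auto)
    also have "\<dots> = u \<bullet> mean \<eta> + a + v / (4 * a)"
      using iu P2D(5)[OF \<eta>] by (simp add: mean_def E.prob_space v_def)
    finally show ?thesis by simp
  qed
  show ?thesis
  proof (rule field_le_epsilon)
    fix e :: real assume e: "e > 0"
    \<comment> \<open>The choice a = (v + 1) / e brings the error below \<open>e\<close>, and the
      added 1 keeps \<open>a\<close> positive when v = 0.\<close>
    have "v / (4 * ((v + 1) / e)) \<le> e" using e v by (simp add: field_simps)
    then show "u \<bullet> mean \<mu> \<le> u \<bullet> mean \<eta> + e" using key[of "(v + 1) / e"] e v by simp
  qed
qed

lemma mean_eq_of_nonneg_convex:
  assumes "\<mu> \<in> P2" "\<eta> \<in> P2"
    "\<And>h. convex_on UNIV h \<Longrightarrow> (\<And>x. 0 \<le> h x) \<Longrightarrow> (\<integral>\<^sup>+x. ennreal (h x) \<partial>\<mu>) \<le> (\<integral>\<^sup>+x. ennreal (h x) \<partial>\<eta>)"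
  shows "mean \<mu> = mean (\<eta> :: (real^'n) measure)"
proof -
  have "u \<bullet> mean \<mu> = u \<bullet> mean \<eta>" for u
    using mean_inner_le_of_nonneg_convex[OF assms, of u] mean_inner_le_of_nonneg_convex[OF assms, of "- u"]
    by simp
  then show ?thesis using vector_eq_ldot by blast
qed

text \<open>Subtracting an affine minorant makes a convex function nonnegative. The subtracted part
  has the same integral on both sides because the nonnegative test functions already force equal
  means.\<close>

lemma cx_le_iff_nonneg:
  fixes \<mu> \<eta> :: "(real^'n) measure"
  assumes \<mu>: "\<mu> \<in> P2" and \<eta>: "\<eta> \<in> P2"
  shows "\<mu> \<le>\<^sub>c\<^sub>x \<eta> \<longleftrightarrow> (\<forall>h. convex_on UNIV h \<longrightarrow> (\<forall>x. 0 \<le> h x) \<longrightarrow>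
    (\<integral>\<^sup>+x. ennreal (h x) \<partial>\<mu>) \<le> (\<integral>\<^sup>+x. ennreal (h x) \<partial>\<eta>))"
proof (intro iffI allI impI)
  fix h :: "real^'n \<Rightarrow> real" assume cx: "\<mu> \<le>\<^sub>c\<^sub>x \<eta>" and h: "convex_on UNIV h" "\<forall>x. 0 \<le> h x"
  have "ext_integral \<rho> h = enn2ereal (\<integral>\<^sup>+x. ennreal (h x) \<partial>\<rho>)" if "\<rho> \<in> P2" for \<rho> :: "(real^'n) measure"
    using ext_integral_nonneg_plus_integrable[of h \<rho> "\<lambda>_. 0"] h that
    by (simp add: P2_borel_measurable convex_on_borel_measurable)
  then show "(\<integral>\<^sup>+x. ennreal (h x) \<partial>\<mu>) \<le> (\<integral>\<^sup>+x. ennreal (h x) \<partial>\<eta>)"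
    using cx h(1) \<mu> \<eta> by (auto simp: cx_le_def less_eq_ennreal.rep_eq)
next
  assume le: "\<forall>h. convex_on UNIV h \<longrightarrow> (\<forall>x. 0 \<le> h x) \<longrightarrow>
    (\<integral>\<^sup>+x. ennreal (h x) \<partial>\<mu>) \<le> (\<integral>\<^sup>+x. ennreal (h x) \<partial>\<eta>)"
  have mean: "mean \<mu> = mean \<eta>" using le by (intro mean_eq_of_nonneg_convex \<mu> \<eta>) auto
  show "\<mu> \<le>\<^sub>c\<^sub>x \<eta>"
    unfolding cx_le_def
  proof (intro allI impI)
    fix f :: "real^'n \<Rightarrow> real" assume f: "convex_on UNIV f"
    obtain g where g: "\<And>y. f 0 + g \<bullet> (y - 0) \<le> f y" using convex_on_subgradient[OF f] by blast
    define h where "h y = f y - (f 0 + g \<bullet> y)" for y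
    have h0: "0 \<le> h y" for y using g[of y] by (simp add: h_def)
    have hc: "convex_on UNIV h"
    proof (rule convex_on_UNIV_I)
      fix t :: real and x y :: "real^'n" assume "0 < t" "t < 1"
      then show "h ((1 - t) *\<^sub>R x + t *\<^sub>R y) \<le> (1 - t) * h x + t * h y"
        using convex_onD[OF f, of t x y] by (simp add: h_def inner_add_right algebra_simps)
    qed
    have e: "ext_integral \<rho> f = enn2ereal (\<integral>\<^sup>+x. ennreal (h x) \<partial>\<rho>) + ereal (f 0 + g \<bullet> mean \<rho>)"
      if "\<rho> \<in> P2" for \<rho> :: "(real^'n) measure"
    proof -
      interpret prob_space \<rho> using that by (rule P2D)
      have i: "integrable \<rho> (\<lambda>x. f 0 + g \<bullet> x)" using P2D(5)[OF that] by auto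
      have "f = (\<lambda>x. h x + (f 0 + g \<bullet> x))" by (simp add: h_def fun_eq_iff)
      then show ?thesis
        using ext_integral_nonneg_plus_integrable[of h \<rho>, OF _ h0 i]
          P2_borel_measurable[OF that convex_on_borel_measurable[OF hc]] P2D(5)[OF that]
        by (simp add: mean_def prob_space)
    qed
    have "(\<integral>\<^sup>+x. ennreal (h x) \<partial>\<mu>) \<le> (\<integral>\<^sup>+x. ennreal (h x) \<partial>\<eta>)" using le hc h0 by blast
    then show "ext_integral \<mu> f \<le> ext_integral \<eta> f"
      unfolding e[OF \<mu>] e[OF \<eta>] mean by (intro add_right_mono) (simp add: less_eq_ennreal.rep_eq)
  qed
qed

lemma cx_leD:
  assumes "\<mu> \<in> P2" "\<eta> \<in> P2" "\<mu> \<le>\<^sub>c\<^sub>x \<eta>" "convex_on UNIV h" "\<And>x. 0 \<le> h x"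
  shows "(\<integral>\<^sup>+x. ennreal (h x) \<partial>\<mu>) \<le> (\<integral>\<^sup>+x. ennreal (h x) \<partial>\<eta>)"
  using assms cx_le_iff_nonneg by blast

lemma cx_leD_integral:
  assumes \<mu>: "\<mu> \<in> P2" and \<eta>: "\<eta> \<in> P2" and "\<mu> \<le>\<^sub>c\<^sub>x \<eta>" "convex_on UNIV h" and h0: "\<And>x. 0 \<le> h x"
    and i: "integrable \<mu> h" "integrable \<eta> h"
  shows "(\<integral>x. h x \<partial>\<mu>) \<le> (\<integral>x. h x \<partial>\<eta>)"
proof -
  have "ennreal (\<integral>x. h x \<partial>\<mu>) \<le> ennreal (\<integral>x. h x \<partial>\<eta>)"
    using cx_leD[OF assms(1-5)] i h0 by (simp add: nn_integral_eq_integral)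
  then show ?thesis using h0 by (simp add: ennreal_le_iff integral_nonneg_AE)
qed

lemma cx_le_mean:
  assumes "\<mu> \<in> P2" "\<eta> \<in> P2" "\<mu> \<le>\<^sub>c\<^sub>x \<eta>" shows "mean \<mu> = mean \<eta>"
  using assms by (intro mean_eq_of_nonneg_convex cx_leD) auto

text \<open>The test functions are squares of linear forms centred at the common mean.\<close>

lemma cx_le_cov_matrix:
  assumes \<mu>: "\<mu> \<in> P2" and \<eta>: "\<eta> \<in> P2" and cx: "\<mu> \<le>\<^sub>c\<^sub>x \<eta>"
  shows "cov_matrix \<mu> \<preceq>\<^sub>L cov_matrix \<eta>"
  unfolding loewner_le_def psd_def
proof (intro conjI allI)
  show "transpose (cov_matrix \<eta> - cov_matrix \<mu>) = cov_matrix \<eta> - cov_matrix \<mu>"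
    using psd_cov_matrix[OF \<mu>] psd_cov_matrix[OF \<eta>] by (simp add: transpose_minus psd_symmetric)
  fix u
  have i: "integrable \<rho> (\<lambda>x. (u \<bullet> (x - mean \<eta>))\<^sup>2)" if "\<rho> \<in> P2" for \<rho> :: "(real^'a) measure"
    using sq_integrable_dot_mult[OF P2_centered P2_centered, OF that that, of u _ u] by (simp add: power2_eq_square)
  have "convex_on UNIV (\<lambda>x. (u \<bullet> x + (- (u \<bullet> mean \<eta>)))\<^sup>2)"
    by (rule convex_on_inner_compose[OF convex_on_square])
  then have "(\<integral>x. (u \<bullet> (x - mean \<eta>))\<^sup>2 \<partial>\<mu>) \<le> (\<integral>x. (u \<bullet> (x - mean \<eta>))\<^sup>2 \<partial>\<eta>)"
    by (intro cx_leD_integral[OF \<mu> \<eta> cx]) (auto simp: inner_diff_right i[unfolded inner_diff_right] \<mu> \<eta>)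
  then show "0 \<le> u \<bullet> ((cov_matrix \<eta> - cov_matrix \<mu>) *v u)"
    using cov_matrix_dot[OF \<mu>, of u] cov_matrix_dot[OF \<eta>, of u] cx_le_mean[OF \<mu> \<eta> cx]
    by (simp add: matrix_vector_mult_diff_rdistrib inner_diff_right)
qed

lemma cx_le_refl: "\<mu> \<le>\<^sub>c\<^sub>x \<mu>"
  by (simp add: cx_le_def)

subsection \<open>Gaussian measures\<close>

text \<open>Uniqueness of Haar measure. The double integral of 1_A(x + y) 1_B(y), with
  \<open>B\<close> the unit ball, is evaluated in both orders: invariance of \<open>M\<close> gives
  one product, invariance of Lebesgue measure together with that of \<open>M\<close> the
  other.\<close>

lemma translation_invariant_eq_lborel:
  fixes M :: "'a::euclidean_space measure"
  assumes [measurable_cong, simp]: "sets M = sets borel" and sf: "sigma_finite_measure M"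
    and inv: "\<And>a. distr M borel (\<lambda>x. x + a) = M"
    and ball: "emeasure M (ball 0 1) = emeasure lborel (ball (0::'a) 1)"
  shows "M = lborel"
proof (rule measure_eqI)
  fix A assume "A \<in> sets M"
  then have [measurable]: "A \<in> sets borel" by simp
  interpret sigma_finite_measure M by (rule sf)
  interpret pair_sigma_finite M lborel ..
  define B where "B = ball (0::'a) 1"
  have [measurable]: "B \<in> sets borel" by (simp add: B_def)
  have translate: "(\<integral>\<^sup>+x. f (x + a) \<partial>N) = (\<integral>\<^sup>+x. f x \<partial>N)"
    if "distr N borel (\<lambda>x. x + a) = N" "sets N = sets borel" "f \<in> borel_measurable borel"
    for f :: "'a \<Rightarrow> ennreal" and a N
    using that nn_integral_distr[of "\<lambda>x. x + a" N borel f] by simp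
  have linv: "distr lborel borel (\<lambda>x. x + a) = lborel" for a :: 'a
    using lborel_distr_plus[of a] by (simp add: add.commute[of _ a])
  have "(\<integral>\<^sup>+y. \<integral>\<^sup>+x. indicator A (x + y) * indicator B y \<partial>M \<partial>lborel)
      = (\<integral>\<^sup>+y. (\<integral>\<^sup>+x. indicator A (x + y) \<partial>M) * indicator B y \<partial>lborel)"
    by (simp add: nn_integral_multc)
  also have "\<dots> = (\<integral>\<^sup>+y. emeasure M A * indicator B y \<partial>lborel)"
    by (subst translate[OF inv]) auto
  also have "\<dots> = emeasure M A * emeasure lborel B"
    by (simp add: nn_integral_cmult)
  finally have 1: "(\<integral>\<^sup>+y. \<integral>\<^sup>+x. indicator A (x + y) * indicator B y \<partial>M \<partial>lborel)
    = emeasure M A * emeasure lborel B" .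
  have "(\<integral>\<^sup>+y. \<integral>\<^sup>+x. indicator A (x + y) * indicator B y \<partial>M \<partial>lborel)
      = (\<integral>\<^sup>+x. \<integral>\<^sup>+y. indicator A (x + y) * indicator B y \<partial>lborel \<partial>M)"
    by (rule Fubini') simp
  also have "\<dots> = (\<integral>\<^sup>+x. \<integral>\<^sup>+y. indicator A y * indicator B (y - x) \<partial>lborel \<partial>M)"
  proof (rule nn_integral_cong)
    fix x
    show "(\<integral>\<^sup>+y. indicator A (x + y) * indicator B y \<partial>lborel) = (\<integral>\<^sup>+y. indicator A y * indicator B (y - x) \<partial>lborel)"
      using translate[OF linv, of "\<lambda>y. indicator A y * indicator B (y - x)" x] by (simp add: add.commute)
  qed
  also have "\<dots> = (\<integral>\<^sup>+y. \<integral>\<^sup>+x. indicator A y * indicator B (y - x) \<partial>M \<partial>lborel)"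
    by (rule Fubini'[symmetric]) simp
  also have "\<dots> = (\<integral>\<^sup>+y. indicator A y * (\<integral>\<^sup>+x. indicator B (x + (- y)) \<partial>M) \<partial>lborel)"
  proof (rule nn_integral_cong)
    fix y
    \<comment> \<open>The symmetry of the ball turns y - x into a translate of x, to which the
      invariance of \<open>M\<close> applies.\<close>
    have "indicator B (y - x) = (indicator B (x + (- y)) :: ennreal)" for x
      by (auto simp: indicator_def B_def norm_minus_commute)
    then show "(\<integral>\<^sup>+x. indicator A y * indicator B (y - x) \<partial>M) = indicator A y * (\<integral>\<^sup>+x. indicator B (x + (- y)) \<partial>M)"
      by (simp add: nn_integral_cmult)
  qed
  also have "\<dots> = (\<integral>\<^sup>+y. indicator A y * emeasure M B \<partial>lborel)"
    by (subst translate[OF inv]) auto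
  also have "\<dots> = emeasure lborel A * emeasure lborel B"
    by (simp add: nn_integral_multc ball B_def)
  finally have "emeasure M A * emeasure lborel B = emeasure lborel A * emeasure lborel B"
    using 1 by simp
  moreover have "emeasure lborel B \<noteq> 0"
    using content_ball_pos[of 1 "0::'a"] by (auto simp: B_def measure_def)
  moreover have "emeasure lborel B \<noteq> \<infinity>"
    using emeasure_lborel_ball_finite[of "0::'a" 1] by (simp add: B_def)
  ultimately show "emeasure M A = emeasure lborel A"
    by (metis mult_divide_eq_ennreal infinity_ennreal_def)
qed simp

lemma orthogonal_matrix_mult_inverse:
  assumes "orthogonal_matrix (Q::real^'n^'n)"
  shows "transpose Q *v (Q *v x) = x" "Q *v (transpose Q *v x) = x"
  using orthogonal_matrix_inverse[OF assms] by (simp_all add: matrix_vector_mul_assoc)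

text \<open>The image is characterised by translation invariance and the mass of the unit ball, so
  no determinant enters. A shift by \<open>a\<close> after \<open>Q\<close> is a shift by Q^T a
  before it, and \<open>Q\<close> maps balls to balls.\<close>

lemma lborel_distr_orthogonal:
  assumes Q: "orthogonal_matrix (Q::real^'n^'n)"
  shows "distr lborel borel ((*v) Q) = lborel"
proof (rule translation_invariant_eq_lborel)
  let ?M = "distr lborel borel ((*v) Q)"
  show "sets ?M = sets borel" by simp
  have vim: "(*v) Q -` ball (Q *v c) r = ball c r" for c r
  proof -
    have "dist (Q *v c) (Q *v x) = dist c x" for x
      using orthogonal_matrix_norm[OF Q, of "c - x"] by (simp add: dist_norm matrix_vector_mult_diff_distrib)
    then show ?thesis by auto
  qed
  show "emeasure ?M (ball 0 1) = emeasure lborel (ball (0::real^'n) 1)"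
    using vim[of 0 1] by (simp add: emeasure_distr)
  show "sigma_finite_measure ?M"
  proof
    show "\<exists>F. countable F \<and> F \<subseteq> sets ?M \<and> \<Union>F = space ?M \<and> (\<forall>a\<in>F. emeasure ?M a \<noteq> \<infinity>)"
    proof (intro exI[of _ "range (\<lambda>k::nat. ball (0::real^'n) k)"] conjI ballI)
      show "\<Union> (range (\<lambda>k::nat. ball (0::real^'n) k)) = space ?M"
        by (auto simp: reals_Archimedean2)
      fix a assume "a \<in> range (\<lambda>k::nat. ball (0::real^'n) k)"
      then obtain k :: nat where "a = ball 0 k" by auto
      then have "emeasure ?M a = emeasure lborel (ball (0::real^'n) k)"
        using vim[of 0 k] by (simp add: emeasure_distr)
      then show "emeasure ?M a \<noteq> \<infinity>" using emeasure_lborel_ball_finite[of "0::real^'n" k] by simp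
    qed auto
  qed
  show "distr ?M borel (\<lambda>x. x + a) = ?M" for a
  proof -
    have "distr ?M borel (\<lambda>x. x + a) = distr lborel borel (\<lambda>x. Q *v x + a)"
      by (simp add: distr_distr comp_def)
    also have "(\<lambda>x. Q *v x + a) = (*v) Q \<circ> (+) (transpose Q *v a)"
      using orthogonal_matrix_mult_inverse[OF Q]
      by (simp add: fun_eq_iff matrix_vector_right_distrib add.commute)
    also have "distr lborel borel ((*v) Q \<circ> (+) (transpose Q *v a)) = distr (distr lborel borel ((+) (transpose Q *v a))) borel ((*v) Q)"
      by (rule distr_distr[symmetric]) auto
    finally show ?thesis by (simp add: lborel_distr_plus)
  qed
qed

section \<open>Rotation invariance and moments of the standard Gaussian\<close>

definition std_gaussian_density :: "real^'n \<Rightarrow> real" where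
  "std_gaussian_density x = (\<Prod>i\<in>UNIV. std_normal_density (x $ i))"

lemma norm_sq_eq_sum: "(norm (x::real^'n))\<^sup>2 = (\<Sum>i\<in>UNIV. (x $ i)\<^sup>2)"
  unfolding power2_norm_eq_inner inner_vec_def by (simp add: power2_eq_square)

text \<open>The product of the one-dimensional densities depends on the norm alone; rotation
  invariance rests on this form.\<close>

lemma std_gaussian_density_radial:
  "std_gaussian_density (x::real^'n) = (1 / sqrt (2 * pi)) ^ CARD('n) * exp (- (norm x)\<^sup>2 / 2)"
proof -
  have "exp (- (norm x)\<^sup>2 / 2) = (\<Prod>i\<in>UNIV. exp (- (x $ i)\<^sup>2 / 2))"
    by (simp add: norm_sq_eq_sum exp_sum[symmetric] sum_negf sum_divide_distrib)
  then show ?thesis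
    by (simp add: std_gaussian_density_def std_normal_density_def prod_dividef prod.distrib power_divide)
qed

lemma std_gaussian_density_nonneg: "0 \<le> std_gaussian_density x"
  by (simp add: std_gaussian_density_radial)

lemma borel_measurable_std_gaussian_density [measurable]: "std_gaussian_density \<in> borel_measurable borel"
  unfolding std_gaussian_density_radial[abs_def] by measurable

lemma std_gaussian_eq: "std_gaussian = density lborel (\<lambda>x. ennreal (std_gaussian_density x))"
  by (simp add: std_gaussian_def std_gaussian_density_def)

lemma sets_std_gaussian [simp, measurable_cong]: "sets std_gaussian = sets borel"
  by (simp add: std_gaussian_def)

lemma space_std_gaussian [simp]: "space std_gaussian = UNIV"
  by (simp add: std_gaussian_def)

lemma std_gaussian_distr_orthogonal:
  assumes Q: "orthogonal_matrix (Q::real^'n^'n)"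
  shows "distr std_gaussian borel ((*v) Q) = std_gaussian"
proof -
  have "std_gaussian_density (Q *v x) = std_gaussian_density x" for x
    by (simp add: std_gaussian_density_radial orthogonal_matrix_norm[OF Q])
  then have "distr std_gaussian borel ((*v) Q)
      = distr (density lborel (\<lambda>x. ennreal (std_gaussian_density (Q *v x)))) borel ((*v) Q)"
    by (simp add: std_gaussian_eq)
  also have "\<dots> = density (distr lborel borel ((*v) Q)) (\<lambda>x. ennreal (std_gaussian_density x))"
    by (rule density_distr[symmetric]) auto
  finally show ?thesis by (simp add: lborel_distr_orthogonal[OF Q] std_gaussian_eq)
qed

lemma nn_integral_lborel_prod_cart:
  assumes [measurable]: "\<And>i. f i \<in> borel_measurable borel" and nn: "\<And>i x. 0 \<le> (f i x :: real)"
  shows "(\<integral>\<^sup>+x. ennreal (\<Prod>i\<in>UNIV. f i (x $ i)) \<partial>(lborel :: (real^'n) measure)) = (\<Prod>i\<in>UNIV. \<integral>\<^sup>+t. ennreal (f i t) \<partial>lborel)"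
proof -
  have B: "(Basis :: (real^'n) set) = range (\<lambda>i. axis i 1)" by (auto simp: Basis_vec_def)
  have inj: "inj (\<lambda>i. axis i (1::real) :: real^'n)" by (simp add: inj_def axis_eq_axis)
  define g where "g b = f (the_inv (\<lambda>i. axis i (1::real) :: real^'n) b)" for b
  have g: "g (axis i 1) = f i" for i by (simp add: g_def the_inv_f_f[OF inj])
  have "(\<integral>\<^sup>+x. ennreal (\<Prod>i\<in>UNIV. f i (x $ i)) \<partial>(lborel :: (real^'n) measure))
      = (\<integral>\<^sup>+x. (\<Prod>b\<in>Basis. ennreal (g b (x \<bullet> b))) \<partial>(lborel :: (real^'n) measure))"
    by (simp add: B prod.reindex[OF inj] g inner_axis prod_ennreal nn)
  also have "\<dots> = (\<Prod>b\<in>(Basis :: (real^'n) set). \<integral>\<^sup>+t. ennreal (g b t) \<partial>lborel)"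
    by (rule nn_integral_lborel_prod) (auto simp: g_def)
  also have "\<dots> = (\<Prod>i\<in>UNIV. \<integral>\<^sup>+t. ennreal (f i t) \<partial>lborel)"
    by (simp add: B prod.reindex[OF inj] g)
  finally show ?thesis .
qed

lemma nn_integral_std_normal_density: "(\<integral>\<^sup>+t. ennreal (std_normal_density t) \<partial>lborel) = 1"
proof -
  interpret prob_space "density lborel std_normal_density" by (rule prob_space_normal_density) simp
  show ?thesis using emeasure_space_1 by (simp add: emeasure_density)
qed

lemma nn_integral_std_normal_density_square:
  "(\<integral>\<^sup>+t. ennreal (std_normal_density t * t\<^sup>2) \<partial>lborel) = 1"
proof -
  have "has_bochner_integral lborel (\<lambda>t. std_normal_density t * t\<^sup>2) 1"
    using std_normal_moment_even[of 1] by (simp add: fact_2)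
  then show ?thesis
    using nn_integral_eq_integral[of lborel "\<lambda>t. std_normal_density t * t\<^sup>2"]
    by (auto simp: has_bochner_integral_iff)
qed

lemma prob_space_std_gaussian: "prob_space (std_gaussian :: (real^'n) measure)"
proof
  show "emeasure (std_gaussian :: (real^'n) measure) (space std_gaussian) = 1"
    using nn_integral_lborel_prod_cart[of "\<lambda>i :: 'n. std_normal_density"]
    by (simp add: std_gaussian_eq emeasure_density std_gaussian_density_def[abs_def] nn_integral_std_normal_density)
qed

lemma nn_integral_std_gaussian_component:
  "(\<integral>\<^sup>+x. ennreal ((x $ k)\<^sup>2) \<partial>(std_gaussian :: (real^'n) measure)) = 1"
proof -
  define f where "f i t = (if i = k then std_normal_density t * t\<^sup>2 else std_normal_density t)" for i t
  have prod: "std_gaussian_density x * (x $ k)\<^sup>2 = (\<Prod>i\<in>UNIV. f i (x $ i))" for x :: "real^'n"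
  proof -
    have "(\<Prod>i\<in>UNIV. f i (x $ i)) = (\<Prod>i\<in>UNIV. std_normal_density (x $ i) * (if i = k then (x $ i)\<^sup>2 else 1))"
      by (intro prod.cong) (auto simp: f_def)
    then show ?thesis by (simp add: prod.distrib std_gaussian_density_def)
  qed
  have "(\<integral>\<^sup>+x. ennreal ((x $ k)\<^sup>2) \<partial>(std_gaussian :: (real^'n) measure))
      = (\<integral>\<^sup>+x. ennreal (\<Prod>i\<in>UNIV. f i (x $ i)) \<partial>(lborel :: (real^'n) measure))"
    by (simp add: std_gaussian_eq nn_integral_density prod[symmetric] ennreal_mult std_gaussian_density_nonneg)
  also have "\<dots> = (\<Prod>i\<in>UNIV. \<integral>\<^sup>+t. ennreal (f i t) \<partial>lborel)"
    by (rule nn_integral_lborel_prod_cart) (auto simp: f_def)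
  also have "\<dots> = 1"
  proof (intro prod.neutral ballI)
    show "(\<integral>\<^sup>+t. ennreal (f i t) \<partial>lborel) = 1" for i
      by (cases "i = k")
        (simp_all add: f_def nn_integral_std_normal_density nn_integral_std_normal_density_square)
  qed
  finally show ?thesis .
qed

lemma std_gaussian_component_square:
  "integrable std_gaussian (\<lambda>x::real^'n. (x $ k)\<^sup>2)" "(\<integral>x. (x $ k)\<^sup>2 \<partial>(std_gaussian :: (real^'n) measure)) = 1"
proof -
  have "(\<lambda>x::real^'n. (x $ k)\<^sup>2) \<in> borel_measurable std_gaussian" by measurable
  then show "integrable std_gaussian (\<lambda>x::real^'n. (x $ k)\<^sup>2)"
    "(\<integral>x. (x $ k)\<^sup>2 \<partial>(std_gaussian :: (real^'n) measure)) = 1"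
    using nn_integral_std_gaussian_component[of k]
    by (auto simp: integrable_iff_bounded integral_eq_nn_integral)
qed

lemma sq_integrable_std_gaussian: "sq_integrable std_gaussian (\<lambda>x::real^'n. x)"
proof -
  have "integrable std_gaussian (\<lambda>x::real^'n. \<Sum>i\<in>UNIV. (x $ i)\<^sup>2)"
    by (intro Bochner_Integration.integrable_sum std_gaussian_component_square)
  moreover have "(\<lambda>x::real^'n. x) \<in> borel_measurable std_gaussian" by measurable
  ultimately show ?thesis
    by (simp add: sq_integrable_def norm_sq_eq_sum)
qed

lemma std_gaussian_P2: "std_gaussian \<in> P2"
  by (simp add: P2_iff prob_space_std_gaussian sq_integrable_std_gaussian)

lemma integral_std_gaussian_orthogonal:
  assumes "orthogonal_matrix (Q::real^'n^'n)" "f \<in> borel_measurable borel"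
  shows "(\<integral>x. f (Q *v x) \<partial>std_gaussian) = (\<integral>x. (f x :: 'b::{banach,second_countable_topology}) \<partial>std_gaussian)"
proof -
  have "(*v) Q \<in> measurable std_gaussian borel" by measurable
  from integral_distr[OF this assms(2)] show ?thesis
    by (simp add: std_gaussian_distr_orthogonal[OF assms(1)])
qed

lemma orthogonal_matrix_diag: "(\<And>i. s i * s i = 1) \<Longrightarrow> orthogonal_matrix (diag s)"
  by (simp add: orthogonal_matrix diag_mult_diag diag_one)

text \<open>Means and correlations vanish because the law is invariant under sign changes.\<close>

lemma mean_std_gaussian: "mean (std_gaussian :: (real^'n) measure) = 0"
proof -
  define Q :: "real^'n^'n" where "Q = diag (\<lambda>_. - 1)"
  have "orthogonal_matrix Q" by (simp add: Q_def orthogonal_matrix_diag)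
  moreover have "Q *v x = - x" for x by (simp add: Q_def diag_mult_vec vec_eq_iff)
  ultimately have "(\<integral>x. - x \<partial>(std_gaussian :: (real^'n) measure)) = (\<integral>x. x \<partial>std_gaussian)"
    using integral_std_gaussian_orthogonal[of Q "\<lambda>x. x"] by simp
  then have "- mean (std_gaussian :: (real^'n) measure) = mean std_gaussian"
    by (simp add: mean_def)
  then show ?thesis by (simp add: eq_neg_iff_add_eq_0 vec_eq_iff)
qed

lemma cross_moment_std_gaussian:
  "cross_moment std_gaussian (\<lambda>x. x) (\<lambda>x. x) = (mat 1 :: real^'n^'n)"
proof -
  have "(\<integral>x. x $ i * x $ j \<partial>(std_gaussian :: (real^'n) measure)) = 0" if "i \<noteq> j" for i j :: 'n
  proof -
    define Q :: "real^'n^'n" where "Q = diag (\<lambda>k. if k = i then - 1 else 1)"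
    have "orthogonal_matrix Q" unfolding Q_def by (rule orthogonal_matrix_diag) simp
    moreover have "(Q *v x) $ i * (Q *v x) $ j = - (x $ i * x $ j)" for x
      using that by (simp add: Q_def diag_mult_vec)
    ultimately have "(\<integral>x. - (x $ i * x $ j) \<partial>(std_gaussian :: (real^'n) measure)) = (\<integral>x. x $ i * x $ j \<partial>std_gaussian)"
      using integral_std_gaussian_orthogonal[of Q "\<lambda>x. x $ i * x $ j"] by simp
    then show ?thesis by simp
  qed
  then show ?thesis
    using std_gaussian_component_square(2)
    by (auto simp: cross_moment_def mat_def vec_eq_iff power2_eq_square)
qed

lemma sq_integrable_std_gaussian_affine: "sq_integrable std_gaussian (\<lambda>z. m + B *v z)" for B :: "real^'n^'n"
  by (intro sq_integrable_add sq_integrable_const sq_integrable_matrix sq_integrable_std_gaussian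
      prob_space.finite_measure prob_space_std_gaussian)

lemma std_gaussian_affine_P2: "distr std_gaussian borel (\<lambda>z. m + B *v z) \<in> P2" for B :: "real^'n^'n"
  by (intro distr_P2 prob_space_std_gaussian sq_integrable_std_gaussian_affine)

text \<open>Although \<open>gaussian\<close> uses the positive semi-definite root, every factor
  \<open>B\<close> of the covariance will do: by polar decomposition it differs from the root by a
  rotation, which the standard Gaussian absorbs.\<close>

lemma std_gaussian_affine_eq_gaussian:
  fixes B :: "real^'n^'n"
  shows "distr std_gaussian borel (\<lambda>z. m + B *v z) = gaussian m (B ** transpose B)"
proof -
  obtain Q where Q: "orthogonal_matrix Q" "B = psd_sqrt (B ** transpose B) ** Q"
    using polar_decomposition[of B] .
  define R where "R = psd_sqrt (B ** transpose B)"
  have "(\<lambda>z. m + B *v z) = (\<lambda>z. m + R *v z) \<circ> (*v) Q"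
    using Q(2) by (simp add: fun_eq_iff R_def matrix_vector_mul_assoc)
  then have "distr std_gaussian borel (\<lambda>z. m + B *v z)
      = distr (distr std_gaussian borel ((*v) Q)) borel (\<lambda>z. m + R *v z)"
    by (simp add: distr_distr)
  then show ?thesis by (simp add: std_gaussian_distr_orthogonal[OF Q(1)] gaussian_def R_def)
qed

lemma gaussian_P2: "gaussian m S \<in> P2"
  unfolding gaussian_def by (rule std_gaussian_affine_P2)

lemma mean_gaussian: "mean (gaussian m S) = (m :: real^'n)"
proof -
  interpret prob_space "std_gaussian :: (real^'n) measure" by (rule prob_space_std_gaussian)
  have i: "integrable std_gaussian (\<lambda>z::real^'n. z)" using P2D(5)[OF std_gaussian_P2] .
  have "mean (gaussian m S) = (\<integral>z. m + psd_sqrt S *v z \<partial>std_gaussian)"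
    unfolding gaussian_def by (rule mean_distr) measurable
  also have "\<dots> = m + psd_sqrt S *v mean std_gaussian"
    using i integral_bounded_linear[OF matrix_vector_mul_bounded_linear i, of "psd_sqrt S"]
      integrable_bounded_linear[OF matrix_vector_mul_bounded_linear i, of "psd_sqrt S"]
    by (simp add: mean_def prob_space[simplified])
  finally show ?thesis by (simp add: mean_std_gaussian)
qed

lemma cov_matrix_gaussian:
  assumes "psd S" shows "cov_matrix (gaussian m S) = (S :: real^'n^'n)"
proof -
  have "(\<lambda>z. m + psd_sqrt S *v z) \<in> borel_measurable std_gaussian" by measurable
  from cov_matrix_distr[OF this]
  have "cov_matrix (gaussian m S) = cross_moment std_gaussian (\<lambda>z. psd_sqrt S *v z) (\<lambda>z. psd_sqrt S *v z)"
    using mean_gaussian[of m S] by (simp add: gaussian_def)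
  also have "\<dots> = psd_sqrt S ** transpose (psd_sqrt S)"
    by (simp add: cross_moment_matrix[OF sq_integrable_std_gaussian sq_integrable_std_gaussian]
        cross_moment_std_gaussian)
  finally show ?thesis using psd_sqrt[OF assms] by (simp add: psd_symmetric)
qed

lemma nn_integral_gaussian_orthogonal:
  fixes B Q :: "real^'n^'n"
  assumes "orthogonal_matrix Q" and [measurable]: "f \<in> borel_measurable borel"
  shows "(\<integral>\<^sup>+z. f (B *v (Q *v z)) \<partial>std_gaussian) = (\<integral>\<^sup>+z. f (B *v z) \<partial>std_gaussian)"
proof -
  have "(*v) Q \<in> measurable std_gaussian borel" by measurable
  from nn_integral_distr[OF this, of "\<lambda>z. f (B *v z)"] show ?thesis
    by (simp add: std_gaussian_distr_orthogonal[OF assms(1)])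
qed

lemma gaussian_cx_le:
  fixes S1 S2 :: "real^'n^'n"
  assumes S1: "psd S1" and S2: "psd S2" and le: "S1 \<preceq>\<^sub>L S2"
  shows "gaussian m S1 \<le>\<^sub>c\<^sub>x gaussian m S2"
  unfolding cx_le_iff_nonneg[OF gaussian_P2 gaussian_P2]
proof (intro allI impI)
  fix h :: "real^'n \<Rightarrow> real" assume h: "convex_on UNIV h" and h0: "\<forall>x. 0 \<le> h x"
  note [measurable] = convex_on_borel_measurable[OF h]
  have "norm (psd_sqrt S1 *v x) \<le> norm (psd_sqrt S2 *v x)" for x
  proof (rule power2_le_imp_le)
    have "0 \<le> x \<bullet> ((S2 - S1) *v x)" using le by (simp add: loewner_le_def psd_def)
    then show "(norm (psd_sqrt S1 *v x))\<^sup>2 \<le> (norm (psd_sqrt S2 *v x))\<^sup>2"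
      using psd_sqrt[OF S1] psd_sqrt[OF S2]
      by (simp add: norm_psd_mult matrix_vector_mult_diff_rdistrib inner_diff_right)
  qed simp
  then obtain K where K: "contraction K" "psd_sqrt S1 = psd_sqrt S2 ** K"
    using contraction_of_mult_le[OF psd_psd_sqrt[OF S1] psd_psd_sqrt[OF S2]] by metis
  obtain F c where F: "finite F" "\<forall>Q\<in>F. orthogonal_matrix Q"
    and c: "\<forall>Q\<in>F. 0 \<le> c Q" "sum c F = 1" "K = (\<Sum>Q\<in>F. c Q *\<^sub>R Q)"
    by (rule contraction_convex_combination[OF K(1)])
  define g where "g y = ennreal (h (m + y))" for y
  have [measurable]: "g \<in> borel_measurable borel" unfolding g_def by measurable
  define I where "I = (\<integral>\<^sup>+z. g (psd_sqrt S2 *v z) \<partial>std_gaussian)"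
  have lin: "psd_sqrt S1 *v z = (\<Sum>Q\<in>F. c Q *\<^sub>R (psd_sqrt S2 *v (Q *v z)))" for z
  proof -
    have "K *v z = (\<Sum>Q\<in>F. c Q *\<^sub>R (Q *v z))"
      unfolding c(3) by (induction F rule: infinite_finite_induct)
        (simp_all add: matrix_vector_mult_add_rdistrib flip: scaleR_matrix_vector_assoc)
    moreover have "psd_sqrt S2 *v (\<Sum>Q\<in>F. c Q *\<^sub>R (Q *v z)) = (\<Sum>Q\<in>F. c Q *\<^sub>R (psd_sqrt S2 *v (Q *v z)))"
      by (simp add: linear_sum[OF matrix_vector_mul_linear] matrix_vector_mult_scaleR)
    ultimately show ?thesis by (simp add: K(2) flip: matrix_vector_mul_assoc)
  qed
  have "(\<integral>\<^sup>+x. ennreal (h x) \<partial>gaussian m S1) = (\<integral>\<^sup>+z. g (psd_sqrt S1 *v z) \<partial>std_gaussian)"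
    unfolding gaussian_def g_def by (subst nn_integral_distr) auto
  also have "\<dots> \<le> (\<integral>\<^sup>+z. (\<Sum>Q\<in>F. ennreal (c Q) * g (psd_sqrt S2 *v (Q *v z))) \<partial>std_gaussian)"
  proof (rule nn_integral_mono)
    fix z
    \<comment> \<open>The weights sum to 1, so the mean can be distributed over the combination and
      Jensen's inequality applies for each fixed \<open>z\<close>.\<close>
    have "m + psd_sqrt S1 *v z = (\<Sum>Q\<in>F. c Q *\<^sub>R (m + psd_sqrt S2 *v (Q *v z)))"
      by (simp add: lin scaleR_add_right sum.distrib flip: scaleR_sum_left) (simp add: c)
    then have "h (m + psd_sqrt S1 *v z) \<le> (\<Sum>Q\<in>F. c Q * h (m + psd_sqrt S2 *v (Q *v z)))"
      using F(1) c convex_on_sum[OF F(1) _ h, of c "\<lambda>Q. m + psd_sqrt S2 *v (Q *v z)"] by fastforce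
    then have "g (psd_sqrt S1 *v z) \<le> ennreal (\<Sum>Q\<in>F. c Q * h (m + psd_sqrt S2 *v (Q *v z)))"
      unfolding g_def by (rule ennreal_leI)
    also have "\<dots> = (\<Sum>Q\<in>F. ennreal (c Q) * g (psd_sqrt S2 *v (Q *v z)))"
      using c(1) h0 by (simp add: g_def ennreal_mult[symmetric] sum_ennreal)
    finally show "g (psd_sqrt S1 *v z) \<le> (\<Sum>Q\<in>F. ennreal (c Q) * g (psd_sqrt S2 *v (Q *v z)))" .
  qed
  also have "\<dots> = (\<Sum>Q\<in>F. ennreal (c Q) * (\<integral>\<^sup>+z. g (psd_sqrt S2 *v (Q *v z)) \<partial>std_gaussian))"
    by (subst nn_integral_sum) (auto simp: nn_integral_cmult)
  also have "\<dots> = (\<Sum>Q\<in>F. ennreal (c Q) * I)"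
    using F(2) by (simp add: nn_integral_gaussian_orthogonal I_def)
  also have "\<dots> = (\<Sum>Q\<in>F. ennreal (c Q)) * I" by (simp only: sum_distrib_right)
  also have "(\<Sum>Q\<in>F. ennreal (c Q)) = ennreal (sum c F)" using c(1) by (intro sum_ennreal) auto
  also have "ennreal (sum c F) * I = (\<integral>\<^sup>+x. ennreal (h x) \<partial>gaussian m S2)"
    unfolding gaussian_def I_def g_def c(2) by (subst nn_integral_distr) auto
  finally show "(\<integral>\<^sup>+x. ennreal (h x) \<partial>gaussian m S1) \<le> (\<integral>\<^sup>+x. ennreal (h x) \<partial>gaussian m S2)" .
qed

subsection \<open>Couplings and the Wasserstein distance\<close>

lemma sq_integrable_of_distr:
  assumes "distr M borel X \<in> P2" "X \<in> borel_measurable M" shows "sq_integrable M X"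
  using assms by (auto simp: P2_def sq_integrable_def integrable_distr_eq)

lemma couplingsD:
  assumes \<pi>: "\<pi> \<in> couplings \<mu> \<nu>"
  shows "prob_space \<pi>" "sets \<pi> = sets borel" "fst \<in> borel_measurable \<pi>" "snd \<in> borel_measurable \<pi>"
    "distr \<pi> borel fst = \<mu>" "distr \<pi> borel snd = \<nu>" "space \<pi> = UNIV"
proof -
  show s: "sets \<pi> = sets borel" and "prob_space \<pi>" "distr \<pi> borel fst = \<mu>" "distr \<pi> borel snd = \<nu>"
    using \<pi> by (auto simp: couplings_def)
  show "space \<pi> = UNIV" using sets_eq_imp_space_eq[OF s] by simp
  have "fst \<in> borel_measurable (borel :: ((real^'a) \<times> (real^'a)) measure)"
    "snd \<in> borel_measurable (borel :: ((real^'a) \<times> (real^'a)) measure)"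
    by (intro borel_measurable_continuous_onI continuous_intros)+
  then show "fst \<in> borel_measurable \<pi>" "snd \<in> borel_measurable \<pi>"
    using s measurable_cong_sets by blast+
qed

lemma couplings_sq_integrable:
  assumes "\<pi> \<in> couplings \<mu> \<nu>" "\<mu> \<in> P2" "\<nu> \<in> P2"
  shows "sq_integrable \<pi> fst" "sq_integrable \<pi> snd"
  using assms couplingsD[OF assms(1)] by (auto intro!: sq_integrable_of_distr)

lemma coupling_of_pair:
  assumes M: "prob_space M" and [measurable]: "X \<in> borel_measurable M" "Y \<in> borel_measurable M"
  shows "distr M borel (\<lambda>z. (X z, Y z)) \<in> couplings (distr M borel X) (distr M borel Y)"
proof -
  have f: "fst \<in> borel_measurable (borel :: ((real^'b) \<times> (real^'b)) measure)"
    "snd \<in> borel_measurable (borel :: ((real^'b) \<times> (real^'b)) measure)"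
    by (intro borel_measurable_continuous_onI continuous_intros)+
  have p: "(\<lambda>z. (X z, Y z)) \<in> borel_measurable M" by measurable
  show ?thesis
    unfolding couplings_def using M f p
    by (auto simp: prob_space.prob_space_distr distr_distr comp_def)
qed

text \<open>The independent coupling makes the infimum in \<open>W2\<close> finite and starts the
  search for an optimal map.\<close>

lemma couplings_nonempty:
  assumes "\<mu> \<in> P2" "\<nu> \<in> P2" shows "\<exists>\<pi>. \<pi> \<in> couplings \<mu> \<nu>"
proof -
  interpret M: prob_space \<mu> using assms P2D by blast
  interpret N: prob_space \<nu> using assms P2D by blast
  interpret P: pair_prob_space \<mu> \<nu> ..
  have [measurable_cong]: "sets \<mu> = sets borel" "sets \<nu> = sets borel" using assms P2D by auto
  have d: "distr (\<mu> \<Otimes>\<^sub>M \<nu>) borel fst = \<mu>"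
  proof (rule measure_eqI)
    fix A assume "A \<in> sets (distr (\<mu> \<Otimes>\<^sub>M \<nu>) borel fst)"
    then have A[measurable]: "A \<in> sets borel" by simp
    have "fst -` A \<inter> space (\<mu> \<Otimes>\<^sub>M \<nu>) = A \<times> space \<nu>"
      using assms by (auto simp: space_pair_measure P2D)
    then show "emeasure (distr (\<mu> \<Otimes>\<^sub>M \<nu>) borel fst) A = emeasure \<mu> A"
      using N.emeasure_space_1 by (simp add: emeasure_distr N.emeasure_pair_measure_Times assms P2D)
  qed (use assms P2D in auto)
  have e: "distr (\<mu> \<Otimes>\<^sub>M \<nu>) borel snd = \<nu>"
  proof (rule measure_eqI)
    fix A assume "A \<in> sets (distr (\<mu> \<Otimes>\<^sub>M \<nu>) borel snd)"
    then have A[measurable]: "A \<in> sets borel" by simp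
    have "snd -` A \<inter> space (\<mu> \<Otimes>\<^sub>M \<nu>) = space \<mu> \<times> A"
      using assms by (auto simp: space_pair_measure P2D)
    then show "emeasure (distr (\<mu> \<Otimes>\<^sub>M \<nu>) borel snd) A = emeasure \<nu> A"
      using M.emeasure_space_1 by (simp add: emeasure_distr N.emeasure_pair_measure_Times assms P2D)
  qed (use assms P2D in auto)
  \<comment> \<open>Pushing the product measure forward by the identity pair places it on the Borel
    sets of the product space, as \<open>couplings\<close> demands.\<close>
  have "distr (\<mu> \<Otimes>\<^sub>M \<nu>) borel (\<lambda>z. (fst z, snd z)) \<in> couplings \<mu> \<nu>"
    using coupling_of_pair[of "\<mu> \<Otimes>\<^sub>M \<nu>" fst snd] P.P.prob_space_axioms d e by simp
  then show ?thesis by blast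
qed

section \<open>Transport cost and almost optimal couplings\<close>

definition transport_cost :: "((real^'n) \<times> (real^'n)) measure \<Rightarrow> real" where
  "transport_cost \<pi> = (\<integral>z. (norm (fst z - snd z))\<^sup>2 \<partial>\<pi>)"

lemma couplings_cost:
  assumes "\<pi> \<in> couplings \<mu> \<nu>" "\<mu> \<in> P2" "\<nu> \<in> P2"
  shows "(\<integral>\<^sup>+z. ennreal ((norm (fst z - snd z))\<^sup>2) \<partial>\<pi>) = ennreal (transport_cost \<pi>)"
proof -
  have "sq_integrable \<pi> (\<lambda>z. fst z - snd z)"
    using couplings_sq_integrable[OF assms] by (rule sq_integrable_diff)
  then show ?thesis
    by (simp add: nn_integral_eq_integral sq_integrable_def transport_cost_def)
qed

lemma transport_cost_nonneg: "0 \<le> transport_cost \<pi>"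
  by (simp add: transport_cost_def integral_nonneg_AE)

lemma ennreal_W2_sq:
  assumes "\<mu> \<in> P2" "\<nu> \<in> P2"
  shows "ennreal ((W2 \<mu> \<nu>)\<^sup>2) = (INF \<pi>\<in>couplings \<mu> \<nu>. ennreal (transport_cost \<pi>))"
proof -
  let ?I = "INF \<pi>\<in>couplings \<mu> \<nu>. ennreal (transport_cost \<pi>)"
  obtain \<pi> where "\<pi> \<in> couplings \<mu> \<nu>" using couplings_nonempty[OF assms] by blast
  then have "?I \<le> ennreal (transport_cost \<pi>)" by (rule INF_lower)
  then have "?I < top" using ennreal_less_top le_less_trans by blast
  moreover have "(INF \<pi>\<in>couplings \<mu> \<nu>. \<integral>\<^sup>+z. ennreal ((norm (fst z - snd z))\<^sup>2) \<partial>\<pi>) = ?I"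
    using couplings_cost assms by (intro INF_cong) auto
  ultimately show ?thesis by (simp add: W2_def)
qed

lemma W2_sq_le_cost:
  assumes "\<mu> \<in> P2" "\<nu> \<in> P2" "\<pi> \<in> couplings \<mu> \<nu>"
  shows "(W2 \<mu> \<nu>)\<^sup>2 \<le> transport_cost \<pi>"
proof -
  have "ennreal ((W2 \<mu> \<nu>)\<^sup>2) \<le> ennreal (transport_cost \<pi>)"
    unfolding ennreal_W2_sq[OF assms(1,2)] using assms(3) by (rule INF_lower)
  then show ?thesis by (simp add: ennreal_le_iff transport_cost_nonneg)
qed

lemma W2_sq_approx:
  assumes "\<mu> \<in> P2" "\<nu> \<in> P2" "0 < e"
  obtains \<pi> where "\<pi> \<in> couplings \<mu> \<nu>" "transport_cost \<pi> < (W2 \<mu> \<nu>)\<^sup>2 + e"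
proof -
  have "(INF \<pi>\<in>couplings \<mu> \<nu>. ennreal (transport_cost \<pi>)) < ennreal ((W2 \<mu> \<nu>)\<^sup>2 + e)"
    unfolding ennreal_W2_sq[OF assms(1,2), symmetric] using assms(3)
    by (intro ennreal_lessI add_nonneg_pos) auto
  then obtain \<pi> where "\<pi> \<in> couplings \<mu> \<nu>" "ennreal (transport_cost \<pi>) < ennreal ((W2 \<mu> \<nu>)\<^sup>2 + e)"
    by (auto simp: INF_less_iff)
  then show thesis using that by (simp add: ennreal_less_iff transport_cost_nonneg)
qed

lemma W2_sq_greatest:
  assumes "\<mu> \<in> P2" "\<nu> \<in> P2" "\<And>\<pi>. \<pi> \<in> couplings \<mu> \<nu> \<Longrightarrow> c \<le> transport_cost \<pi>"
  shows "c \<le> (W2 \<mu> \<nu>)\<^sup>2"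
proof (rule field_le_epsilon)
  fix e :: real assume "0 < e"
  then obtain \<pi> where "\<pi> \<in> couplings \<mu> \<nu>" "transport_cost \<pi> < (W2 \<mu> \<nu>)\<^sup>2 + e"
    using W2_sq_approx[OF assms(1,2)] by blast
  with assms(3) show "c \<le> (W2 \<mu> \<nu>)\<^sup>2 + e" by force
qed

text \<open>Source of all upper bounds: any square integrable pair on any probability space is a
  competitor for its two laws.\<close>

lemma W2_sq_le_expectation:
  assumes M: "prob_space M" and X: "sq_integrable M X" and Y: "sq_integrable M Y"
  shows "(W2 (distr M borel X) (distr M borel Y))\<^sup>2 \<le> (\<integral>z. (norm (X z - Y z))\<^sup>2 \<partial>M)"
proof -
  have [measurable]: "X \<in> borel_measurable M" "Y \<in> borel_measurable M" using X Y by (auto simp: sq_integrable_def)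
  have c: "distr M borel (\<lambda>z. (X z, Y z)) \<in> couplings (distr M borel X) (distr M borel Y)"
    by (rule coupling_of_pair[OF M]) measurable
  have "transport_cost (distr M borel (\<lambda>z. (X z, Y z))) = (\<integral>z. (norm (X z - Y z))\<^sup>2 \<partial>M)"
    unfolding transport_cost_def by (subst integral_distr) (auto intro!: borel_measurable_continuous_onI continuous_intros)
  then show ?thesis
    using W2_sq_le_cost[OF distr_P2[OF M X] distr_P2[OF M Y] c] by simp
qed

lemma W2_nonneg: "0 \<le> W2 \<mu> \<nu>"
  by (simp add: W2_def)

lemma W2_le_iff: "W2 \<mu> \<nu> \<le> W2 \<mu>' \<nu>' \<longleftrightarrow> (W2 \<mu> \<nu>)\<^sup>2 \<le> (W2 \<mu>' \<nu>')\<^sup>2"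
  using W2_nonneg by (meson power2_le_imp_le power_mono)

lemma W2_sq_commute_le:
  assumes "\<mu> \<in> P2" "\<nu> \<in> P2" shows "(W2 \<nu> \<mu>)\<^sup>2 \<le> (W2 \<mu> \<nu>)\<^sup>2"
proof (rule W2_sq_greatest[OF assms])
  fix \<pi> assume \<pi>: "\<pi> \<in> couplings \<mu> \<nu>"
  from W2_sq_le_expectation[OF couplingsD(1)[OF \<pi>] couplings_sq_integrable(2,1)[OF \<pi> assms]]
  show "(W2 \<nu> \<mu>)\<^sup>2 \<le> transport_cost \<pi>"
    by (simp add: couplingsD[OF \<pi>] transport_cost_def norm_minus_commute)
qed

subsection \<open>Measures at distance zero\<close>

text \<open>If the first point lies in \<open>C\<close> and the two points are closer than
  \<open>d\<close>, the second lies in the \<open>d\<close>-enlargement of \<open>C\<close>.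
  Markov's inequality bounds the probability that they are farther apart.\<close>

lemma coupling_measure_closed_le:
  assumes \<pi>: "\<pi> \<in> couplings \<alpha> \<beta>" and P2: "\<alpha> \<in> P2" "\<beta> \<in> P2" and C: "closed C" and d: "0 < d"
  shows "measure \<alpha> C \<le> measure \<beta> {x. infdist x C \<le> d} + transport_cost \<pi> / d\<^sup>2"
proof -
  note c = couplingsD[OF \<pi>] and s = couplings_sq_integrable[OF \<pi> P2]
  interpret prob_space \<pi> by (rule c(1))
  define D where "D = {x. infdist x C \<le> d}"
  have "closed D" unfolding D_def by (intro closed_Collect_le continuous_intros)
  then have [measurable]: "fst \<in> borel_measurable \<pi>" "snd \<in> borel_measurable \<pi>" "C \<in> sets borel" "D \<in> sets borel"
    using c C by auto
  define F where "F = {z \<in> space \<pi>. d\<^sup>2 \<le> (norm (fst z - snd z))\<^sup>2}"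
  have [measurable]: "F \<in> sets \<pi>" unfolding F_def by measurable
  have "fst -` C \<inter> space \<pi> \<subseteq> (snd -` D \<inter> space \<pi>) \<union> F"
  proof
    fix z assume z: "z \<in> fst -` C \<inter> space \<pi>"
    show "z \<in> (snd -` D \<inter> space \<pi>) \<union> F"
    proof (cases "norm (fst z - snd z) < d")
      case True
      then have "infdist (snd z) C \<le> d"
        using z infdist_le2[of "fst z" C "snd z" d] by (auto simp: dist_norm norm_minus_commute)
      then show ?thesis using z by (auto simp: D_def)
    next
      case False
      then have "d\<^sup>2 \<le> (norm (fst z - snd z))\<^sup>2" using d by (intro power_mono) auto
      then show ?thesis using z by (auto simp: F_def)
    qed
  qed
  then have "measure \<pi> (fst -` C \<inter> space \<pi>) \<le> measure \<pi> ((snd -` D \<inter> space \<pi>) \<union> F)"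
    by (intro finite_measure_mono) measurable
  also have "\<dots> \<le> measure \<pi> (snd -` D \<inter> space \<pi>) + measure \<pi> F"
    by (intro measure_Un_le) measurable
  also have "measure \<pi> F \<le> transport_cost \<pi> / d\<^sup>2"
    unfolding F_def transport_cost_def using sq_integrable_diff[OF s] d
    by (intro integral_Markov_inequality_measure[of _ _ "{}"]) (auto simp: sq_integrable_def)
  also have "measure \<pi> (fst -` C \<inter> space \<pi>) = measure \<alpha> C" unfolding c(5)[symmetric] by (simp add: measure_distr)
  also have "measure \<pi> (snd -` D \<inter> space \<pi>) = measure \<beta> D" unfolding c(6)[symmetric] by (simp add: measure_distr)
  finally show ?thesis by (simp add: D_def)
qed

text \<open>For a fixed enlargement of width d, a coupling of cost below e d^2 makes the Markov
  error at most e. Letting e and then d tend to 0 leaves \<open>C\<close> itself, because the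
  enlargements of a closed set decrease to it.\<close>

lemma W2_eq_0_measure_closed_le:
  fixes C :: "(real^'n) set"
  assumes P2: "\<alpha> \<in> P2" "\<beta> \<in> P2" and 0: "W2 \<alpha> \<beta> = 0" and C: "closed C"
  shows "measure \<alpha> C \<le> measure \<beta> C"
\<comment> \<open>The empty set is treated apart because \<open>infdist\<close> to it is 0 by
  convention, so its enlargements would be the whole space.\<close>
proof (cases "C = {}")
  case False
  interpret B: prob_space \<beta> using P2 P2D by blast
  define E where "E n = {x. infdist x C \<le> 1 / real (Suc n)}" for n
  have clE: "closed (E n)" for n unfolding E_def by (intro closed_Collect_le continuous_intros)
  have le: "measure \<alpha> C \<le> measure \<beta> (E n)" for n
  proof (rule field_le_epsilon)
    fix e :: real assume e: "0 < e"
    define d where "d = 1 / real (Suc n)"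
    have d: "0 < d" by (simp add: d_def)
    obtain \<pi> where \<pi>: "\<pi> \<in> couplings \<alpha> \<beta>" "transport_cost \<pi> < (W2 \<alpha> \<beta>)\<^sup>2 + e * d\<^sup>2"
      using W2_sq_approx[OF P2, of "e * d\<^sup>2"] e d by auto
    have "transport_cost \<pi> / d\<^sup>2 \<le> e" using \<pi>(2) d by (simp add: 0 divide_le_eq)
    then show "measure \<alpha> C \<le> measure \<beta> (E n) + e"
      using coupling_measure_closed_le[OF \<pi>(1) P2 C d] by (simp add: E_def d_def)
  qed
  have "(\<Inter>n. E n) = C"
  proof
    show "C \<subseteq> (\<Inter>n. E n)" by (auto simp: E_def)
    show "(\<Inter>n. E n) \<subseteq> C"
    proof
      fix x assume "x \<in> (\<Inter>n. E n)"
      then have "infdist x C \<le> 1 / real (Suc n)" for n by (auto simp: E_def)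
      moreover have "(\<lambda>n. 1 / real (Suc n)) \<longlonglongrightarrow> 0" by (rule LIMSEQ_Suc[OF lim_1_over_n])
      ultimately have "infdist x C \<le> 0" by (intro LIMSEQ_le_const) auto
      then have "infdist x C = 0" using infdist_nonneg[of x C] by linarith
      then show "x \<in> C" using in_closed_iff_infdist_zero[OF C False] by simp
    qed
  qed
  moreover have "(\<lambda>n. measure \<beta> (E n)) \<longlonglongrightarrow> measure \<beta> (\<Inter>n. E n)"
  proof (rule B.finite_Lim_measure_decseq)
    show "range E \<subseteq> sets \<beta>" using clE by (auto simp: P2D(2)[OF P2(2)])
    have "1 / real (Suc (Suc n)) \<le> 1 / real (Suc n)" for n by (simp add: frac_le)
    then show "decseq E" by (intro decseq_SucI) (auto simp: E_def intro: order_trans)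
  qed
  ultimately show ?thesis using LIMSEQ_le_const[of _ "measure \<beta> C"] le by simp
qed simp

lemma measure_eq_closedI:
  fixes \<alpha> \<beta> :: "(real^'n) measure"
  assumes "prob_space \<alpha>" "prob_space \<beta>" and s: "sets \<alpha> = sets borel" "sets \<beta> = sets borel"
    and eq: "\<And>C. closed C \<Longrightarrow> measure \<alpha> C = measure \<beta> C"
  shows "\<alpha> = \<beta>"
proof (rule measure_eqI_generator_eq[where E = "Collect closed" and \<Omega> = UNIV and A = "\<lambda>_. UNIV"])
  interpret A: prob_space \<alpha> by fact
  interpret B: prob_space \<beta> by fact
  show "Int_stable (Collect closed)" by (auto simp: Int_stable_def)
  show "sets \<alpha> = sigma_sets UNIV (Collect closed)" "sets \<beta> = sigma_sets UNIV (Collect closed)"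
    unfolding s by (subst borel_eq_closed, simp)+
  show "emeasure \<alpha> X = emeasure \<beta> X" if "X \<in> Collect closed" for X
    using that eq by (simp add: A.emeasure_eq_measure B.emeasure_eq_measure)
qed (auto simp: prob_space.emeasure_space_1 finite_measure.emeasure_finite prob_space.finite_measure assms)

lemma W2_eq_0_imp_eq:
  fixes \<alpha> \<beta> :: "(real^'n) measure"
  assumes \<alpha>: "\<alpha> \<in> P2" and \<beta>: "\<beta> \<in> P2" and 0: "W2 \<alpha> \<beta> = 0"
  shows "\<alpha> = \<beta>"
proof (rule measure_eq_closedI)
  have "W2 \<beta> \<alpha> = 0" using W2_sq_commute_le[OF \<alpha> \<beta>] by (simp add: 0)
  then show "measure \<alpha> C = measure \<beta> C" if "closed C" for C
    using W2_eq_0_measure_closed_le[OF \<alpha> \<beta> 0 that] W2_eq_0_measure_closed_le[OF \<beta> \<alpha> _ that] by simp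
qed (use \<alpha> \<beta> P2D in auto)

lemma W2_eq_0I:
  assumes "\<And>e. 0 < e \<Longrightarrow> (W2 \<alpha> \<beta>)\<^sup>2 \<le> e" shows "W2 \<alpha> \<beta> = 0"
proof -
  have "(W2 \<alpha> \<beta>)\<^sup>2 \<le> 0"
  proof (rule field_le_epsilon)
    show "(W2 \<alpha> \<beta>)\<^sup>2 \<le> 0 + e" if "0 < e" for e using assms[OF that] by simp
  qed
  then show ?thesis by simp
qed

subsection \<open>The Gelbrich bound\<close>

text \<open>In quantum information this is the root fidelity;
  \<open>trace A + trace B - 2 * fidelity A B\<close> is the squared Bures distance.\<close>

definition fidelity :: "real^'n^'n \<Rightarrow> real^'n^'n \<Rightarrow> real" where
  "fidelity A B = trace (psd_sqrt (psd_sqrt A ** B ** psd_sqrt A))"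

lemma expectation_dist_sq:
  assumes M: "prob_space M" and X: "sq_integrable M X" and Y: "sq_integrable M Y"
    and a: "(\<integral>z. X z \<partial>M) = a" and b: "(\<integral>z. Y z \<partial>M) = b"
  shows "(\<integral>z. (norm (X z - Y z))\<^sup>2 \<partial>M) = (norm (a - b))\<^sup>2
    + trace (cross_moment M (\<lambda>z. X z - a) (\<lambda>z. X z - a)) + trace (cross_moment M (\<lambda>z. Y z - b) (\<lambda>z. Y z - b))
    - 2 * (\<integral>z. (X z - a) \<bullet> (Y z - b) \<partial>M)"
proof -
  interpret prob_space M by fact
  define U V where "U z = X z - a" and "V z = Y z - b" for z
  have U: "sq_integrable M U"
    unfolding U_def[abs_def] by (intro sq_integrable_diff X sq_integrable_const finite_measure_axioms)
  have V: "sq_integrable M V"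
    unfolding V_def[abs_def] by (intro sq_integrable_diff Y sq_integrable_const finite_measure_axioms)
  have i: "integrable M X" "integrable M Y" "integrable M U" "integrable M V"
    using X Y U V finite_measure_axioms by (auto intro: sq_integrable_integrable)
  have 0: "(\<integral>z. U z \<partial>M) = 0" "(\<integral>z. V z \<partial>M) = 0"
    using i a b by (simp_all add: prob_space U_def V_def)
  note ii = sq_integrable_inner[OF U U] sq_integrable_inner[OF V V] sq_integrable_inner[OF U V]
  have "(norm (X z - Y z))\<^sup>2 = (norm (a - b))\<^sup>2 + U z \<bullet> U z + V z \<bullet> V z - 2 * (U z \<bullet> V z)
      + ((2 *\<^sub>R (a - b)) \<bullet> U z - (2 *\<^sub>R (a - b)) \<bullet> V z)" for z
    by (simp add: U_def V_def power2_norm_eq_inner inner_diff_left inner_diff_right inner_commute algebra_simps)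
  then have "(\<integral>z. (norm (X z - Y z))\<^sup>2 \<partial>M) = (norm (a - b))\<^sup>2 + (\<integral>z. U z \<bullet> U z \<partial>M)
      + (\<integral>z. V z \<bullet> V z \<partial>M) - 2 * (\<integral>z. U z \<bullet> V z \<partial>M)
      + ((2 *\<^sub>R (a - b)) \<bullet> (\<integral>z. U z \<partial>M) - (2 *\<^sub>R (a - b)) \<bullet> (\<integral>z. V z \<partial>M))"
    using ii i by (simp add: prob_space)
  then show ?thesis
    by (simp add: 0 trace_cross_moment[OF U U] trace_cross_moment[OF V V] flip: U_def V_def)
qed

lemma coupling_cost_eq:
  assumes \<pi>: "\<pi> \<in> couplings \<mu> \<nu>" and \<mu>: "\<mu> \<in> P2" and \<nu>: "\<nu> \<in> P2"
  shows "transport_cost \<pi> = (norm (mean \<mu> - mean \<nu>))\<^sup>2 + trace (cov_matrix \<mu>) + trace (cov_matrix \<nu>)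
    - 2 * (\<integral>z. (fst z - mean \<mu>) \<bullet> (snd z - mean \<nu>) \<partial>\<pi>)"
  and coupling_cov: "cov_matrix \<mu> = cross_moment \<pi> (\<lambda>z. fst z - mean \<mu>) (\<lambda>z. fst z - mean \<mu>)"
    "cov_matrix \<nu> = cross_moment \<pi> (\<lambda>z. snd z - mean \<nu>) (\<lambda>z. snd z - mean \<nu>)"
proof -
  note c = couplingsD[OF \<pi>] and s = couplings_sq_integrable[OF \<pi> \<mu> \<nu>]
  show cov: "cov_matrix \<mu> = cross_moment \<pi> (\<lambda>z. fst z - mean \<mu>) (\<lambda>z. fst z - mean \<mu>)"
    "cov_matrix \<nu> = cross_moment \<pi> (\<lambda>z. snd z - mean \<nu>) (\<lambda>z. snd z - mean \<nu>)"
    using cov_matrix_distr[OF c(3)] cov_matrix_distr[OF c(4)] by (simp_all add: c(5,6))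
  have "(\<integral>z. fst z \<partial>\<pi>) = mean \<mu>" "(\<integral>z. snd z \<partial>\<pi>) = mean \<nu>"
    using mean_distr[OF c(3)] mean_distr[OF c(4)] by (simp_all add: c(5,6))
  from expectation_dist_sq[OF c(1) s this]
  show "transport_cost \<pi> = (norm (mean \<mu> - mean \<nu>))\<^sup>2 + trace (cov_matrix \<mu>) + trace (cov_matrix \<nu>)
    - 2 * (\<integral>z. (fst z - mean \<mu>) \<bullet> (snd z - mean \<nu>) \<partial>\<pi>)"
    unfolding cov transport_cost_def by simp
qed

lemma coupling_centered:
  assumes "\<pi> \<in> couplings \<mu> \<nu>" "\<mu> \<in> P2" "\<nu> \<in> P2"
  shows "sq_integrable \<pi> (\<lambda>z. fst z - a)" "sq_integrable \<pi> (\<lambda>z. snd z - b)"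
  using couplings_sq_integrable[OF assms] couplingsD(1)[OF assms(1)]
  by (auto intro!: sq_integrable_diff sq_integrable_const prob_space.finite_measure)

lemma gelbrich_bound:
  assumes \<mu>: "\<mu> \<in> P2" and \<nu>: "\<nu> \<in> P2"
  shows "(norm (mean \<mu> - mean \<nu>))\<^sup>2 + trace (cov_matrix \<mu>) + trace (cov_matrix \<nu>)
    - 2 * fidelity (cov_matrix \<mu>) (cov_matrix \<nu>) \<le> (W2 \<mu> \<nu>)\<^sup>2"
proof (rule W2_sq_greatest[OF \<mu> \<nu>])
  fix \<pi> assume \<pi>: "\<pi> \<in> couplings \<mu> \<nu>"
  from expectation_inner_le[OF coupling_centered[OF \<pi> \<mu> \<nu>]]
  have "(\<integral>z. (fst z - mean \<mu>) \<bullet> (snd z - mean \<nu>) \<partial>\<pi>) \<le> fidelity (cov_matrix \<mu>) (cov_matrix \<nu>)"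
    unfolding fidelity_def coupling_cov(1)[OF \<pi> \<mu> \<nu>] coupling_cov(2)[OF \<pi> \<mu> \<nu>] .
  then show "(norm (mean \<mu> - mean \<nu>))\<^sup>2 + trace (cov_matrix \<mu>) + trace (cov_matrix \<nu>)
    - 2 * fidelity (cov_matrix \<mu>) (cov_matrix \<nu>) \<le> transport_cost \<pi>"
    unfolding coupling_cost_eq[OF \<pi> \<mu> \<nu>] by simp
qed

text \<open>A factor of \<open>B\<close> is determined only up to a rotation on the right. This
  freedom is used to align it with the root of \<open>A\<close>.\<close>

lemma fidelity_attained:
  assumes A: "psd A" and B: "psd B"
  obtains Q where "orthogonal_matrix Q" "trace (psd_sqrt A ** psd_sqrt B ** Q) = fidelity A B"
proof -
  obtain Q where Q: "orthogonal_matrix Q" "trace (psd_sqrt A ** psd_sqrt B ** Q)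
      = trace (psd_sqrt ((psd_sqrt A ** psd_sqrt B) ** transpose (psd_sqrt A ** psd_sqrt B)))"
    using trace_mult_orthogonal_attained[of "psd_sqrt A ** psd_sqrt B"] .
  have "(psd_sqrt A ** psd_sqrt B) ** transpose (psd_sqrt A ** psd_sqrt B)
      = psd_sqrt A ** (psd_sqrt B ** psd_sqrt B) ** psd_sqrt A"
    using psd_symmetric[OF psd_psd_sqrt[OF A]] psd_symmetric[OF psd_psd_sqrt[OF B]]
    by (simp add: matrix_transpose_mul matrix_mul_assoc)
  then have "trace (psd_sqrt A ** psd_sqrt B ** Q) = fidelity A B"
    using Q(2) by (simp add: fidelity_def psd_sqrt_mult_self[OF B])
  with Q(1) that show thesis by blast
qed

lemma W2_gaussian:
  fixes A B :: "real^'n^'n"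
  assumes A: "psd A" and B: "psd B"
  shows "(W2 (gaussian a A) (gaussian b B))\<^sup>2 = (norm (a - b))\<^sup>2 + trace A + trace B - 2 * fidelity A B"
proof (rule antisym)
  show "(norm (a - b))\<^sup>2 + trace A + trace B - 2 * fidelity A B \<le> (W2 (gaussian a A) (gaussian b B))\<^sup>2"
    using gelbrich_bound[OF gaussian_P2 gaussian_P2, of a A b B]
    by (simp add: mean_gaussian cov_matrix_gaussian A B)
  obtain Q where Q: "orthogonal_matrix Q" "trace (psd_sqrt A ** psd_sqrt B ** Q) = fidelity A B"
    using fidelity_attained[OF A B] .
  \<comment> \<open>Both Gaussians are images of one standard Gaussian. Since S S^T = B, the
    rotation \<open>Q\<close> leaves the second law unchanged while raising the correlation to its
    maximum.\<close>
  define R S where "R = psd_sqrt A" and "S = psd_sqrt B ** Q"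
  have R: "transpose R = R" "R ** R = A"
    using psd_sqrt[OF A] by (auto simp: R_def psd_symmetric)
  have S: "S ** transpose S = B"
    using psd_sqrt[OF B]
    by (simp add: S_def matrix_transpose_mul matrix_mul_assoc psd_symmetric orthogonal_matrix_inverse[OF Q(1)])
  let ?M = "std_gaussian :: (real^'n) measure"
  note si = sq_integrable_std_gaussian_affine[of a R] sq_integrable_std_gaussian_affine[of b S]
  have mean: "(\<integral>z. m + L *v z \<partial>?M) = m" for m and L :: "real^'n^'n"
  proof -
    have "(\<lambda>z. m + L *v z) \<in> borel_measurable ?M" by measurable
    from mean_distr[OF this] show ?thesis
      by (simp add: std_gaussian_affine_eq_gaussian mean_gaussian)
  qed
  have cm: "cross_moment ?M (\<lambda>z. L *v z) (\<lambda>z. N *v z) = L ** transpose N" for L N :: "real^'n^'n"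
    by (simp add: cross_moment_matrix[OF sq_integrable_std_gaussian sq_integrable_std_gaussian]
        cross_moment_std_gaussian)
  have "(W2 (gaussian a A) (gaussian b B))\<^sup>2
      = (W2 (distr ?M borel (\<lambda>z. a + R *v z)) (distr ?M borel (\<lambda>z. b + S *v z)))\<^sup>2"
    by (simp add: std_gaussian_affine_eq_gaussian R S)
  also have "\<dots> \<le> (\<integral>z. (norm ((a + R *v z) - (b + S *v z)))\<^sup>2 \<partial>?M)"
    by (rule W2_sq_le_expectation[OF prob_space_std_gaussian si])
  also have "\<dots> = (norm (a - b))\<^sup>2 + trace (R ** transpose R) + trace (S ** transpose S)
      - 2 * (\<integral>z. (R *v z) \<bullet> (S *v z) \<partial>?M)"
    using expectation_dist_sq[OF prob_space_std_gaussian si mean mean] by (simp add: cm)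
  also have "(\<integral>z. (R *v z) \<bullet> (S *v z) \<partial>?M) = trace (R ** transpose S)"
    by (simp add: trace_cross_moment[symmetric] sq_integrable_matrix sq_integrable_std_gaussian cm)
  also have "\<dots> = trace (S ** R)"
    using trace_transpose[of "R ** transpose S"] by (simp add: matrix_transpose_mul R)
  also have "\<dots> = fidelity A B"
    using Q(2) trace_mul_sym[of S R] by (simp add: R_def S_def matrix_mul_assoc)
  finally show "(W2 (gaussian a A) (gaussian b B))\<^sup>2 \<le> (norm (a - b))\<^sup>2 + trace A + trace B - 2 * fidelity A B"
    by (simp add: R S)
qed

subsection \<open>Conditional expectations as maps\<close>

text \<open>\<open>D\<close> is the density, with respect to the law of \<open>X\<close>, of the
  image under \<open>X\<close> of the measure with density \<open>Y\<close>. Working on the target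
  space yields the conditional expectation directly as a function of \<open>X\<close>.\<close>

lemma nonneg_conditional_density:
  fixes Y :: "'a \<Rightarrow> real"
  assumes M: "finite_measure M" and X[measurable]: "X \<in> measurable M N"
    and Y: "integrable M Y" "\<And>z. 0 \<le> Y z"
  shows "\<exists>D\<in>borel_measurable N. \<forall>g\<in>borel_measurable N. integrable M (\<lambda>z. g (X z) * Y z) \<longrightarrow>
      integrable M (\<lambda>z. g (X z) * D (X z)) \<and> (\<integral>z. g (X z) * D (X z) \<partial>M) = (\<integral>z. g (X z) * Y z \<partial>M)"
proof -
  have [measurable]: "Y \<in> borel_measurable M" using Y by simp
  define \<mu> where "\<mu> = distr M N X"
  define \<kappa> where "\<kappa> = distr (density M (\<lambda>z. ennreal (Y z))) N X"
  interpret M: finite_measure M by fact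
  interpret \<mu>: finite_measure \<mu> unfolding \<mu>_def by (rule M.finite_measure_distr[OF X])
  have "finite_measure (density M (\<lambda>z. ennreal (Y z)))"
    using Y by (intro finite_measureI) (simp add: emeasure_density nn_integral_eq_integral)
  then have fin: "finite_measure \<kappa>"
    unfolding \<kappa>_def by (rule finite_measure.finite_measure_distr) simp
  have sets: "sets \<kappa> = sets \<mu>" by (simp add: \<kappa>_def \<mu>_def)
  have ac: "absolutely_continuous \<mu> \<kappa>"
    unfolding absolutely_continuous_def
  proof
    fix A assume "A \<in> null_sets \<mu>"
    then have A: "A \<in> sets N" "emeasure M (X -` A \<inter> space M) = 0"
      by (auto simp: null_sets_def \<mu>_def emeasure_distr)
    then have "X -` A \<inter> space M \<in> null_sets M" by (auto simp: null_sets_def)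
    then have "X -` A \<inter> space M \<in> null_sets (density M (\<lambda>z. ennreal (Y z)))"
      by (subst null_sets_density_iff) (auto dest: AE_not_in)
    then show "A \<in> null_sets \<kappa>" using A(1) by (auto simp: null_sets_def \<kappa>_def emeasure_distr)
  qed
  obtain D :: "'b \<Rightarrow> real" where D: "D \<in> borel_measurable \<mu>" "AE x in \<mu>. RN_deriv \<mu> \<kappa> x = ennreal (D x)"
    "\<And>x. 0 \<le> D x"
    using \<mu>.real_RN_deriv[OF fin ac sets] by metis
  have D'[measurable]: "D \<in> borel_measurable N" using D(1) by (simp add: \<mu>_def)
  have dens: "density \<mu> (\<lambda>x. ennreal (D x)) = \<kappa>"
    using \<mu>.density_RN_deriv[OF ac sets] density_cong[OF _ _ D(2)] D(1) by simp
  show ?thesis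
  proof (intro bexI[OF _ D'] ballI impI)
    fix g assume g[measurable]: "g \<in> borel_measurable N" and i: "integrable M (\<lambda>z. g (X z) * Y z)"
    have "integrable (density M (\<lambda>z. ennreal (Y z))) (\<lambda>z. g (X z))"
      using i Y(2) by (subst integrable_density) (auto simp: mult.commute)
    then have "integrable \<kappa> g" unfolding \<kappa>_def by (subst integrable_distr_eq) auto
    then have "integrable \<mu> (\<lambda>x. g x * D x)"
      unfolding dens[symmetric] using D(3) D(1) by (subst (asm) integrable_density) (auto simp: mult.commute \<mu>_def)
    then have 1: "integrable M (\<lambda>z. g (X z) * D (X z))"
      unfolding \<mu>_def by (subst (asm) integrable_distr_eq) auto
    have "(\<integral>z. g (X z) * D (X z) \<partial>M) = (\<integral>x. D x * g x \<partial>\<mu>)"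
      unfolding \<mu>_def by (subst integral_distr) (auto simp: mult.commute)
    also have "\<dots> = (\<integral>x. g x \<partial>\<kappa>)"
      unfolding dens[symmetric] using D(3) D(1) by (subst integral_density) (auto simp: \<mu>_def)
    also have "\<dots> = (\<integral>z. g (X z) \<partial>density M (\<lambda>z. ennreal (Y z)))"
      unfolding \<kappa>_def by (subst integral_distr) auto
    also have "\<dots> = (\<integral>z. g (X z) * Y z \<partial>M)"
      using Y(2) by (subst integral_density) (auto simp: mult.commute)
    finally show "integrable M (\<lambda>z. g (X z) * D (X z)) \<and> (\<integral>z. g (X z) * D (X z) \<partial>M) = (\<integral>z. g (X z) * Y z \<partial>M)"
      using 1 by blast
  qed
qed

text \<open>The positive and negative parts are treated separately. Their products with g(X) are
  dominated by |g(X) Y|, so one integrability hypothesis covers both.\<close>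

lemma conditional_expectation_map:
  fixes Y :: "'a \<Rightarrow> real"
  assumes M: "finite_measure M" and X[measurable]: "X \<in> measurable M N" and Y: "integrable M Y"
  shows "\<exists>t\<in>borel_measurable N. \<forall>g\<in>borel_measurable N. integrable M (\<lambda>z. g (X z) * Y z) \<longrightarrow>
      integrable M (\<lambda>z. g (X z) * t (X z)) \<and> (\<integral>z. g (X z) * t (X z) \<partial>M) = (\<integral>z. g (X z) * Y z \<partial>M)"
proof -
  have [measurable]: "Y \<in> borel_measurable M" using Y by simp
  have Y': "integrable M (\<lambda>z. max 0 (Y z))" "integrable M (\<lambda>z. max 0 (- Y z))"
    using Y by (auto intro!: integrable_max)
  obtain D where D[measurable]: "D \<in> borel_measurable N"
    and D': "\<forall>g\<in>borel_measurable N. integrable M (\<lambda>z. g (X z) * max 0 (Y z)) \<longrightarrow>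
      integrable M (\<lambda>z. g (X z) * D (X z)) \<and> (\<integral>z. g (X z) * D (X z) \<partial>M) = (\<integral>z. g (X z) * max 0 (Y z) \<partial>M)"
    using nonneg_conditional_density[OF M X Y'(1) max.cobounded1] by (rule bexE)
  obtain E where E[measurable]: "E \<in> borel_measurable N"
    and E': "\<forall>g\<in>borel_measurable N. integrable M (\<lambda>z. g (X z) * max 0 (- Y z)) \<longrightarrow>
      integrable M (\<lambda>z. g (X z) * E (X z)) \<and> (\<integral>z. g (X z) * E (X z) \<partial>M) = (\<integral>z. g (X z) * max 0 (- Y z) \<partial>M)"
    using nonneg_conditional_density[OF M X Y'(2) max.cobounded1] by (rule bexE)
  show ?thesis
  proof (intro bexI[of _ "\<lambda>x. D x - E x"] ballI impI)
    fix g assume g[measurable]: "g \<in> borel_measurable N" and i: "integrable M (\<lambda>z. g (X z) * Y z)"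
    have i1: "integrable M (\<lambda>z. g (X z) * max 0 (Y z))"
      by (rule Bochner_Integration.integrable_bound[OF i]) (auto simp: abs_mult intro!: mult_left_mono)
    have i2: "integrable M (\<lambda>z. g (X z) * max 0 (- Y z))"
      by (rule Bochner_Integration.integrable_bound[OF i]) (auto simp: abs_mult intro!: mult_left_mono)
    have eq: "g (X z) * Y z = g (X z) * max 0 (Y z) - g (X z) * max 0 (- Y z)" for z
      by (simp add: max_def)
    show "integrable M (\<lambda>z. g (X z) * (D (X z) - E (X z))) \<and>
      (\<integral>z. g (X z) * (D (X z) - E (X z)) \<partial>M) = (\<integral>z. g (X z) * Y z \<partial>M)"
      unfolding eq right_diff_distrib using bspec[OF D' g] bspec[OF E' g] i1 i2 by simp
  qed simp
qed

definition is_conditional_mean :: "'a measure \<Rightarrow> ('a \<Rightarrow> real^'n) \<Rightarrow> ('a \<Rightarrow> real^'n) \<Rightarrow> (real^'n \<Rightarrow> real^'n) \<Rightarrow> bool" where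
  "is_conditional_mean M X Y T \<longleftrightarrow> T \<in> borel_measurable borel \<and>
    (\<forall>i. \<forall>g\<in>borel_measurable borel. integrable M (\<lambda>z. g (X z) * Y z $ i) \<longrightarrow>
      integrable M (\<lambda>z. g (X z) * T (X z) $ i) \<and>
      (\<integral>z. g (X z) * T (X z) $ i \<partial>M) = (\<integral>z. g (X z) * Y z $ i \<partial>M))"

lemma integrable_vec_component: "integrable M Y \<Longrightarrow> integrable M (\<lambda>z. (Y z :: real^'n) $ i)"
  by (rule integrable_bounded_linear[OF bounded_linear_vec_nth])

lemma conditional_mean_exists:
  fixes X Y :: "'a \<Rightarrow> real^'n"
  assumes M: "finite_measure M" and X: "X \<in> borel_measurable M" and Y: "integrable M Y"
  obtains T where "is_conditional_mean M X Y T"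
proof -
  have "\<forall>i. \<exists>t. t \<in> borel_measurable borel \<and> (\<forall>g\<in>borel_measurable borel. integrable M (\<lambda>z. g (X z) * Y z $ i) \<longrightarrow>
      integrable M (\<lambda>z. g (X z) * t (X z)) \<and> (\<integral>z. g (X z) * t (X z) \<partial>M) = (\<integral>z. g (X z) * Y z $ i \<partial>M))"
    using conditional_expectation_map[OF M X integrable_vec_component[OF Y]] by blast
  from choice[OF this] obtain t where t: "\<And>i. t i \<in> borel_measurable borel"
    "\<And>i g. g \<in> borel_measurable borel \<Longrightarrow> integrable M (\<lambda>z. g (X z) * Y z $ i) \<Longrightarrow>
      integrable M (\<lambda>z. g (X z) * t i (X z)) \<and> (\<integral>z. g (X z) * t i (X z) \<partial>M) = (\<integral>z. g (X z) * Y z $ i \<partial>M)"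
    by blast
  have "(\<lambda>x. \<chi> i. t i x) \<in> borel_measurable borel"
    using t(1) by (intro borel_measurable_euclidean_space[THEN iffD2]) (auto simp: Basis_vec_def inner_axis)
  then show thesis
    using t(2) by (intro that[of "\<lambda>x. \<chi> i. t i x"]) (auto simp: is_conditional_mean_def)
qed

context
  fixes M :: "'a measure" and X Y :: "'a \<Rightarrow> real^'n" and T
  assumes M: "prob_space M" and X: "X \<in> borel_measurable M" and Y: "sq_integrable M Y"
    and T: "is_conditional_mean M X Y T"
begin

interpretation prob_space M by (rule M)

lemma conditional_mean_measurable: "T \<in> borel_measurable borel" "(\<lambda>z. T (X z)) \<in> borel_measurable M"
proof -
  show T': "T \<in> borel_measurable borel" using T by (simp add: is_conditional_mean_def)
  show "(\<lambda>z. T (X z)) \<in> borel_measurable M" by (rule measurable_compose[OF X T'])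
qed

private lemma integrable_Y: "integrable M Y"
  by (rule sq_integrable_integrable[OF finite_measure_axioms Y])

text \<open>Jensen's inequality localised to the events that \<open>X\<close> lies in
  \<open>A\<close>. The localisation makes the property stable under maxima, so it passes from
  affine functions to finite maxima of them.\<close>

private definition jensen :: "(real^'n \<Rightarrow> real) \<Rightarrow> bool" where
  "jensen h \<longleftrightarrow> h \<in> borel_measurable borel \<and> integrable M (\<lambda>z. h (Y z)) \<and> integrable M (\<lambda>z. h (T (X z))) \<and>
    (\<forall>A\<in>sets borel. (\<integral>z. indicator A (X z) * h (T (X z)) \<partial>M) \<le> (\<integral>z. indicator A (X z) * h (Y z) \<partial>M))"

private lemma integrable_indicator_mult:
  fixes f :: "'a \<Rightarrow> real"
  assumes "A \<in> sets borel" "integrable M f" shows "integrable M (\<lambda>z. indicator A (X z) * f z)"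
proof (rule Bochner_Integration.integrable_bound[OF assms(2)])
  have [measurable]: "X \<in> borel_measurable M" "A \<in> sets borel" "f \<in> borel_measurable M" using X assms by auto
  show "(\<lambda>z. indicator A (X z) * f z) \<in> borel_measurable M" by measurable
qed (auto simp: indicator_def)

private lemma component:
  assumes "A \<in> sets borel"
  shows "integrable M (\<lambda>z. indicator A (X z) * T (X z) $ i)"
    "(\<integral>z. indicator A (X z) * T (X z) $ i \<partial>M) = (\<integral>z. indicator A (X z) * Y z $ i \<partial>M)"
proof -
  have "(indicator A :: real^'n \<Rightarrow> real) \<in> borel_measurable borel" using assms by measurable
  then show "integrable M (\<lambda>z. indicator A (X z) * T (X z) $ i)"
    "(\<integral>z. indicator A (X z) * T (X z) $ i \<partial>M) = (\<integral>z. indicator A (X z) * Y z $ i \<partial>M)"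
    using T integrable_indicator_mult[OF assms integrable_vec_component[OF integrable_Y]]
    by (auto simp: is_conditional_mean_def)
qed

private lemma jensen_affine: "jensen (\<lambda>y. a + b \<bullet> y)"
proof -
  have TX: "integrable M (\<lambda>z. T (X z) $ i)" for i using component(1)[of UNIV i] by simp
  have bT: "integrable M (\<lambda>z. b \<bullet> T (X z))" using TX by (simp add: inner_vec_def)
  have "(\<integral>z. indicator A (X z) * (a + b \<bullet> T (X z)) \<partial>M) = (\<integral>z. indicator A (X z) * (a + b \<bullet> Y z) \<partial>M)"
    if A: "A \<in> sets borel" for A
  proof -
    note iY = integrable_indicator_mult[OF A integrable_vec_component[OF integrable_Y]]
    have e: "indicator A x * (a + b \<bullet> y) = indicator A x * a + (\<Sum>i\<in>UNIV. b $ i * (indicator A x * y $ i))" for x y :: "real^'n"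
      by (simp add: inner_vec_def sum_distrib_left algebra_simps)
    have "integrable M (\<lambda>z. indicator A (X z) * a)" by (rule integrable_indicator_mult[OF A]) simp
    then show ?thesis unfolding e using component[OF A] iY by (simp add: Bochner_Integration.integral_sum)
  qed
  then show ?thesis
    using integrable_Y bT by (auto simp: jensen_def)
qed

private lemma jensen_max:
  assumes h: "jensen h1" "jensen h2" shows "jensen (\<lambda>y. max (h1 y) (h2 y))"
  unfolding jensen_def
proof (intro conjI ballI)
  have [measurable]: "h1 \<in> borel_measurable borel" "h2 \<in> borel_measurable borel" "T \<in> borel_measurable borel"
    using h conditional_mean_measurable by (auto simp: jensen_def)
  show "(\<lambda>y. max (h1 y) (h2 y)) \<in> borel_measurable borel" by measurable
  have i: "integrable M (\<lambda>z. h1 (Y z))" "integrable M (\<lambda>z. h2 (Y z))"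
    "integrable M (\<lambda>z. h1 (T (X z)))" "integrable M (\<lambda>z. h2 (T (X z)))"
    using h by (auto simp: jensen_def)
  then show iY: "integrable M (\<lambda>z. max (h1 (Y z)) (h2 (Y z)))"
    and "integrable M (\<lambda>z. max (h1 (T (X z))) (h2 (T (X z))))" by auto
  fix A :: "(real^'n) set" assume A[measurable]: "A \<in> sets borel"
  \<comment> \<open>\<open>D\<close> selects the larger branch at \<open>T x\<close>. Being a set of
    values of \<open>X\<close>, it allows the localised inequalities on \<open>A \<inter> D\<close>
    and \<open>A - D\<close>.\<close>
  define D where "D = {x. h2 (T x) \<le> h1 (T x)}"
  have D[measurable]: "D \<in> sets borel" unfolding D_def by measurable
  have AD: "A \<inter> D \<in> sets borel" "A - D \<in> sets borel" by measurable
  have "(\<integral>z. indicator A (X z) * max (h1 (T (X z))) (h2 (T (X z))) \<partial>M)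
      = (\<integral>z. indicator (A \<inter> D) (X z) * h1 (T (X z)) + indicator (A - D) (X z) * h2 (T (X z)) \<partial>M)"
    by (intro Bochner_Integration.integral_cong) (auto simp: indicator_def D_def max_def)
  also have "\<dots> = (\<integral>z. indicator (A \<inter> D) (X z) * h1 (T (X z)) \<partial>M) + (\<integral>z. indicator (A - D) (X z) * h2 (T (X z)) \<partial>M)"
    using integrable_indicator_mult[OF AD(1) i(3)] integrable_indicator_mult[OF AD(2) i(4)] by simp
  also have "\<dots> \<le> (\<integral>z. indicator (A \<inter> D) (X z) * h1 (Y z) \<partial>M) + (\<integral>z. indicator (A - D) (X z) * h2 (Y z) \<partial>M)"
    using h AD by (intro add_mono) (auto simp: jensen_def)
  also have "\<dots> = (\<integral>z. indicator (A \<inter> D) (X z) * h1 (Y z) + indicator (A - D) (X z) * h2 (Y z) \<partial>M)"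
    using integrable_indicator_mult[OF AD(1) i(1)] integrable_indicator_mult[OF AD(2) i(2)] by simp
  also have "\<dots> \<le> (\<integral>z. indicator A (X z) * max (h1 (Y z)) (h2 (Y z)) \<partial>M)"
    using integrable_indicator_mult[OF AD(1) i(1)] integrable_indicator_mult[OF AD(2) i(2)]
      integrable_indicator_mult[OF A iY]
    by (intro integral_mono) (auto simp: indicator_def)
  finally show "(\<integral>z. indicator A (X z) * max (h1 (T (X z))) (h2 (T (X z))) \<partial>M)
    \<le> (\<integral>z. indicator A (X z) * max (h1 (Y z)) (h2 (Y z)) \<partial>M)" .
qed

text \<open>A nonnegative convex function is the increasing limit of finite maxima of affine
  minorants, and monotone convergence carries the inequality over even if the right side is
  infinite.\<close>

lemma conditional_mean_jensen:
  assumes h: "convex_on UNIV h" and h0: "\<And>y. 0 \<le> h y"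
  shows "(\<integral>\<^sup>+z. ennreal (h (T (X z))) \<partial>M) \<le> (\<integral>\<^sup>+z. ennreal (h (Y z)) \<partial>M)"
proof -
  obtain a :: "nat \<Rightarrow> real" and b where ab: "\<And>k y. a k + b k \<bullet> y \<le> h y"
    "\<And>y e. 0 < e \<Longrightarrow> \<exists>k. h y - e < a k + b k \<bullet> y"
    using convex_on_countable_affine_sup[OF h] by metis
  \<comment> \<open>Starting the maxima at 0 keeps every approximation nonnegative, hence faithful
    under \<open>ennreal\<close>.\<close>
  define m where "m = rec_nat (\<lambda>y. 0) (\<lambda>k f y. max (f y) (a k + b k \<bullet> y))"
  have m0: "m 0 y = 0" and mS: "m (Suc k) y = max (m k y) (a k + b k \<bullet> y)" for k y
    by (simp_all add: m_def)
  have mS': "m (Suc k) = (\<lambda>y. max (m k y) (a k + b k \<bullet> y))" for k by (simp add: mS fun_eq_iff)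
  have J: "jensen (m k)" for k
  proof (induction k)
    case 0
    have "m 0 = (\<lambda>y. 0 + 0 \<bullet> y)" by (simp add: m0 fun_eq_iff)
    then show ?case using jensen_affine[of 0 0] by simp
  next
    case (Suc k)
    then show ?case unfolding mS' by (intro jensen_max jensen_affine)
  qed
  have m_nn: "0 \<le> m k y" and m_le: "m k y \<le> h y" for k y
    by (induction k) (auto simp: m0 mS h0 ab)
  have inc: "incseq (\<lambda>k. m k y)" for y by (intro incseq_SucI) (simp add: mS)
  have sup: "ennreal (h y) = (SUP k. ennreal (m k y))" for y
  proof (rule antisym)
    show "(SUP k. ennreal (m k y)) \<le> ennreal (h y)" by (intro SUP_least ennreal_leI m_le)
    show "ennreal (h y) \<le> (SUP k. ennreal (m k y))"
    proof (rule ennreal_le_epsilon)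
      fix e :: real assume "0 < e"
      from ab(2)[OF this] obtain k where "h y - e < a k + b k \<bullet> y" by blast
      then have "h y \<le> m (Suc k) y + e" by (simp add: mS)
      then have "ennreal (h y) \<le> ennreal (m (Suc k) y) + ennreal e"
        using m_nn \<open>0 < e\<close> by (metis ennreal_leI ennreal_plus less_imp_le)
      also have "\<dots> \<le> (SUP k. ennreal (m k y)) + ennreal e"
        by (intro add_right_mono SUP_upper) simp
      finally show "ennreal (h y) \<le> (SUP k. ennreal (m k y)) + ennreal e" .
    qed
  qed
  have meas: "(\<lambda>z. ennreal (m k (T (X z)))) \<in> borel_measurable M" for k
    using J[of k] conditional_mean_measurable(2) by (auto simp: jensen_def)
  have "(\<integral>\<^sup>+z. ennreal (h (T (X z))) \<partial>M) = (SUP k. \<integral>\<^sup>+z. ennreal (m k (T (X z))) \<partial>M)"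
    unfolding sup using meas inc
    by (intro nn_integral_monotone_convergence_SUP) (auto simp: incseq_def le_fun_def intro!: ennreal_leI)
  also have "\<dots> \<le> (\<integral>\<^sup>+z. ennreal (h (Y z)) \<partial>M)"
  proof (rule SUP_least)
    fix k
    have "(\<integral>z. m k (T (X z)) \<partial>M) \<le> (\<integral>z. m k (Y z) \<partial>M)"
      using J[of k] unfolding jensen_def by (auto dest!: bspec[of _ _ UNIV])
    then have "ennreal (\<integral>z. m k (T (X z)) \<partial>M) \<le> ennreal (\<integral>z. m k (Y z) \<partial>M)" by (rule ennreal_leI)
    then have "(\<integral>\<^sup>+z. ennreal (m k (T (X z))) \<partial>M) \<le> (\<integral>\<^sup>+z. ennreal (m k (Y z)) \<partial>M)"
      using J[of k] m_nn by (simp add: nn_integral_eq_integral jensen_def)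
    also have "\<dots> \<le> (\<integral>\<^sup>+z. ennreal (h (Y z)) \<partial>M)" by (intro nn_integral_mono ennreal_leI m_le)
    finally show "(\<integral>\<^sup>+z. ennreal (m k (T (X z))) \<partial>M) \<le> (\<integral>\<^sup>+z. ennreal (h (Y z)) \<partial>M)" .
  qed
  finally show ?thesis .
qed

lemma conditional_mean_sq_integrable: "sq_integrable M (\<lambda>z. T (X z))"
proof -
  have [measurable]: "(\<lambda>z. T (X z)) \<in> borel_measurable M" by (rule conditional_mean_measurable)
  have "(\<integral>\<^sup>+z. ennreal ((norm (T (X z)))\<^sup>2) \<partial>M) \<le> (\<integral>\<^sup>+z. ennreal ((norm (Y z))\<^sup>2) \<partial>M)"
    by (rule conditional_mean_jensen[OF convex_on_norm_sq]) simp
  also have "\<dots> < \<infinity>" using Y by (simp add: sq_integrable_def nn_integral_eq_integral)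
  finally show ?thesis by (simp add: sq_integrable_def integrable_iff_bounded)
qed

text \<open>X - T(X) is a function of \<open>X\<close> and therefore orthogonal to the residual Y -
  T(X), coordinate by coordinate.\<close>

lemma conditional_mean_pythagoras:
  assumes X': "sq_integrable M X"
  shows "(\<integral>z. (norm (X z - Y z))\<^sup>2 \<partial>M) = (\<integral>z. (norm (X z - T (X z)))\<^sup>2 \<partial>M) + (\<integral>z. (norm (Y z - T (X z)))\<^sup>2 \<partial>M)"
proof -
  note TX = conditional_mean_sq_integrable
  note U = sq_integrable_diff[OF X' TX] and V = sq_integrable_diff[OF Y TX]
  have [measurable]: "T \<in> borel_measurable borel" by (rule conditional_mean_measurable)
  have "(\<integral>z. (X z - T (X z)) $ i * (Y z - T (X z)) $ i \<partial>M) = 0" for i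
  proof -
    define g where "g x = (x - T x) $ i" for x
    have "(\<lambda>x. x - T x) \<in> borel_measurable borel" by measurable
    moreover have "(\<lambda>y::real^'n. y $ i) \<in> borel_measurable borel"
      by (intro borel_measurable_continuous_onI continuous_intros)
    ultimately have g: "g \<in> borel_measurable borel" unfolding g_def by (rule measurable_compose)
    have i1: "integrable M (\<lambda>z. g (X z) * Y z $ i)" "integrable M (\<lambda>z. g (X z) * T (X z) $ i)"
      using sq_integrable_component_mult[OF U Y, of i i] sq_integrable_component_mult[OF U TX, of i i]
      by (auto simp: g_def)
    have "(\<integral>z. g (X z) * T (X z) $ i \<partial>M) = (\<integral>z. g (X z) * Y z $ i \<partial>M)"
      using T g i1(1) by (auto simp: is_conditional_mean_def)
    then have "(\<integral>z. g (X z) * Y z $ i - g (X z) * T (X z) $ i \<partial>M) = 0" using i1 by simp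
    then show ?thesis by (simp add: g_def right_diff_distrib)
  qed
  then have 0: "(\<integral>z. (X z - T (X z)) \<bullet> (Y z - T (X z)) \<partial>M) = 0"
    using sq_integrable_component_mult[OF U V]
    by (simp add: inner_vec_def Bochner_Integration.integral_sum del: vector_minus_component)
  have "(norm (X z - Y z))\<^sup>2 = (norm (X z - T (X z)))\<^sup>2 + (norm (Y z - T (X z)))\<^sup>2
      - 2 * ((X z - T (X z)) \<bullet> (Y z - T (X z)))" for z
    by (simp add: power2_norm_eq_inner inner_diff_left inner_diff_right inner_commute algebra_simps)
  then show ?thesis
    using U V sq_integrable_inner[OF U V] by (simp add: 0 sq_integrable_def)
qed

end

subsection \<open>Existence and uniqueness of the projection\<close>

lemma cx_le_trans: "\<mu> \<le>\<^sub>c\<^sub>x \<nu> \<Longrightarrow> \<nu> \<le>\<^sub>c\<^sub>x \<rho> \<Longrightarrow> \<mu> \<le>\<^sub>c\<^sub>x \<rho>"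
  unfolding cx_le_def using order_trans by blast

lemma nn_integral_limit_le:
  assumes f: "\<And>i. f i \<in> borel_measurable M" "AE x in M. (\<lambda>i. f i x) \<longlonglongrightarrow> g x"
    and c: "\<And>i. (\<integral>\<^sup>+x. f i x \<partial>M) \<le> c i" "c \<longlonglongrightarrow> (C :: ennreal)"
  shows "(\<integral>\<^sup>+x. g x \<partial>M) \<le> C"
proof -
  have "(\<integral>\<^sup>+x. g x \<partial>M) = (\<integral>\<^sup>+x. liminf (\<lambda>i. f i x) \<partial>M)"
    using f(2) by (intro nn_integral_cong_AE) (auto elim!: eventually_mono simp: lim_imp_Liminf)
  also have "\<dots> \<le> liminf (\<lambda>i. \<integral>\<^sup>+x. f i x \<partial>M)" by (rule nn_integral_liminf[OF f(1)])
  also have "\<dots> \<le> liminf c" using c(1) by (intro Liminf_mono) auto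
  also have "\<dots> = C" using c(2) by (intro lim_imp_Liminf) auto
  finally show ?thesis .
qed

lemma parallelogram_midpoint:
  fixes x a b :: "'a::real_inner"
  shows "(norm (a - b))\<^sup>2 = 2 * (norm (x - a))\<^sup>2 + 2 * (norm (x - b))\<^sup>2 - 4 * (norm (x - (1/2) *\<^sub>R (a + b)))\<^sup>2"
  by (simp add: power2_norm_eq_inner inner_diff_left inner_diff_right inner_add_left inner_add_right
      inner_commute algebra_simps)

context
  fixes \<mu> \<nu> :: "(real^'n) measure"
  assumes \<mu>: "\<mu> \<in> P2" and \<nu>: "\<nu> \<in> P2"
begin

interpretation M: prob_space \<mu> by (rule P2D(1)[OF \<mu>])

definition admissible_maps :: "(real^'n \<Rightarrow> real^'n) set" where
  "admissible_maps = {T. sq_integrable \<mu> T \<and> distr \<mu> borel T \<le>\<^sub>c\<^sub>x \<nu>}"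

definition map_cost :: "(real^'n \<Rightarrow> real^'n) \<Rightarrow> real" where
  "map_cost T = (\<integral>x. (norm (x - T x))\<^sup>2 \<partial>\<mu>)"

lemma admissible_measurable: "T \<in> admissible_maps \<Longrightarrow> T \<in> borel_measurable \<mu>" "T \<in> admissible_maps \<Longrightarrow> T \<in> borel_measurable borel"
  using P2D(2)[OF \<mu>] measurable_cong_sets[of \<mu> borel borel borel] by (auto simp: admissible_maps_def sq_integrable_def)

lemma admissible_diff: "T \<in> admissible_maps \<Longrightarrow> sq_integrable \<mu> (\<lambda>x. x - T x)"
  by (intro sq_integrable_diff P2D(3)[OF \<mu>]) (simp add: admissible_maps_def)

lemma admissible_nn_integral:
  assumes T: "T \<in> admissible_maps" and h: "convex_on UNIV h" "\<And>x. 0 \<le> h x"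
  shows "(\<integral>\<^sup>+x. ennreal (h (T x)) \<partial>\<mu>) \<le> (\<integral>\<^sup>+x. ennreal (h x) \<partial>\<nu>)"
proof -
  note [measurable] = convex_on_borel_measurable[OF h(1)] admissible_measurable(1)[OF T]
  have "(\<integral>\<^sup>+x. ennreal (h (T x)) \<partial>\<mu>) = (\<integral>\<^sup>+x. ennreal (h x) \<partial>distr \<mu> borel T)"
    by (simp add: nn_integral_distr)
  also have "\<dots> \<le> (\<integral>\<^sup>+x. ennreal (h x) \<partial>\<nu>)"
    using T h by (intro cx_leD distr_P2 M.prob_space_axioms \<nu>) (auto simp: admissible_maps_def)
  finally show ?thesis .
qed

lemma admissibleI:
  assumes T: "sq_integrable \<mu> T" and
    le: "\<And>h. convex_on UNIV h \<Longrightarrow> (\<And>x. 0 \<le> h x) \<Longrightarrow> (\<integral>\<^sup>+x. ennreal (h (T x)) \<partial>\<mu>) \<le> (\<integral>\<^sup>+x. ennreal (h x) \<partial>\<nu>)"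
  shows "T \<in> admissible_maps"
proof -
  have "distr \<mu> borel T \<le>\<^sub>c\<^sub>x \<nu>"
    unfolding cx_le_iff_nonneg[OF distr_P2[OF M.prob_space_axioms T] \<nu>]
  proof (intro allI impI)
    fix h :: "real^'n \<Rightarrow> real" assume h: "convex_on UNIV h" "\<forall>x. 0 \<le> h x"
    have [measurable]: "T \<in> borel_measurable \<mu>" "h \<in> borel_measurable borel"
      using T h(1) by (auto simp: sq_integrable_def convex_on_borel_measurable)
    have "(\<integral>\<^sup>+x. ennreal (h x) \<partial>distr \<mu> borel T) = (\<integral>\<^sup>+x. ennreal (h (T x)) \<partial>\<mu>)"
      by (simp add: nn_integral_distr)
    then show "(\<integral>\<^sup>+x. ennreal (h x) \<partial>distr \<mu> borel T) \<le> (\<integral>\<^sup>+x. ennreal (h x) \<partial>\<nu>)"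
      using le h by simp
  qed
  with T show ?thesis by (simp add: admissible_maps_def)
qed

text \<open>The residual is kept as an exact term: it measures how far the coupling is from the
  graph of \<open>T\<close>, which uniqueness needs. Admissibility is conditional Jensen followed by
  transitivity of the convex order.\<close>

lemma coupling_to_map:
  assumes \<eta>: "\<eta> \<in> P2" "\<eta> \<le>\<^sub>c\<^sub>x \<nu>" and \<pi>: "\<pi> \<in> couplings \<mu> \<eta>"
  obtains T where "T \<in> admissible_maps" "sq_integrable \<pi> (\<lambda>z. T (fst z))"
    "transport_cost \<pi> = map_cost T + (\<integral>z. (norm (snd z - T (fst z)))\<^sup>2 \<partial>\<pi>)"
proof -
  note c = couplingsD[OF \<pi>] and s = couplings_sq_integrable[OF \<pi> \<mu> \<eta>(1)]
  interpret P: prob_space \<pi> by (rule c(1))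
  obtain T where T: "is_conditional_mean \<pi> fst snd T"
    using conditional_mean_exists[OF P.finite_measure_axioms c(3) sq_integrable_integrable[OF P.finite_measure_axioms s(2)]] .
  note TX = conditional_mean_sq_integrable[OF c(1,3) s(2) T]
  note Tm = conditional_mean_measurable[OF c(1,3) s(2) T]
  have d: "distr \<mu> borel T = distr \<pi> borel (\<lambda>z. T (fst z))"
    unfolding c(5)[symmetric] using c(3) Tm(1) by (simp add: distr_distr comp_def)
  have si: "sq_integrable \<mu> T"
    unfolding c(5)[symmetric] using TX c(3) Tm(1) by (auto simp: sq_integrable_def integrable_distr_eq)
  have "distr \<mu> borel T \<le>\<^sub>c\<^sub>x \<eta>"
    unfolding cx_le_iff_nonneg[OF distr_P2[OF M.prob_space_axioms si] \<eta>(1)]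
  proof (intro allI impI)
    fix h :: "real^'n \<Rightarrow> real" assume h: "convex_on UNIV h" "\<forall>x. 0 \<le> h x"
    note [measurable] = convex_on_borel_measurable[OF h(1)] Tm(2) c(4)
    have "(\<integral>\<^sup>+x. ennreal (h x) \<partial>distr \<mu> borel T) = (\<integral>\<^sup>+z. ennreal (h (T (fst z))) \<partial>\<pi>)"
      unfolding d by (simp add: nn_integral_distr)
    also have "\<dots> \<le> (\<integral>\<^sup>+z. ennreal (h (snd z)) \<partial>\<pi>)"
      using h by (intro conditional_mean_jensen[OF c(1,3) s(2) T]) auto
    also have "\<dots> = (\<integral>\<^sup>+x. ennreal (h x) \<partial>\<eta>)"
      unfolding c(6)[symmetric] by (simp add: nn_integral_distr)
    finally show "(\<integral>\<^sup>+x. ennreal (h x) \<partial>distr \<mu> borel T) \<le> (\<integral>\<^sup>+x. ennreal (h x) \<partial>\<eta>)" .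
  qed
  with si cx_le_trans[OF _ \<eta>(2)] have adm: "T \<in> admissible_maps" by (auto simp: admissible_maps_def)
  have "map_cost T = (\<integral>z. (norm (fst z - T (fst z)))\<^sup>2 \<partial>\<pi>)"
  proof -
    have "map_cost T = (\<integral>x. (norm (x - T x))\<^sup>2 \<partial>distr \<pi> borel fst)" by (simp add: map_cost_def c(5))
    also have "\<dots> = (\<integral>z. (norm (fst z - T (fst z)))\<^sup>2 \<partial>\<pi>)"
      using c(3) Tm(1) by (subst integral_distr) auto
    finally show ?thesis .
  qed
  then show thesis
    using that[OF adm TX] conditional_mean_pythagoras[OF c(1,3) s(2) T s(1)] by (simp add: transport_cost_def)
qed

text \<open>Midpoints are all the convexity that the parallelogram identity requires.\<close>

lemma admissible_midpoint:
  assumes S: "S \<in> admissible_maps" and T: "T \<in> admissible_maps"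
  shows "(\<lambda>x. (1/2) *\<^sub>R (S x + T x)) \<in> admissible_maps"
proof (rule admissibleI)
  show "sq_integrable \<mu> (\<lambda>x. (1/2) *\<^sub>R (S x + T x))"
    using S T by (intro sq_integrable_scaleR sq_integrable_add) (auto simp: admissible_maps_def)
  fix h :: "real^'n \<Rightarrow> real" assume h: "convex_on UNIV h" "\<And>x. 0 \<le> h x"
  note [measurable] = convex_on_borel_measurable[OF h(1)] admissible_measurable(1)[OF S] admissible_measurable(1)[OF T]
  have "(\<integral>\<^sup>+x. ennreal (h ((1/2) *\<^sub>R (S x + T x))) \<partial>\<mu>)
      \<le> (\<integral>\<^sup>+x. ennreal (1/2) * ennreal (h (S x)) + ennreal (1/2) * ennreal (h (T x)) \<partial>\<mu>)"
  proof (rule nn_integral_mono)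
    fix x
    have "h ((1/2) *\<^sub>R (S x + T x)) \<le> (1/2) * h (S x) + (1/2) * h (T x)"
      using convex_onD[OF h(1), of "1/2" "S x" "T x"] by (simp add: scaleR_add_right)
    then have "ennreal (h ((1/2) *\<^sub>R (S x + T x))) \<le> ennreal ((1/2) * h (S x) + (1/2) * h (T x))"
      by (rule ennreal_leI)
    also have "\<dots> = ennreal (1/2) * ennreal (h (S x)) + ennreal (1/2) * ennreal (h (T x))"
      using h(2) by (simp only: ennreal_mult[symmetric] ennreal_plus[symmetric] mult_nonneg_nonneg zero_le_divide_1_iff zero_le_numeral)
    finally show "ennreal (h ((1/2) *\<^sub>R (S x + T x))) \<le> ennreal (1/2) * ennreal (h (S x)) + ennreal (1/2) * ennreal (h (T x))" .
  qed
  also have "\<dots> = ennreal (1/2) * (\<integral>\<^sup>+x. ennreal (h (S x)) \<partial>\<mu>) + ennreal (1/2) * (\<integral>\<^sup>+x. ennreal (h (T x)) \<partial>\<mu>)"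
    by (simp add: nn_integral_add nn_integral_cmult)
  also have "\<dots> \<le> ennreal (1/2) * (\<integral>\<^sup>+x. ennreal (h x) \<partial>\<nu>) + ennreal (1/2) * (\<integral>\<^sup>+x. ennreal (h x) \<partial>\<nu>)"
    using admissible_nn_integral[OF S h] admissible_nn_integral[OF T h] by (intro add_mono mult_left_mono) auto
  also have "\<dots> = (ennreal (1/2) + ennreal (1/2)) * (\<integral>\<^sup>+x. ennreal (h x) \<partial>\<nu>)" by (simp only: distrib_right)
  also have "ennreal (1/2) + ennreal (1/2) = 1" by (subst ennreal_plus[symmetric]) simp_all
  finally show "(\<integral>\<^sup>+x. ennreal (h ((1/2) *\<^sub>R (S x + T x))) \<partial>\<mu>) \<le> (\<integral>\<^sup>+x. ennreal (h x) \<partial>\<nu>)" by simp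
qed

lemma map_cost_nonneg: "0 \<le> map_cost T"
  by (simp add: map_cost_def integral_nonneg_AE)

text \<open>The lower bound \<open>d\<close> applies to the midpoint, so two maps with cost near
  \<open>d\<close> are near each other. It will be the infimum in the existence proof and the
  optimal cost in the uniqueness proof.\<close>

lemma admissible_dist_le:
  assumes S: "S \<in> admissible_maps" and T: "T \<in> admissible_maps"
    and d: "\<And>R. R \<in> admissible_maps \<Longrightarrow> d \<le> map_cost R"
  shows "(\<integral>x. (norm (S x - T x))\<^sup>2 \<partial>\<mu>) \<le> 2 * map_cost S + 2 * map_cost T - 4 * d"
proof -
  note mid = admissible_midpoint[OF S T]
  have "(\<integral>x. (norm (S x - T x))\<^sup>2 \<partial>\<mu>) = (\<integral>x. 2 * (norm (x - S x))\<^sup>2 + 2 * (norm (x - T x))\<^sup>2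
      - 4 * (norm (x - (1/2) *\<^sub>R (S x + T x)))\<^sup>2 \<partial>\<mu>)"
    by (intro Bochner_Integration.integral_cong refl parallelogram_midpoint)
  also have "\<dots> = 2 * map_cost S + 2 * map_cost T - 4 * map_cost (\<lambda>x. (1/2) *\<^sub>R (S x + T x))"
    using admissible_diff[OF S] admissible_diff[OF T] admissible_diff[OF mid]
    by (simp add: map_cost_def sq_integrable_def)
  also have "\<dots> \<le> 2 * map_cost S + 2 * map_cost T - 4 * d" using d[OF mid] by simp
  finally show ?thesis .
qed

text \<open>A minimising sequence is Cauchy by the parallelogram identity, and both constraints pass to
  the limit by Fatou's lemma.\<close>

lemma optimal_map_exists:
  obtains T where "T \<in> admissible_maps" "\<And>R. R \<in> admissible_maps \<Longrightarrow> map_cost T \<le> map_cost R"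
proof -
  obtain \<pi> where "\<pi> \<in> couplings \<mu> \<nu>" using couplings_nonempty[OF \<mu> \<nu>] by blast
  then have ne: "admissible_maps \<noteq> {}" using coupling_to_map[OF \<nu> cx_le_refl] by blast
  define d where "d = (INF T\<in>admissible_maps. map_cost T)"
  have bdd: "bdd_below (map_cost ` admissible_maps)" using map_cost_nonneg by (auto intro!: bdd_belowI)
  have d: "d \<le> map_cost R" if "R \<in> admissible_maps" for R
    unfolding d_def using bdd that by (rule cINF_lower)
  have "\<forall>k. \<exists>T. T \<in> admissible_maps \<and> map_cost T < d + 1 / real (Suc k)"
  proof
    fix k
    have "d < d + 1 / real (Suc k)" by simp
    then show "\<exists>T. T \<in> admissible_maps \<and> map_cost T < d + 1 / real (Suc k)"
      using cINF_less_iff[OF ne bdd, of "d + 1 / real (Suc k)"] unfolding d_def by blast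
  qed
  from choice[OF this] obtain S where S: "\<And>k. S k \<in> admissible_maps" "\<And>k. map_cost (S k) < d + 1 / real (Suc k)"
    by blast
  have si: "sq_integrable \<mu> (S k)" for k using S(1) by (simp add: admissible_maps_def)
  have int: "integrable \<mu> (S k)" for k by (rule sq_integrable_integrable[OF M.finite_measure_axioms si])
  \<comment> \<open>The mean square bound is weakened to a Cauchy property in mean, which yields a
    subsequence converging almost everywhere.\<close>
  have "\<exists>N. \<forall>i\<ge>N. \<forall>j\<ge>N. (\<integral>x. norm (S i x - S j x) \<partial>\<mu>) < e" if e: "0 < e" for e :: real
  proof -
    \<comment> \<open>Both costs lie within 1 / (N + 1) of the infimum, so the squared distance is
      below 4 / (N + 1) < e^2.\<close>
    obtain N where N: "1 / real (Suc N) < e\<^sup>2 / 4" using e by (metis nat_approx_posE divide_pos_pos zero_less_numeral zero_less_power)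
    have "(\<integral>x. norm (S i x - S j x) \<partial>\<mu>) < e" if "N \<le> i" "N \<le> j" for i j
    proof -
      have "1 / real (Suc i) \<le> 1 / real (Suc N)" "1 / real (Suc j) \<le> 1 / real (Suc N)"
        using that by (auto intro!: divide_left_mono)
      then have "(\<integral>x. (norm (S i x - S j x))\<^sup>2 \<partial>\<mu>) < e\<^sup>2"
        using admissible_dist_le[OF S(1)[of i] S(1)[of j] d] S(2)[of i] S(2)[of j] N by linarith
      then have "(\<integral>x. norm (S i x - S j x) \<partial>\<mu>)\<^sup>2 < e\<^sup>2"
        using M.norm_expectation_sq_le[OF sq_integrable_diff[OF si[of i] si[of j]]] by linarith
      then show ?thesis using e by (intro power2_less_imp_less[of _ e]) auto
    qed
    then show ?thesis by blast
  qed
  from cauchy_L1_AE_cauchy_subseq[OF int this]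
  obtain r where r: "strict_mono r" "AE x in \<mu>. Cauchy (\<lambda>i. S (r i) x)" by blast
  \<comment> \<open>Using \<open>lim\<close> at every point keeps \<open>T\<close> measurable; its
    value is arbitrary on the null set without convergence.\<close>
  define T where "T x = lim (\<lambda>i. S (r i) x)" for x
  have Sm[measurable]: "S k \<in> borel_measurable \<mu>" for k using si by (simp add: sq_integrable_def)
  have Tm[measurable]: "T \<in> borel_measurable \<mu>" unfolding T_def by measurable
  have lim: "AE x in \<mu>. (\<lambda>i. S (r i) x) \<longlonglongrightarrow> T x"
    using r(2) by (auto elim!: eventually_mono simp: T_def Cauchy_convergent_iff convergent_LIMSEQ_iff)
  have [measurable]: "(\<lambda>x. x) \<in> borel_measurable \<mu>" using P2D(3)[OF \<mu>] by (simp add: sq_integrable_def)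
  have Sc: "(\<lambda>i. d + 1 / real (Suc (r i))) \<longlonglongrightarrow> d"
  proof -
    have "(\<lambda>i. 1 / real (Suc (r i))) \<longlonglongrightarrow> 0"
      using LIMSEQ_subseq_LIMSEQ[OF LIMSEQ_Suc[OF lim_1_over_n] r(1)] by (simp add: comp_def)
    from tendsto_add[OF tendsto_const this, of d] show ?thesis by simp
  qed
  have nn: "(\<integral>\<^sup>+x. ennreal ((norm (x - T x))\<^sup>2) \<partial>\<mu>) \<le> ennreal d"
  proof (rule nn_integral_limit_le[where f = "\<lambda>i x. ennreal ((norm (x - S (r i) x))\<^sup>2)" and c = "\<lambda>i. ennreal (d + 1 / real (Suc (r i)))"])
    show "AE x in \<mu>. (\<lambda>i. ennreal ((norm (x - S (r i) x))\<^sup>2)) \<longlonglongrightarrow> ennreal ((norm (x - T x))\<^sup>2)"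
      using lim by (auto elim!: eventually_mono intro!: tendsto_intros)
    show "(\<integral>\<^sup>+x. ennreal ((norm (x - S (r i) x))\<^sup>2) \<partial>\<mu>) \<le> ennreal (d + 1 / real (Suc (r i)))" for i
      using S(2)[of "r i"] admissible_diff[OF S(1)[of "r i"]]
      by (simp add: nn_integral_eq_integral sq_integrable_def map_cost_def ennreal_leI)
    show "(\<lambda>i. ennreal (d + 1 / real (Suc (r i)))) \<longlonglongrightarrow> ennreal d" using Sc by (intro tendsto_ennrealI)
  qed measurable
  have d0: "0 \<le> d" unfolding d_def using ne map_cost_nonneg by (intro cINF_greatest)
  have diff: "sq_integrable \<mu> (\<lambda>x. x - T x)"
    using le_less_trans[OF nn ennreal_less_top] by (simp add: sq_integrable_def integrable_iff_bounded)
  have T: "sq_integrable \<mu> T" using sq_integrable_diff[OF P2D(3)[OF \<mu>] diff] by simp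
  have adm: "T \<in> admissible_maps"
  proof (rule admissibleI[OF T])
    fix h :: "real^'n \<Rightarrow> real" assume h: "convex_on UNIV h" "\<And>x. 0 \<le> h x"
    note [measurable] = convex_on_borel_measurable[OF h(1)]
    have cont: "continuous_on UNIV h" using h(1) by (intro convex_on_continuous) auto
    have hlim: "AE x in \<mu>. (\<lambda>i. ennreal (h (S (r i) x))) \<longlonglongrightarrow> ennreal (h (T x))"
      using lim by (auto elim!: eventually_mono intro!: tendsto_ennrealI continuous_on_tendsto_compose[OF cont])
    show "(\<integral>\<^sup>+x. ennreal (h (T x)) \<partial>\<mu>) \<le> (\<integral>\<^sup>+x. ennreal (h x) \<partial>\<nu>)"
      by (rule nn_integral_limit_le[OF _ hlim admissible_nn_integral[OF S(1) h] tendsto_const]) measurable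
  qed
  have "map_cost T \<le> d"
  proof -
    have "ennreal (map_cost T) \<le> ennreal d"
      using nn diff by (simp add: nn_integral_eq_integral sq_integrable_def map_cost_def)
    then show ?thesis using d0 by (simp add: ennreal_le_iff)
  qed
  then show thesis using that[OF adm] d by (meson order_trans)
qed

text \<open>The image of \<open>\<mu>\<close> under the optimal map is a projection. A second
  projection need not come from a map, nor have an optimal coupling; its almost optimal couplings
  show that its distance to this image is arbitrarily small.\<close>

lemma projection_exists_unique:
  "\<exists>!\<eta>. is_arg_min (\<lambda>\<eta>. W2 \<mu> \<eta>) (\<lambda>\<eta>. \<eta> \<in> P2 \<and> \<eta> \<le>\<^sub>c\<^sub>x \<nu>) \<eta>"
proof -
  obtain T where T: "T \<in> admissible_maps" and opt: "\<And>R. R \<in> admissible_maps \<Longrightarrow> map_cost T \<le> map_cost R"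
    using optimal_map_exists by blast
  define \<tau> where "\<tau> = distr \<mu> borel T"
  have Tsi: "sq_integrable \<mu> T" using T by (simp add: admissible_maps_def)
  have \<tau>: "\<tau> \<in> P2" "\<tau> \<le>\<^sub>c\<^sub>x \<nu>"
    using T distr_P2[OF M.prob_space_axioms Tsi] by (auto simp: \<tau>_def admissible_maps_def)
  have lower: "map_cost T \<le> (W2 \<mu> \<eta>)\<^sup>2" if \<eta>: "\<eta> \<in> P2" "\<eta> \<le>\<^sub>c\<^sub>x \<nu>" for \<eta>
  proof (rule W2_sq_greatest[OF \<mu> \<eta>(1)])
    fix \<pi> assume \<pi>: "\<pi> \<in> couplings \<mu> \<eta>"
    obtain R where R: "R \<in> admissible_maps"
      "transport_cost \<pi> = map_cost R + (\<integral>z. (norm (snd z - R (fst z)))\<^sup>2 \<partial>\<pi>)"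
      by (rule coupling_to_map[OF \<eta> \<pi>])
    have "0 \<le> (\<integral>z. (norm (snd z - R (fst z)))\<^sup>2 \<partial>\<pi>)" by (simp add: integral_nonneg_AE)
    then show "map_cost T \<le> transport_cost \<pi>" using opt[OF R(1)] R(2) by linarith
  qed
  have upper: "(W2 \<mu> \<tau>)\<^sup>2 \<le> map_cost T"
    using W2_sq_le_expectation[OF M.prob_space_axioms P2D(3)[OF \<mu>] Tsi] P2D(2)[OF \<mu>]
    by (simp add: \<tau>_def map_cost_def distr_id2)
  have min: "is_arg_min (\<lambda>\<eta>. W2 \<mu> \<eta>) (\<lambda>\<eta>. \<eta> \<in> P2 \<and> \<eta> \<le>\<^sub>c\<^sub>x \<nu>) \<tau>"
  proof -
    have "W2 \<mu> \<tau> \<le> W2 \<mu> \<eta>" if "\<eta> \<in> P2" "\<eta> \<le>\<^sub>c\<^sub>x \<nu>" for \<eta>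
      unfolding W2_le_iff using upper lower[OF that] by (rule order_trans)
    then show ?thesis using \<tau> by (auto simp: is_arg_min_def not_less)
  qed
  moreover have "\<eta> = \<tau>" if "is_arg_min (\<lambda>\<eta>. W2 \<mu> \<eta>) (\<lambda>\<eta>. \<eta> \<in> P2 \<and> \<eta> \<le>\<^sub>c\<^sub>x \<nu>) \<eta>" for \<eta>
  proof -
    have \<eta>: "\<eta> \<in> P2" "\<eta> \<le>\<^sub>c\<^sub>x \<nu>" and "W2 \<mu> \<eta> \<le> W2 \<mu> \<tau>"
      using that \<tau> by (auto simp: is_arg_min_def not_less)
    then have "(W2 \<mu> \<eta>)\<^sup>2 \<le> (W2 \<mu> \<tau>)\<^sup>2" by (simp add: W2_le_iff)
    with upper have W: "(W2 \<mu> \<eta>)\<^sup>2 \<le> map_cost T" by (rule order_trans[rotated])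
    show "\<eta> = \<tau>"
    proof (rule W2_eq_0_imp_eq[OF \<eta>(1) \<tau>(1)], rule W2_eq_0I)
      fix e :: real assume e: "0 < e"
      \<comment> \<open>With slack e/6, the residual is below e/6 and the parallelogram bound
        between \<open>R\<close> and \<open>T\<close> below 2 e/6 = e/3. The inequality |x + y|^2 <=
        2 |x|^2 + 2 |y|^2 then gives e/3 + 2 e/3 = e.\<close>
      obtain \<pi> where \<pi>: "\<pi> \<in> couplings \<mu> \<eta>" "transport_cost \<pi> < (W2 \<mu> \<eta>)\<^sup>2 + e / 6"
        using W2_sq_approx[OF \<mu> \<eta>(1), of "e / 6"] e by auto
      note c = couplingsD[OF \<pi>(1)] and s = couplings_sq_integrable[OF \<pi>(1) \<mu> \<eta>(1)]
      obtain R where R: "R \<in> admissible_maps" "sq_integrable \<pi> (\<lambda>z. R (fst z))"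
        "transport_cost \<pi> = map_cost R + (\<integral>z. (norm (snd z - R (fst z)))\<^sup>2 \<partial>\<pi>)"
        by (rule coupling_to_map[OF \<eta> \<pi>(1)])
      have Tf: "sq_integrable \<pi> (\<lambda>z. T (fst z))"
        using Tsi c(3) admissible_measurable(2)[OF T] unfolding c(5)[symmetric]
        by (auto simp: sq_integrable_def integrable_distr_eq)
      note s1 = sq_integrable_diff[OF s(2) R(2)] and s2 = sq_integrable_diff[OF R(2) Tf]
        and s3 = sq_integrable_diff[OF s(2) Tf]
      have nn: "0 \<le> (\<integral>z. (norm (snd z - R (fst z)))\<^sup>2 \<partial>\<pi>)" by (simp add: integral_nonneg_AE)
      have a1: "map_cost R < map_cost T + e / 6" using \<pi>(2) W R(3) nn by linarith
      have a2: "(\<integral>z. (norm (snd z - R (fst z)))\<^sup>2 \<partial>\<pi>) < e / 6" using \<pi>(2) W R(3) opt[OF R(1)] by linarith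
      have "(\<integral>z. (norm (R (fst z) - T (fst z)))\<^sup>2 \<partial>\<pi>) = (\<integral>x. (norm (R x - T x))\<^sup>2 \<partial>\<mu>)"
        unfolding c(5)[symmetric] using c(3) admissible_measurable(2)[OF T] admissible_measurable(2)[OF R(1)]
        by (subst integral_distr) auto
      also have "\<dots> \<le> 2 * map_cost R + 2 * map_cost T - 4 * map_cost T"
        by (rule admissible_dist_le[OF R(1) T opt])
      finally have a3: "(\<integral>z. (norm (R (fst z) - T (fst z)))\<^sup>2 \<partial>\<pi>) < e / 3" using a1 by linarith
      have "(\<integral>z. (norm (snd z - T (fst z)))\<^sup>2 \<partial>\<pi>)
          \<le> (\<integral>z. 2 * (norm (snd z - R (fst z)))\<^sup>2 + 2 * (norm (R (fst z) - T (fst z)))\<^sup>2 \<partial>\<pi>)"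
      proof (rule integral_mono)
        show "(norm (snd z - T (fst z)))\<^sup>2 \<le> 2 * (norm (snd z - R (fst z)))\<^sup>2 + 2 * (norm (R (fst z) - T (fst z)))\<^sup>2" for z
          using norm_add_sq_le[of "snd z - R (fst z)" "R (fst z) - T (fst z)"] by simp
      qed (use s1 s2 s3 in \<open>auto simp: sq_integrable_def\<close>)
      also have "\<dots> = 2 * (\<integral>z. (norm (snd z - R (fst z)))\<^sup>2 \<partial>\<pi>) + 2 * (\<integral>z. (norm (R (fst z) - T (fst z)))\<^sup>2 \<partial>\<pi>)"
        using s1 s2 by (simp add: sq_integrable_def)
      finally have close: "(\<integral>z. (norm (snd z - T (fst z)))\<^sup>2 \<partial>\<pi>) < e" using a2 a3 e by linarith
      have dT: "distr \<pi> borel (\<lambda>z. T (fst z)) = \<tau>"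
        unfolding \<tau>_def c(5)[symmetric] using c(3) admissible_measurable(2)[OF T] by (simp add: distr_distr comp_def)
      show "(W2 \<eta> \<tau>)\<^sup>2 \<le> e"
        using W2_sq_le_expectation[OF c(1) s(2) Tf] close by (simp add: dT c(6))
    qed
  qed
  ultimately show ?thesis by blast
qed

end

lemma I2_is_arg_min:
  assumes "\<mu> \<in> P2" "\<nu> \<in> P2"
  shows "is_arg_min (\<lambda>\<eta>. W2 \<mu> \<eta>) (\<lambda>\<eta>. \<eta> \<in> P2 \<and> \<eta> \<le>\<^sub>c\<^sub>x \<nu>) (I2 \<mu> \<nu>)"
  unfolding I2_def by (rule theI'[OF projection_exists_unique[OF assms]])

lemma I2_eqI:
  assumes "\<mu> \<in> P2" "\<nu> \<in> P2" "is_arg_min (\<lambda>\<eta>. W2 \<mu> \<eta>) (\<lambda>\<eta>. \<eta> \<in> P2 \<and> \<eta> \<le>\<^sub>c\<^sub>x \<nu>) \<eta>"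
  shows "I2 \<mu> \<nu> = \<eta>"
  unfolding I2_def by (rule the1_equality[OF projection_exists_unique[OF assms(1,2)] assms(3)])

subsection \<open>Strict concavity of the trace of the square root\<close>

text \<open>Operator monotonicity of the square root. For a unit eigenvector v of R - P with
  eigenvalue d < 0, |R v|^2 - |P v|^2 = d (v . R v + v . P v) forces both forms to vanish. Then R v
  = P v = 0, contradicting d v = R v - P v.\<close>

lemma psd_sqrt_monotone:
  fixes R P :: "real^'n^'n"
  assumes R: "psd R" and P: "psd P" and le: "\<And>x. norm (P *v x) \<le> norm (R *v x)"
  shows "psd (R - P)"
proof -
  have "transpose (R - P) = R - P" using R P by (simp add: transpose_minus psd_symmetric)
  then obtain U d where U: "orthogonal_matrix U" and D: "R - P = U ** diag d ** transpose U"
    by (rule symmetric_diagonalization)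
  have "0 \<le> d i" for i
  proof (rule ccontr)
    assume "\<not> 0 \<le> d i"
    then have neg: "d i < 0" by simp
    define v where "v = U *v axis i 1"
    have "(R - P) *v v = U *v (diag d *v (transpose U *v (U *v axis i 1)))"
      by (simp add: D v_def flip: matrix_vector_mul_assoc)
    also have "diag d *v (transpose U *v (U *v axis i 1)) = d i *\<^sub>R axis i 1"
      by (simp add: orthogonal_matrix_mult_inverse[OF U]) (simp add: diag_mult_vec vec_eq_iff axis_def)
    finally have ev: "R *v v - P *v v = d i *\<^sub>R v"
      by (simp add: matrix_vector_mult_diff_rdistrib matrix_vector_mult_scaleR v_def)
    have nv: "norm v = 1" by (simp add: v_def orthogonal_matrix_norm[OF U])
    have "0 \<le> (norm (R *v v))\<^sup>2 - (norm (P *v v))\<^sup>2" using power_mono[OF le[of v]] by simp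
    also have "\<dots> = (R *v v - P *v v) \<bullet> (R *v v + P *v v)"
      by (simp add: power2_norm_eq_inner inner_diff_left inner_diff_right inner_add_right inner_commute)
    also have "\<dots> = d i * (v \<bullet> (R *v v) + v \<bullet> (P *v v))" by (simp add: ev inner_add_right distrib_left)
    finally have "v \<bullet> (R *v v) + v \<bullet> (P *v v) \<le> 0" using neg by (simp add: zero_le_mult_iff)
    moreover have "0 \<le> v \<bullet> (R *v v)" "0 \<le> v \<bullet> (P *v v)" using R P by (auto simp: psd_def)
    ultimately have "v \<bullet> (R *v v) = 0" "v \<bullet> (P *v v) = 0" by linarith+
    then have "R *v v = 0" "P *v v = 0" using psd_null_iff R P by blast+
    then show False using ev neg nv by auto
  qed
  then show ?thesis unfolding D by (rule psd_conj_diag)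
qed

text \<open>\<open>R\<close> is the root of the midpoint and \<open>P\<close> the midpoint of the
  roots. The parallelogram identity gives the exact difference of |R x|^2 and |P x|^2, so
  monotonicity yields P <= R. Equal traces would force R = P and hence equal roots.\<close>

lemma trace_psd_sqrt_midpoint_less:
  fixes A B :: "real^'n^'n"
  assumes A: "psd A" and B: "psd B" and ne: "A \<noteq> B"
  shows "(trace (psd_sqrt A) + trace (psd_sqrt B)) / 2 < trace (psd_sqrt ((1/2) *\<^sub>R (A + B)))"
proof -
  define R P where "R = psd_sqrt ((1/2) *\<^sub>R (A + B))" and "P = (1/2) *\<^sub>R (psd_sqrt A + psd_sqrt B)"
  have M: "psd ((1/2) *\<^sub>R (A + B))" using A B by (intro psd_scaleR psd_add) auto
  have R: "psd R" unfolding R_def by (rule psd_psd_sqrt[OF M])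
  have P: "psd P" unfolding P_def using psd_psd_sqrt[OF A] psd_psd_sqrt[OF B] by (intro psd_scaleR psd_add) auto
  have gap: "(norm (R *v x))\<^sup>2 = (norm (P *v x))\<^sup>2 + (1/4) * (norm (psd_sqrt A *v x - psd_sqrt B *v x))\<^sup>2" for x
  proof -
    have "(norm (R *v x))\<^sup>2 = x \<bullet> (((1/2) *\<^sub>R (A + B)) *v x)"
      unfolding norm_psd_mult[OF R] by (simp add: R_def psd_sqrt_mult_self[OF M])
    also have "\<dots> = (1/2) * (x \<bullet> (A *v x)) + (1/2) * (x \<bullet> (B *v x))"
      by (simp add: inner_add_right matrix_vector_mult_add_rdistrib scaleR_matrix_vector_assoc[symmetric])
    also have "x \<bullet> (A *v x) = (norm (psd_sqrt A *v x))\<^sup>2"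
      by (simp add: norm_psd_mult[OF psd_psd_sqrt[OF A]] psd_sqrt_mult_self[OF A])
    also have "x \<bullet> (B *v x) = (norm (psd_sqrt B *v x))\<^sup>2"
      by (simp add: norm_psd_mult[OF psd_psd_sqrt[OF B]] psd_sqrt_mult_self[OF B])
    also have "(1/2) * (norm (psd_sqrt A *v x))\<^sup>2 + (1/2) * (norm (psd_sqrt B *v x))\<^sup>2
        = (norm ((1/2) *\<^sub>R (psd_sqrt A *v x + psd_sqrt B *v x)))\<^sup>2 + (1/4) * (norm (psd_sqrt A *v x - psd_sqrt B *v x))\<^sup>2"
      by (simp add: power2_norm_eq_inner inner_add_left inner_add_right inner_diff_left inner_diff_right
          inner_commute algebra_simps)
    also have "(1/2) *\<^sub>R (psd_sqrt A *v x + psd_sqrt B *v x) = P *v x"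
      by (simp add: P_def matrix_vector_mult_add_rdistrib scaleR_matrix_vector_assoc[symmetric])
    finally show ?thesis .
  qed
  have "norm (P *v x) \<le> norm (R *v x)" for x
    by (rule power2_le_imp_le) (simp_all add: gap)
  then have RP: "psd (R - P)" by (rule psd_sqrt_monotone[OF R P])
  have "trace (R - P) \<noteq> 0"
  proof
    assume "trace (R - P) = 0"
    then have "R = P" using psd_trace_eq_0[OF RP] by simp
    then have "psd_sqrt A *v x = psd_sqrt B *v x" for x using gap[of x] by simp
    then have "psd_sqrt A = psd_sqrt B" by (simp add: matrix_eq)
    then show False using psd_sqrt_mult_self[OF A] psd_sqrt_mult_self[OF B] ne by metis
  qed
  then have "0 < trace (R - P)" using psd_trace_nonneg[OF RP] by linarith
  then show ?thesis by (simp add: trace_sub trace_add trace_scaleR R_def P_def)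
qed

subsection \<open>The covariance problem for dominating measures\<close>

definition covariance_objective :: "real^'n^'n \<Rightarrow> real^'n^'n \<Rightarrow> real" where
  "covariance_objective S A = trace A - 2 * fidelity S A"

lemma covariance_objective_eq:
  "trace (A - 2 *\<^sub>R psd_sqrt (psd_sqrt S ** A ** psd_sqrt S)) = covariance_objective S A"
  by (simp add: covariance_objective_def fidelity_def trace_sub trace_scaleR)

text \<open>Trace duality with the identity as contraction. An arbitrary factor \<open>B\<close> may
  be badly rotated, hence only an inequality.\<close>

lemma fidelity_ge:
  fixes S B :: "real^'n^'n"
  assumes "psd S" shows "trace (psd_sqrt S ** B) \<le> fidelity S (B ** transpose B)"
proof -
  have "contraction (mat 1 :: real^'n^'n)" by (simp add: contraction_def)
  from trace_mult_contraction_le(1)[OF this, of "psd_sqrt S ** B"]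
  show ?thesis
    using psd_symmetric[OF psd_psd_sqrt[OF assms]]
    by (simp add: fidelity_def matrix_transpose_mul matrix_mul_assoc)
qed

text \<open>Writing \<open>A = B B\<^sup>T\<close>, the objective is the squared distance from \<open>B\<close> to the square root of \<open>S\<close>
  up to a constant, once \<open>B\<close> is rotated optimally. So a closest point of a closed set is a minimiser.\<close>

lemma norm_diff_sqrt_sq:
  fixes S B :: "real^'n^'n"
  assumes "psd S"
  shows "(norm (psd_sqrt S - B))\<^sup>2 = trace S + trace (B ** transpose B) - 2 * trace (psd_sqrt S ** B)"
proof -
  have "(norm (psd_sqrt S - B))\<^sup>2 = psd_sqrt S \<bullet> psd_sqrt S + B \<bullet> B - 2 * (psd_sqrt S \<bullet> B)"
    by (simp add: power2_norm_eq_inner inner_diff_left inner_diff_right inner_commute)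
  also have "psd_sqrt S \<bullet> psd_sqrt S = trace S"
    using psd_sqrt[OF assms] by (simp add: inner_matrix_trace psd_symmetric)
  also have "B \<bullet> B = trace (B ** transpose B)" by (subst trace_mul_sym) (simp add: inner_matrix_trace)
  also have "psd_sqrt S \<bullet> B = trace (psd_sqrt S ** B)"
    using psd_psd_sqrt[OF assms] by (simp add: inner_matrix_trace psd_symmetric)
  finally show ?thesis .
qed

text \<open>The Loewner constraint is an intersection over x of the closed conditions x . A x <=
  |B^T x|^2. The vector B^T x is written in coordinates to expose its continuity in \<open>B\<close>
  for fixed x.\<close>

lemma closed_dominating_factors:
  assumes A: "psd (A :: real^'n^'n)" shows "closed {B :: real^'n^'n. A \<preceq>\<^sub>L B ** transpose B}"
proof -
  have "A \<preceq>\<^sub>L B ** transpose B \<longleftrightarrow> (\<forall>x. x \<bullet> (A *v x) \<le> (norm (\<chi> i. \<Sum>j\<in>UNIV. B $ j $ i * x $ j))\<^sup>2)" for B :: "real^'n^'n"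
  proof -
    have "x \<bullet> (B ** transpose B *v x) = (norm (\<chi> i. \<Sum>j\<in>UNIV. B $ j $ i * x $ j))\<^sup>2" for x
    proof -
      have "transpose B *v x = (\<chi> i. \<Sum>j\<in>UNIV. B $ j $ i * x $ j)"
        by (simp add: matrix_vector_mult_def transpose_def)
      then show ?thesis
        using transpose_dot[of x "transpose B" "transpose B *v x"]
        by (simp add: power2_norm_eq_inner flip: matrix_vector_mul_assoc)
    qed
    then show ?thesis
      using psd_mult_transpose[of B] A
      by (auto simp: loewner_le_def psd_def transpose_minus matrix_vector_mult_diff_rdistrib inner_diff_right)
  qed
  then have "{B :: real^'n^'n. A \<preceq>\<^sub>L B ** transpose B}
      = (\<Inter>x. {B. x \<bullet> (A *v x) \<le> (norm (\<chi> i. \<Sum>j\<in>UNIV. B $ j $ i * x $ j))\<^sup>2})" by auto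
  also have "closed \<dots>"
    by (intro closed_INT ballI closed_Collect_le continuous_intros)
  finally show ?thesis .
qed

lemma covariance_minimizer_exists:
  fixes S A :: "real^'n^'n"
  assumes S: "psd S" and A: "psd A"
  shows "\<exists>\<Sigma>. is_arg_min (covariance_objective S) (\<lambda>\<Sigma>. psd \<Sigma> \<and> A \<preceq>\<^sub>L \<Sigma>) \<Sigma>"
proof -
  define C where "C = {B :: real^'n^'n. A \<preceq>\<^sub>L B ** transpose B}"
  have psd0: "psd (0 :: real^'n^'n)" by (simp add: psd_def transpose_def vec_eq_iff)
  have "psd_sqrt A \<in> C"
    using psd_sqrt[OF A] psd0 by (simp add: C_def psd_symmetric loewner_le_def)
  then have ne: "C \<noteq> {}" by blast
  have "closed C" unfolding C_def by (rule closed_dominating_factors[OF A])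
  from distance_attains_inf[OF this ne, of "psd_sqrt S"]
  obtain B where B: "B \<in> C" "\<And>B'. B' \<in> C \<Longrightarrow> dist (psd_sqrt S) B \<le> dist (psd_sqrt S) B'" by blast
  have min: "covariance_objective S (B ** transpose B) \<le> covariance_objective S \<Sigma>" if \<Sigma>: "psd \<Sigma>" "A \<preceq>\<^sub>L \<Sigma>" for \<Sigma>
  proof -
    \<comment> \<open>For the competitor an optimally rotated factor gives equality between fidelity
      and trace. For the closest point \<open>B\<close> the inequality of \<open>fidelity_ge\<close>
      suffices and has the right direction.\<close>
    obtain Q where Q: "orthogonal_matrix Q" "trace (psd_sqrt S ** psd_sqrt \<Sigma> ** Q) = fidelity S \<Sigma>"
      using fidelity_attained[OF S \<Sigma>(1)] .
    define B' where "B' = psd_sqrt \<Sigma> ** Q"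
    have B'B': "B' ** transpose B' = \<Sigma>"
      using psd_sqrt[OF \<Sigma>(1)]
      by (simp add: B'_def matrix_transpose_mul matrix_mul_assoc psd_symmetric orthogonal_matrix_inverse[OF Q(1)])
    have "B' \<in> C" using \<Sigma>(2) by (simp add: C_def B'B')
    from B(2)[OF this] have "(norm (psd_sqrt S - B))\<^sup>2 \<le> (norm (psd_sqrt S - B'))\<^sup>2"
      by (intro power_mono) (auto simp: dist_norm)
    then have "trace (B ** transpose B) - 2 * trace (psd_sqrt S ** B) \<le> trace \<Sigma> - 2 * trace (psd_sqrt S ** B')"
      unfolding norm_diff_sqrt_sq[OF S] B'B' by simp
    moreover have "trace (psd_sqrt S ** B') = fidelity S \<Sigma>" using Q(2) by (simp add: B'_def matrix_mul_assoc)
    ultimately show ?thesis using fidelity_ge[OF S, of B] by (simp add: covariance_objective_def)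
  qed
  show ?thesis
    using B(1) min psd_mult_transpose[of B]
    by (intro exI[of _ "B ** transpose B"]) (auto simp: is_arg_min_def C_def not_less)
qed

lemma pos_def_psd: "pos_def S \<Longrightarrow> psd S"
  unfolding pos_def_def psd_def by (metis inner_zero_left less_imp_le order_refl)

lemma pos_def_sqrt_inverse:
  fixes S :: "real^'n^'n"
  assumes S: "pos_def S"
  obtains R where "R ** psd_sqrt S = mat 1" "psd_sqrt S ** R = mat 1" "transpose R = R"
proof -
  note p = psd_sqrt[OF pos_def_psd[OF S]]
  have "x = 0" if "psd_sqrt S *v x = 0" for x
  proof -
    have "S *v x = psd_sqrt S *v (psd_sqrt S *v x)" by (simp add: matrix_vector_mul_assoc p(2))
    then have "x \<bullet> (S *v x) = 0" using that by simp
    then show ?thesis using S unfolding pos_def_def by (metis less_irrefl)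
  qed
  then obtain R where R: "R ** psd_sqrt S = mat 1" using matrix_left_invertible_ker[of "psd_sqrt S"] by blast
  then have R': "psd_sqrt S ** R = mat 1" by (simp add: matrix_left_right_inverse)
  have "transpose R = transpose R ** (psd_sqrt S ** R)" by (simp add: R')
  also have "\<dots> = transpose (psd_sqrt S ** R) ** R"
    using psd_symmetric[OF p(1)] by (simp add: matrix_transpose_mul matrix_mul_assoc)
  also have "\<dots> = R" by (simp add: R')
  finally show thesis using that R R' by blast
qed

text \<open>Conjugation by the invertible root of \<open>S\<close> is injective, so distinct
  covariances give distinct arguments of the strictly concave trace of the root. Their midpoint is
  feasible and would be strictly better.\<close>

lemma covariance_minimizer_unique:
  fixes S A :: "real^'n^'n"
  assumes S: "pos_def S"
    and 1: "is_arg_min (covariance_objective S) (\<lambda>\<Sigma>. psd \<Sigma> \<and> A \<preceq>\<^sub>L \<Sigma>) \<Sigma>1"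
    and 2: "is_arg_min (covariance_objective S) (\<lambda>\<Sigma>. psd \<Sigma> \<and> A \<preceq>\<^sub>L \<Sigma>) \<Sigma>2"
  shows "\<Sigma>1 = \<Sigma>2"
proof (rule ccontr)
  assume ne: "\<Sigma>1 \<noteq> \<Sigma>2"
  obtain R where R: "R ** psd_sqrt S = mat 1" "psd_sqrt S ** R = mat 1" using pos_def_sqrt_inverse[OF S] by metis
  have T: "transpose (psd_sqrt S) = psd_sqrt S" using psd_psd_sqrt[OF pos_def_psd[OF S]] by (rule psd_symmetric)
  have p: "psd \<Sigma>1" "A \<preceq>\<^sub>L \<Sigma>1" "psd \<Sigma>2" "A \<preceq>\<^sub>L \<Sigma>2" using 1 2 by (auto simp: is_arg_min_def)
  define G where "G \<Sigma> = psd_sqrt S ** \<Sigma> ** psd_sqrt S" for \<Sigma>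
  have inv: "R ** G \<Sigma> ** R = \<Sigma>" for \<Sigma>
  proof -
    have "R ** G \<Sigma> ** R = (R ** psd_sqrt S) ** \<Sigma> ** (psd_sqrt S ** R)" by (simp add: G_def matrix_mul_assoc)
    then show ?thesis by (simp add: R)
  qed
  have Gne: "G \<Sigma>1 \<noteq> G \<Sigma>2" using inv[of \<Sigma>1] inv[of \<Sigma>2] ne by auto
  have Gp: "psd (G \<Sigma>)" if "psd \<Sigma>" for \<Sigma> using psd_congruence[OF that, of "psd_sqrt S"] by (simp add: G_def T)
  define N where "N = (1/2) *\<^sub>R (\<Sigma>1 + \<Sigma>2)"
  have GN: "G N = (1/2) *\<^sub>R (G \<Sigma>1 + G \<Sigma>2)"
    by (simp add: G_def N_def matrix_algebra scaleR_add_right)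
  have pN: "psd N" unfolding N_def using p by (intro psd_scaleR psd_add) auto
  have eq: "N - A = (1/2) *\<^sub>R ((\<Sigma>1 - A) + (\<Sigma>2 - A))"
    by (simp add: N_def vec_eq_iff field_simps)
  have AN: "A \<preceq>\<^sub>L N"
    unfolding loewner_le_def eq using p(2,4) unfolding loewner_le_def by (intro psd_scaleR psd_add) auto
  have "(fidelity S \<Sigma>1 + fidelity S \<Sigma>2) / 2 < fidelity S N"
    using trace_psd_sqrt_midpoint_less[OF Gp[OF p(1)] Gp[OF p(3)] Gne]
    unfolding fidelity_def by (simp add: GN flip: G_def)
  moreover have "trace N = (trace \<Sigma>1 + trace \<Sigma>2) / 2" by (simp add: N_def trace_scaleR trace_add)
  ultimately have "covariance_objective S N < (covariance_objective S \<Sigma>1 + covariance_objective S \<Sigma>2) / 2"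
    by (simp add: covariance_objective_def field_simps)
  moreover have "covariance_objective S \<Sigma>1 \<le> covariance_objective S N" "covariance_objective S \<Sigma>2 \<le> covariance_objective S N"
    using 1 2 pN AN by (auto simp: is_arg_min_def not_less)
  ultimately show False by argo
qed

subsection \<open>The equality case of the Gelbrich bound\<close>

text \<open>In an eigenbasis of \<open>T\<close> the gap splits into coordinates, and the \<open>i\<close>-th contribution to the left side
  is \<open>2 t\<^sub>i\<close> times the \<open>i\<close>-th gap.\<close>

lemma expectation_dist_linear_map_le:
  fixes X Y :: "'a \<Rightarrow> real^'n" and T :: "real^'n^'n"
  assumes X: "sq_integrable M X" and Y: "sq_integrable M Y" and T: "psd T"
    and cov: "cross_moment M Y Y = T ** cross_moment M X X ** T"
  shows "(\<integral>z. (norm (Y z - T *v X z))\<^sup>2 \<partial>M) \<le> 2 * trace T * (trace (T ** cross_moment M X X) - (\<integral>z. X z \<bullet> Y z \<partial>M))"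
proof -
  obtain U t where U: "orthogonal_matrix U" and t: "\<And>i. 0 \<le> t i" and TU: "T = U ** diag t ** transpose U"
    using psd_diagonalization[OF T] by blast
  define V W where "V z = transpose U *v X z" and "W z = transpose U *v Y z" for z
  have V: "sq_integrable M V" and W: "sq_integrable M W"
    unfolding V_def[abs_def] W_def[abs_def] using X Y by (auto intro: sq_integrable_matrix)
  have cV: "cross_moment M V V = transpose U ** cross_moment M X X ** U"
    unfolding V_def[abs_def] using cross_moment_matrix[OF X X, of "transpose U" "transpose U"] by simp
  have "cross_moment M W W = transpose U ** (T ** cross_moment M X X ** T) ** U"
    unfolding W_def[abs_def] using cross_moment_matrix[OF Y Y, of "transpose U" "transpose U"] by (simp add: cov)
  also have "\<dots> = diag t ** cross_moment M V V ** diag t"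
    by (simp add: TU cV matrix_mul_assoc orthogonal_matrix_inverse[OF U])
  finally have cW: "cross_moment M W W = diag t ** cross_moment M V V ** diag t" .
  define a b g where "a i = (\<integral>z. V z $ i * V z $ i \<partial>M)" and "b i = (\<integral>z. V z $ i * W z $ i \<partial>M)" and "g i = t i * a i - b i" for i
  have iVV: "integrable M (\<lambda>z. V z $ i * V z $ i)" and iVW: "integrable M (\<lambda>z. V z $ i * W z $ i)"
    and iWW: "integrable M (\<lambda>z. W z $ i * W z $ i)" for i
    using sq_integrable_component_mult V W by blast+
  have WW: "(\<integral>z. W z $ i * W z $ i \<partial>M) = t i * a i * t i" for i
  proof -
    have "(\<integral>z. W z $ i * W z $ i \<partial>M) = (diag t ** cross_moment M V V ** diag t) $ i $ i"
      unfolding cW[symmetric] by (simp add: cross_moment_def)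
    also have "\<dots> = t i * a i * t i"
      by (simp add: matrix_matrix_mult_def diag_def cross_moment_def a_def if_distrib if_distribR cong: if_cong)
    finally show ?thesis .
  qed
  have sq: "(\<integral>z. (W z $ i - t i * V z $ i)\<^sup>2 \<partial>M) = 2 * t i * g i" for i
  proof -
    have "(\<integral>z. (W z $ i - t i * V z $ i)\<^sup>2 \<partial>M)
        = (\<integral>z. W z $ i * W z $ i - 2 * t i * (V z $ i * W z $ i) + t i * t i * (V z $ i * V z $ i) \<partial>M)"
      by (intro Bochner_Integration.integral_cong) (auto simp: power2_eq_square algebra_simps)
    also have "\<dots> = t i * a i * t i - 2 * t i * b i + t i * t i * a i"
      using iVV iVW iWW by (simp add: WW a_def b_def)
    finally show ?thesis by (simp add: g_def algebra_simps)
  qed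
  \<comment> \<open>If \<open>t i\<close> = 0, the second moment of the i-th coordinate of
    \<open>W\<close> is 0 and Cauchy-Schwarz gives b i <= 0. Otherwise \<open>sq\<close> writes
    \<open>g i\<close> as a mean square divided by 2 t i.\<close>
  have g0: "0 \<le> g i" for i
  proof (cases "t i = 0")
    case True
    have "(\<integral>z. V z $ i * W z $ i \<partial>M) \<le> sqrt (\<integral>z. (V z $ i)\<^sup>2 \<partial>M) * sqrt (\<integral>z. (W z $ i)\<^sup>2 \<partial>M)"
      using iVV[of i] iVW[of i] iWW[of i] by (intro integral_mult_Cauchy_Schwarz) (auto simp: power2_eq_square)
    then show ?thesis using WW[of i] True by (simp add: g_def b_def power2_eq_square)
  next
    case False
    have "0 \<le> 2 * t i * g i" unfolding sq[symmetric] by (simp add: integral_nonneg_AE)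
    then show ?thesis using False t[of i] by (simp add: zero_le_mult_iff)
  qed
  have isq: "integrable M (\<lambda>z. (W z $ i - t i * V z $ i)\<^sup>2)" for i
  proof -
    have "integrable M (\<lambda>z. W z $ i * W z $ i - 2 * t i * (V z $ i * W z $ i) + t i * t i * (V z $ i * V z $ i))"
      using iVV iVW iWW by simp
    then show ?thesis by (simp add: power2_eq_square algebra_simps)
  qed
  have nrm: "(norm (Y z - T *v X z))\<^sup>2 = (\<Sum>i\<in>UNIV. (W z $ i - t i * V z $ i)\<^sup>2)" for z
  proof -
    have "transpose U *v (T *v X z) = (transpose U ** U) *v (diag t *v V z)"
      unfolding TU V_def by (simp add: matrix_vector_mul_assoc matrix_mul_assoc)
    then have "transpose U *v (Y z - T *v X z) = W z - diag t *v V z"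
      by (simp add: matrix_vector_mult_diff_distrib W_def orthogonal_matrix_inverse[OF U])
    moreover have "norm (Y z - T *v X z) = norm (transpose U *v (Y z - T *v X z))"
      using orthogonal_matrix_norm[of "transpose U"] U by simp
    ultimately show ?thesis by (simp add: norm_sq_eq_sum diag_mult_vec)
  qed
  have "(\<integral>z. (norm (Y z - T *v X z))\<^sup>2 \<partial>M) = (\<Sum>i\<in>UNIV. 2 * t i * g i)"
    unfolding nrm using isq by (simp add: Bochner_Integration.integral_sum sq)
  also have "\<dots> \<le> (\<Sum>i\<in>UNIV. 2 * trace T * g i)"
  proof (intro sum_mono mult_right_mono g0)
    have "t i \<le> sum t UNIV" for i using t by (intro member_le_sum) auto
    then show "2 * t i \<le> 2 * trace T" for i by (simp add: TU trace_conj_diag[OF U])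
  qed
  also have "\<dots> = 2 * trace T * (\<Sum>i\<in>UNIV. g i)" by (simp add: sum_distrib_left)
  also have "(\<Sum>i\<in>UNIV. g i) = (\<Sum>i\<in>UNIV. t i * a i) - (\<Sum>i\<in>UNIV. b i)" by (simp add: g_def sum_subtractf)
  also have "(\<Sum>i\<in>UNIV. t i * a i) = trace (diag t ** cross_moment M V V)"
    by (simp add: trace_diag_mult cross_moment_def a_def)
  also have "\<dots> = trace ((diag t ** transpose U ** cross_moment M X X) ** U)" by (simp add: cV matrix_mul_assoc)
  also have "\<dots> = trace (T ** cross_moment M X X)" by (subst trace_mul_sym) (simp add: TU matrix_mul_assoc)
  also have "(\<Sum>i\<in>UNIV. b i) = trace (cross_moment M V W)" by (simp add: trace_def cross_moment_def b_def)
  also have "\<dots> = (\<integral>z. X z \<bullet> Y z \<partial>M)"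
  proof -
    have "V z \<bullet> W z = X z \<bullet> Y z" for z
      using transpose_dot[of "transpose U *v X z" U "Y z"] by (simp add: V_def W_def orthogonal_matrix_mult_inverse[OF U])
    then show ?thesis by (simp add: trace_cross_moment[OF V W])
  qed
  finally show ?thesis .
qed

text \<open>The Brenier map between centred Gaussians, T = S^(-1/2) (S^(1/2) A S^(1/2))^(1/2)
  S^(-1/2).\<close>

lemma optimal_linear_map:
  fixes S A :: "real^'n^'n"
  assumes S: "pos_def S" and A: "psd A"
  obtains T where "psd T" "T ** S ** T = A" "trace (T ** S) = fidelity S A"
proof -
  obtain R where R: "R ** psd_sqrt S = mat 1" "psd_sqrt S ** R = mat 1" "transpose R = R" using pos_def_sqrt_inverse[OF S] by metis
  note p = psd_sqrt[OF pos_def_psd[OF S]]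
  define G where "G = psd_sqrt S ** A ** psd_sqrt S"
  have G: "psd G" using psd_congruence[OF A, of "psd_sqrt S"] by (simp add: G_def psd_symmetric[OF p(1)])
  define T where "T = R ** psd_sqrt G ** R"
  have RSR: "R ** S ** R = mat 1"
  proof -
    have "R ** S ** R = (R ** psd_sqrt S) ** (psd_sqrt S ** R)" by (subst p(2)[symmetric]) (simp add: matrix_mul_assoc)
    then show ?thesis by (simp add: R)
  qed
  have "psd T" using psd_congruence[OF psd_psd_sqrt[OF G], of R] by (simp add: T_def R(3))
  moreover have "T ** S ** T = A"
  proof -
    have "T ** S ** T = R ** psd_sqrt G ** (R ** S ** R) ** psd_sqrt G ** R" by (simp add: T_def matrix_mul_assoc)
    also have "\<dots> = R ** (psd_sqrt G ** psd_sqrt G) ** R" by (simp add: RSR matrix_mul_assoc)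
    also have "\<dots> = (R ** psd_sqrt S) ** A ** (psd_sqrt S ** R)"
      unfolding psd_sqrt_mult_self[OF G] by (simp add: G_def matrix_mul_assoc)
    finally show ?thesis by (simp add: R)
  qed
  moreover have "trace (T ** S) = fidelity S A"
  proof -
    have "trace (T ** S) = trace (R ** (psd_sqrt G ** R ** S))" by (simp add: T_def matrix_mul_assoc)
    also have "\<dots> = trace (psd_sqrt G ** (R ** S ** R))" by (subst trace_mul_sym) (simp add: matrix_mul_assoc)
    finally show ?thesis by (simp add: RSR fidelity_def G_def)
  qed
  ultimately show thesis using that by blast
qed

subsection \<open>Equality in the convex order on the line\<close>

text \<open>The summand 1 provides nonnegativity when |f| <= 1, so that the result is a test
  function for \<open>cx_leD_integral\<close>.\<close>

lemma convex_on_parabola_plus_bounded_curvature: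
  fixes f :: "real \<Rightarrow> real"
  assumes "\<And>x. (f has_real_derivative f' x) (at x)" "\<And>x. (f' has_real_derivative f'' x) (at x)" "\<And>x. \<bar>f'' x\<bar> \<le> 1"
  shows "convex_on UNIV (\<lambda>x. x\<^sup>2 / 2 + 1 + f x)"
proof (rule f''_ge0_imp_convex)
  show "((\<lambda>x. x\<^sup>2 / 2 + 1 + f x) has_real_derivative x + f' x) (at x)" for x
    by (auto intro!: derivative_eq_intros assms(1))
  show "((\<lambda>x. x + f' x) has_real_derivative 1 + f'' x) (at x)" for x
    by (auto intro!: derivative_eq_intros assms(2))
  show "0 \<le> 1 + f'' x" for x using assms(3)[of x] by linarith
qed simp

lemma second_moment_eq:
  assumes "\<mu> \<in> P2"
  shows "(\<integral>x. (u \<bullet> x)\<^sup>2 \<partial>\<mu>) = u \<bullet> (cov_matrix \<mu> *v u) + (u \<bullet> mean \<mu>)\<^sup>2"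
proof -
  interpret prob_space \<mu> using assms by (rule P2D)
  have i: "integrable \<mu> (\<lambda>x. u \<bullet> x)" "integrable \<mu> (\<lambda>x. (u \<bullet> x)\<^sup>2)"
    using P2D(5)[OF assms] sq_integrable_dot_mult[OF P2D(3) P2D(3), OF assms assms, of u u]
    by (auto simp: power2_eq_square)
  have "u \<bullet> (cov_matrix \<mu> *v u) = (\<integral>x. (u \<bullet> x)\<^sup>2 - 2 * (u \<bullet> mean \<mu>) * (u \<bullet> x) + (u \<bullet> mean \<mu>)\<^sup>2 \<partial>\<mu>)"
    unfolding cov_matrix_dot[OF assms]
    by (intro Bochner_Integration.integral_cong) (auto simp: inner_diff_right power2_eq_square algebra_simps)
  also have "\<dots> = (\<integral>x. (u \<bullet> x)\<^sup>2 \<partial>\<mu>) - 2 * (u \<bullet> mean \<mu>) * (u \<bullet> mean \<mu>) + (u \<bullet> mean \<mu>)\<^sup>2"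
    using i P2D(5)[OF assms] by (simp add: prob_space mean_def)
  finally show ?thesis by (simp add: power2_eq_square)
qed

text \<open>Equal means and covariances make the integrals of the parabola agree, so only the
  comparison of \<open>f\<close> remains. Applied to \<open>f\<close> and its negative it becomes an
  equality.\<close>

lemma cx_le_integral_bounded_curvature:
  fixes f :: "real \<Rightarrow> real" and \<mu> \<eta> :: "(real^'n) measure"
  assumes \<mu>: "\<mu> \<in> P2" and \<eta>: "\<eta> \<in> P2" and cx: "\<mu> \<le>\<^sub>c\<^sub>x \<eta>" and cov: "cov_matrix \<mu> = cov_matrix \<eta>"
    and f: "\<And>x. (f has_real_derivative f' x) (at x)" "\<And>x. (f' has_real_derivative f'' x) (at x)"
      "\<And>x. \<bar>f'' x\<bar> \<le> 1" "\<And>x. \<bar>f x\<bar> \<le> 1"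
  shows "(\<integral>x. f (u \<bullet> x) \<partial>\<mu>) \<le> (\<integral>x. f (u \<bullet> x) \<partial>\<eta>)"
proof -
  define h where "h x = (u \<bullet> x)\<^sup>2 / 2 + 1 + f (u \<bullet> x)" for x :: "real^'n"
  have hc: "convex_on UNIV h"
    using convex_on_inner_compose[OF convex_on_parabola_plus_bounded_curvature[OF f(1-3)], of u 0]
    by (simp add: h_def[abs_def])
  have h0: "0 \<le> h x" for x using f(4)[of "u \<bullet> x"] zero_le_power2[of "u \<bullet> x"] unfolding h_def by argo
  have fm: "f \<in> borel_measurable borel"
  proof (rule borel_measurable_continuous_onI)
    show "continuous_on UNIV f"
      using f(1) by (intro continuous_at_imp_continuous_on ballI) (rule DERIV_isCont)
  qed
  have int: "integrable \<rho> (\<lambda>x. (u \<bullet> x)\<^sup>2)" "integrable \<rho> (\<lambda>x. f (u \<bullet> x))"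
    "(\<integral>x. h x \<partial>\<rho>) = (\<integral>x. (u \<bullet> x)\<^sup>2 \<partial>\<rho>) / 2 + 1 + (\<integral>x. f (u \<bullet> x) \<partial>\<rho>)" "integrable \<rho> h" if \<rho>: "\<rho> \<in> P2" for \<rho>
  proof -
    interpret prob_space \<rho> using \<rho> by (rule P2D)
    show i1: "integrable \<rho> (\<lambda>x. (u \<bullet> x)\<^sup>2)"
      using sq_integrable_dot_mult[OF P2D(3) P2D(3), OF \<rho> \<rho>, of u u] by (simp add: power2_eq_square)
    have "(\<lambda>x. u \<bullet> x) \<in> borel_measurable \<rho>" by (rule P2_borel_measurable[OF \<rho>]) measurable
    then have "(\<lambda>x. f (u \<bullet> x)) \<in> borel_measurable \<rho>" using fm by (rule measurable_compose)
    then show i2: "integrable \<rho> (\<lambda>x. f (u \<bullet> x))"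
      by (rule integrable_const_bound[rotated, where B = 1]) (simp add: f(4))
    show "(\<integral>x. h x \<partial>\<rho>) = (\<integral>x. (u \<bullet> x)\<^sup>2 \<partial>\<rho>) / 2 + 1 + (\<integral>x. f (u \<bullet> x) \<partial>\<rho>)" "integrable \<rho> h"
      unfolding h_def[abs_def] using i1 i2 by (simp_all add: prob_space)
  qed
  have "(\<integral>x. h x \<partial>\<mu>) \<le> (\<integral>x. h x \<partial>\<eta>)"
    by (rule cx_leD_integral[OF \<mu> \<eta> cx hc h0 int(4)[OF \<mu>] int(4)[OF \<eta>]])
  moreover have "(\<integral>x. (u \<bullet> x)\<^sup>2 \<partial>\<mu>) = (\<integral>x. (u \<bullet> x)\<^sup>2 \<partial>\<eta>)"
    unfolding second_moment_eq[OF \<mu>] second_moment_eq[OF \<eta>] using cov cx_le_mean[OF \<mu> \<eta> cx] by simp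
  ultimately show ?thesis using int(3)[OF \<mu>] int(3)[OF \<eta>] by simp
qed

lemma cx_le_same_cov_cos_sin:
  fixes \<mu> \<eta> :: "(real^'n) measure"
  assumes "\<mu> \<in> P2" "\<eta> \<in> P2" "\<mu> \<le>\<^sub>c\<^sub>x \<eta>" "cov_matrix \<mu> = cov_matrix \<eta>"
  shows "(\<integral>x. cos (u \<bullet> x) \<partial>\<mu>) = (\<integral>x. cos (u \<bullet> x) \<partial>\<eta>)" "(\<integral>x. sin (u \<bullet> x) \<partial>\<mu>) = (\<integral>x. sin (u \<bullet> x) \<partial>\<eta>)"
proof -
  note le = cx_le_integral_bounded_curvature[OF assms, where u = u]
  have "(\<integral>x. cos (u \<bullet> x) \<partial>\<mu>) \<le> (\<integral>x. cos (u \<bullet> x) \<partial>\<eta>)"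
    by (rule le[where f' = "\<lambda>x. - sin x" and f'' = "\<lambda>x. - cos x"]) (auto intro!: derivative_eq_intros)
  moreover have "(\<integral>x. - cos (u \<bullet> x) \<partial>\<mu>) \<le> (\<integral>x. - cos (u \<bullet> x) \<partial>\<eta>)"
    by (rule le[where f = "\<lambda>x. - cos x" and f' = "\<lambda>x. sin x" and f'' = "\<lambda>x. cos x"]) (auto intro!: derivative_eq_intros)
  ultimately show "(\<integral>x. cos (u \<bullet> x) \<partial>\<mu>) = (\<integral>x. cos (u \<bullet> x) \<partial>\<eta>)" by simp
  have "(\<integral>x. sin (u \<bullet> x) \<partial>\<mu>) \<le> (\<integral>x. sin (u \<bullet> x) \<partial>\<eta>)"
    by (rule le[where f' = "\<lambda>x. cos x" and f'' = "\<lambda>x. - sin x"]) (auto intro!: derivative_eq_intros)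
  moreover have "(\<integral>x. - sin (u \<bullet> x) \<partial>\<mu>) \<le> (\<integral>x. - sin (u \<bullet> x) \<partial>\<eta>)"
    by (rule le[where f = "\<lambda>x. - sin x" and f' = "\<lambda>x. - cos x" and f'' = "\<lambda>x. sin x"]) (auto intro!: derivative_eq_intros)
  ultimately show "(\<integral>x. sin (u \<bullet> x) \<partial>\<mu>) = (\<integral>x. sin (u \<bullet> x) \<partial>\<eta>)" by simp
qed

text \<open>The cosine and sine integrals are the real and imaginary parts of the characteristic
  function. In dimension 1 the single coordinate identifies the space with the real line, where
  Levy's uniqueness theorem applies.\<close>

lemma cx_le_same_cov_eq:
  fixes \<mu> \<eta> :: "(real^'n) measure"
  assumes card: "CARD('n) = 1" and \<mu>: "\<mu> \<in> P2" and \<eta>: "\<eta> \<in> P2" and cx: "\<mu> \<le>\<^sub>c\<^sub>x \<eta>"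
    and cov: "cov_matrix \<mu> = cov_matrix \<eta>"
  shows "\<mu> = \<eta>"
proof -
  obtain i :: 'n where i: "UNIV = {i}" using card card_1_singletonE by metis
  define p where "p \<rho> = distr \<rho> borel (\<lambda>x::real^'n. x $ i)" for \<rho>
  have comp: "(\<lambda>x::real^'n. x $ i) \<in> borel_measurable borel"
    by (intro borel_measurable_continuous_onI continuous_intros)
  have vecm: "(\<lambda>t::real. \<chi> j. t :: real^'n) \<in> borel_measurable borel"
    by (intro borel_measurable_continuous_onI continuous_intros)
  have meas: "(\<lambda>x. x $ i) \<in> borel_measurable \<rho>" if "\<rho> \<in> P2" for \<rho> :: "(real^'n) measure"
    by (rule P2_borel_measurable[OF that comp])
  have recover: "distr (p \<rho>) borel (\<lambda>t. \<chi> j. t) = \<rho>" if \<rho>: "\<rho> \<in> P2" for \<rho> :: "(real^'n) measure"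
  proof -
    have "(\<chi> j. x $ i) = x" for x :: "real^'n" using i by (auto simp: vec_eq_iff)
    then have "distr (p \<rho>) borel (\<lambda>t. \<chi> j. t) = distr \<rho> borel (\<lambda>x. x)"
      unfolding p_def using distr_distr[OF vecm meas[OF \<rho>]] by (simp add: comp_def)
    then show ?thesis using P2D(2)[OF \<rho>] by (simp add: distr_id2)
  qed
  have rd: "real_distribution (p \<rho>)" if \<rho>: "\<rho> \<in> P2" for \<rho> :: "(real^'n) measure"
  proof -
    interpret prob_space \<rho> using \<rho> by (rule P2D)
    show ?thesis unfolding p_def using meas[OF \<rho>] by (rule real_distribution_distr)
  qed
  have char: "char (p \<rho>) t = Complex (\<integral>x. cos ((t *\<^sub>R axis i 1) \<bullet> x) \<partial>\<rho>) (\<integral>x. sin ((t *\<^sub>R axis i 1) \<bullet> x) \<partial>\<rho>)"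
    if \<rho>: "\<rho> \<in> P2" for \<rho> :: "(real^'n) measure" and t
  proof -
    interpret prob_space \<rho> using \<rho> by (rule P2D)
    note [measurable] = meas[OF \<rho>]
    have "char (p \<rho>) t = (CLINT x|\<rho>. iexp (t * x $ i))"
      unfolding char_def p_def by (subst integral_distr) auto
    also have "\<dots> = (CLINT x|\<rho>. complex_of_real (cos (t * x $ i)) + \<i> * complex_of_real (sin (t * x $ i)))"
    proof -
      have "iexp s = complex_of_real (cos s) + \<i> * complex_of_real (sin s)" for s :: real
        by (simp add: exp_Euler cos_of_real sin_of_real)
      then show ?thesis by (simp only:)
    qed
    also have "\<dots> = complex_of_real (\<integral>x. cos (t * x $ i) \<partial>\<rho>) + \<i> * complex_of_real (\<integral>x. sin (t * x $ i) \<partial>\<rho>)"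
    proof -
      have "integrable \<rho> (\<lambda>x. cos (t * x $ i))" "integrable \<rho> (\<lambda>x. sin (t * x $ i))"
        by (auto intro!: integrable_const_bound[of _ 1])
      then show ?thesis by simp
    qed
    finally show ?thesis by (simp add: Complex_eq inner_axis')
  qed
  have "char (p \<mu>) = char (p \<eta>)"
  proof
    fix t
    show "char (p \<mu>) t = char (p \<eta>) t"
      unfolding char[OF \<mu>] char[OF \<eta>]
      by (intro arg_cong2[of _ _ _ _ Complex] cx_le_same_cov_cos_sin[OF \<mu> \<eta> cx cov])
  qed
  then have eq: "p \<mu> = p \<eta>" by (rule Levy_uniqueness[OF rd[OF \<mu>] rd[OF \<eta>]])
  show ?thesis by (rule recover[OF \<mu>, unfolded eq recover[OF \<eta>], symmetric])
qed

subsection \<open>Projections of Gaussian measures\<close>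

lemma W2_gaussian_objective:
  assumes "psd A" "psd B"
  shows "(W2 (gaussian a A) (gaussian b B))\<^sup>2 = (norm (a - b))\<^sup>2 + trace A + covariance_objective A B"
  by (simp add: W2_gaussian[OF assms] covariance_objective_def)

lemma gelbrich_bound_gaussian:
  assumes A: "psd A" and \<eta>: "\<eta> \<in> P2"
  shows "(norm (a - mean \<eta>))\<^sup>2 + trace A + covariance_objective A (cov_matrix \<eta>) \<le> (W2 (gaussian a A) \<eta>)\<^sup>2"
  using gelbrich_bound[OF gaussian_P2[of a A] \<eta>]
  by (simp add: mean_gaussian cov_matrix_gaussian[OF A] covariance_objective_def)

text \<open>A solution exists because the covariance of the projection itself is one. Conversely
  every solution yields a Gaussian that attains the Gelbrich bound and hence equals the
  projection.\<close>

lemma I2_gaussian: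
  fixes A B :: "real^'n^'n"
  assumes A: "psd A" and B: "psd B"
  defines "solves \<equiv> is_arg_min (covariance_objective A) (\<lambda>\<Sigma>. psd \<Sigma> \<and> \<Sigma> \<preceq>\<^sub>L B)"
  shows "(\<exists>!\<Sigma>. solves \<Sigma>) \<and> (\<forall>\<Sigma>. solves \<Sigma> \<longrightarrow> I2 (gaussian a A) (gaussian b B) = gaussian b \<Sigma>)"
proof -
  let ?min = "is_arg_min (\<lambda>\<eta>. W2 (gaussian a A) \<eta>) (\<lambda>\<eta>. \<eta> \<in> P2 \<and> \<eta> \<le>\<^sub>c\<^sub>x gaussian b B)"
  define \<eta> where "\<eta> = I2 (gaussian a A) (gaussian b B)"
  have min: "?min \<eta>" unfolding \<eta>_def by (rule I2_is_arg_min[OF gaussian_P2 gaussian_P2])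
  then have \<eta>: "\<eta> \<in> P2" "\<eta> \<le>\<^sub>c\<^sub>x gaussian b B"
    and le: "\<And>\<rho>. \<rho> \<in> P2 \<Longrightarrow> \<rho> \<le>\<^sub>c\<^sub>x gaussian b B \<Longrightarrow> W2 (gaussian a A) \<eta> \<le> W2 (gaussian a A) \<rho>"
    by (auto simp: is_arg_min_def not_less)
  define C where "C = cov_matrix \<eta>"
  have C: "psd C" "C \<preceq>\<^sub>L B"
    using psd_cov_matrix[OF \<eta>(1)] cx_le_cov_matrix[OF \<eta>(1) gaussian_P2 \<eta>(2)]
    by (simp_all add: C_def cov_matrix_gaussian[OF B])
  have m: "mean \<eta> = b" using cx_le_mean[OF \<eta>(1) gaussian_P2 \<eta>(2)] by (simp add: mean_gaussian)
  have lower: "(norm (a - b))\<^sup>2 + trace A + covariance_objective A C \<le> (W2 (gaussian a A) \<eta>)\<^sup>2"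
    using gelbrich_bound_gaussian[OF A \<eta>(1), of a] by (simp add: m C_def)
  have adm: "gaussian b \<Sigma> \<le>\<^sub>c\<^sub>x gaussian b B" if "psd \<Sigma>" "\<Sigma> \<preceq>\<^sub>L B" for \<Sigma>
    by (rule gaussian_cx_le[OF that(1) B that(2)])
  have C_le: "covariance_objective A C \<le> covariance_objective A \<Sigma>" if \<Sigma>: "psd \<Sigma>" "\<Sigma> \<preceq>\<^sub>L B" for \<Sigma>
  proof -
    have "(W2 (gaussian a A) \<eta>)\<^sup>2 \<le> (W2 (gaussian a A) (gaussian b \<Sigma>))\<^sup>2"
      using le[OF gaussian_P2 adm[OF \<Sigma>]] by (simp add: W2_le_iff)
    then show ?thesis using lower W2_gaussian_objective[OF A \<Sigma>(1), of a b] by argo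
  qed
  have solC: "solves C" unfolding solves_def is_arg_min_def using C C_le by (auto simp: not_less)
  have I2: "\<eta> = gaussian b \<Sigma>" if sol: "solves \<Sigma>" for \<Sigma>
  proof -
    have \<Sigma>: "psd \<Sigma>" "\<Sigma> \<preceq>\<^sub>L B" "covariance_objective A \<Sigma> \<le> covariance_objective A C"
      using sol C by (auto simp: solves_def is_arg_min_def not_less)
    have "(W2 (gaussian a A) (gaussian b \<Sigma>))\<^sup>2 \<le> (W2 (gaussian a A) \<eta>)\<^sup>2"
      using lower W2_gaussian_objective[OF A \<Sigma>(1), of a b] \<Sigma>(3) by argo
    then have "W2 (gaussian a A) (gaussian b \<Sigma>) \<le> W2 (gaussian a A) \<eta>" by (simp add: W2_le_iff)
    then have "?min (gaussian b \<Sigma>)"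
      unfolding is_arg_min_def using le adm[OF \<Sigma>(1,2)] gaussian_P2[of b \<Sigma>]
      by (meson not_le order_trans)
    then show ?thesis unfolding \<eta>_def by (rule I2_eqI[OF gaussian_P2 gaussian_P2])
  qed
  \<comment> \<open>Taking covariances inverts the map from positive semi-definite matrices to
    Gaussians, so uniqueness passes from measures to matrices.\<close>
  have "\<Sigma> = C" if sol: "solves \<Sigma>" for \<Sigma>
  proof -
    have "psd \<Sigma>" using sol by (simp add: solves_def is_arg_min_def)
    then show ?thesis using I2[OF sol] by (simp add: C_def cov_matrix_gaussian)
  qed
  then show ?thesis using solC I2 unfolding \<eta>_def by blast
qed

lemma dominating_projection_gaussian_solves:
  fixes A B :: "real^'n^'n"
  assumes A: "psd A" and B: "psd B"
    and proj: "is_dominating_projection (gaussian a A) (gaussian b B) \<eta>"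
  shows "mean \<eta> = a" "is_arg_min (covariance_objective B) (\<lambda>\<Sigma>. psd \<Sigma> \<and> A \<preceq>\<^sub>L \<Sigma>) (cov_matrix \<eta>)"
proof -
  have \<eta>: "\<eta> \<in> P2" "gaussian a A \<le>\<^sub>c\<^sub>x \<eta>"
    and le: "\<And>\<rho>. \<rho> \<in> P2 \<Longrightarrow> gaussian a A \<le>\<^sub>c\<^sub>x \<rho> \<Longrightarrow> W2 (gaussian b B) \<eta> \<le> W2 (gaussian b B) \<rho>"
    using proj by (auto simp: is_dominating_projection_def is_arg_min_def not_less)
  show m: "mean \<eta> = a" using cx_le_mean[OF gaussian_P2 \<eta>] by (simp add: mean_gaussian)
  have C: "psd (cov_matrix \<eta>)" "A \<preceq>\<^sub>L cov_matrix \<eta>"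
    using psd_cov_matrix[OF \<eta>(1)] cx_le_cov_matrix[OF gaussian_P2 \<eta>] by (simp_all add: cov_matrix_gaussian[OF A])
  have "covariance_objective B (cov_matrix \<eta>) \<le> covariance_objective B \<Sigma>" if \<Sigma>: "psd \<Sigma>" "A \<preceq>\<^sub>L \<Sigma>" for \<Sigma>
  proof -
    have "(W2 (gaussian b B) \<eta>)\<^sup>2 \<le> (W2 (gaussian b B) (gaussian a \<Sigma>))\<^sup>2"
      using le[OF gaussian_P2 gaussian_cx_le[OF A \<Sigma>]] by (simp add: W2_le_iff)
    then show ?thesis
      using gelbrich_bound_gaussian[OF B \<eta>(1), of b] W2_gaussian_objective[OF B \<Sigma>(1), of b a] unfolding m by argo
  qed
  then show "is_arg_min (covariance_objective B) (\<lambda>\<Sigma>. psd \<Sigma> \<and> A \<preceq>\<^sub>L \<Sigma>) (cov_matrix \<eta>)"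
    using C by (auto simp: is_arg_min_def not_less)
qed

lemma gaussian_dominating_projection:
  fixes A B :: "real^'n^'n"
  assumes A: "psd A" and B: "psd B"
    and sol: "is_arg_min (covariance_objective B) (\<lambda>\<Sigma>. psd \<Sigma> \<and> A \<preceq>\<^sub>L \<Sigma>) \<Sigma>"
  shows "is_dominating_projection (gaussian a A) (gaussian b B) (gaussian a \<Sigma>)"
proof -
  have \<Sigma>: "psd \<Sigma>" "A \<preceq>\<^sub>L \<Sigma>" using sol by (auto simp: is_arg_min_def)
  have "W2 (gaussian b B) (gaussian a \<Sigma>) \<le> W2 (gaussian b B) \<eta>" if \<eta>: "\<eta> \<in> P2" "gaussian a A \<le>\<^sub>c\<^sub>x \<eta>" for \<eta>
  proof -
    have m: "mean \<eta> = a" using cx_le_mean[OF gaussian_P2 \<eta>] by (simp add: mean_gaussian)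
    have "psd (cov_matrix \<eta>)" "A \<preceq>\<^sub>L cov_matrix \<eta>"
      using psd_cov_matrix[OF \<eta>(1)] cx_le_cov_matrix[OF gaussian_P2 \<eta>] by (simp_all add: cov_matrix_gaussian[OF A])
    then have "covariance_objective B \<Sigma> \<le> covariance_objective B (cov_matrix \<eta>)"
      using sol by (auto simp: is_arg_min_def not_less)
    then show ?thesis
      unfolding W2_le_iff
      using gelbrich_bound_gaussian[OF B \<eta>(1), of b] W2_gaussian_objective[OF B \<Sigma>(1), of b a] unfolding m by argo
  qed
  then show ?thesis
    using gaussian_P2 gaussian_cx_le[OF A \<Sigma>] by (auto simp: is_dominating_projection_def is_arg_min_def not_less)
qed

text \<open>Couplings whose cost is close to the Gelbrich bound are close to the graph of an affine map,
  which pushes the nondegenerate Gaussian to a Gaussian.\<close>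

lemma dominating_projection_pos_def_unique:
  fixes A B :: "real^'n^'n"
  assumes A: "psd A" and B: "pos_def B"
    and proj: "is_dominating_projection (gaussian a A) (gaussian b B) \<eta>"
  shows "\<eta> = gaussian a (cov_matrix \<eta>)"
proof -
  note pB = pos_def_psd[OF B]
  define C where "C = cov_matrix \<eta>"
  have \<eta>: "\<eta> \<in> P2" using proj by (auto simp: is_dominating_projection_def is_arg_min_def)
  note m = dominating_projection_gaussian_solves(1)[OF A pB proj]
  note sol = dominating_projection_gaussian_solves(2)[OF A pB proj, folded C_def]
  have C: "psd C" using sol by (auto simp: is_arg_min_def)
  \<comment> \<open>The Gaussian with the same covariance is also a projection, so the distance to
    \<open>\<eta>\<close> does not exceed the Gelbrich value.\<close>
  have "is_dominating_projection (gaussian a A) (gaussian b B) (gaussian a C)"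
    by (rule gaussian_dominating_projection[OF A pB sol])
  with proj have "W2 (gaussian b B) \<eta> \<le> W2 (gaussian b B) (gaussian a C)"
    by (auto simp: is_dominating_projection_def is_arg_min_def not_less)
  then have W: "(W2 (gaussian b B) \<eta>)\<^sup>2 \<le> (norm (b - a))\<^sup>2 + trace B + trace C - 2 * fidelity B C"
    unfolding W2_le_iff W2_gaussian[OF pB C] .
  obtain T where T: "psd T" "T ** B ** T = C" "trace (T ** B) = fidelity B C" by (rule optimal_linear_map[OF B C])
  define f where "f x = a + T *v (x - b)" for x
  have push: "distr (gaussian b B) borel f = gaussian a C"
  proof -
    have "f \<in> borel_measurable borel" unfolding f_def[abs_def] by measurable
    moreover have "(\<lambda>z. b + psd_sqrt B *v z) \<in> borel_measurable std_gaussian" by measurable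
    ultimately have "distr (gaussian b B) borel f = distr std_gaussian borel (\<lambda>z. f (b + psd_sqrt B *v z))"
      unfolding gaussian_def by (simp add: distr_distr comp_def)
    also have "(\<lambda>z. f (b + psd_sqrt B *v z)) = (\<lambda>z. a + (T ** psd_sqrt B) *v z)"
      by (simp add: f_def matrix_vector_mul_assoc)
    also have "distr std_gaussian borel \<dots> = gaussian a ((T ** psd_sqrt B) ** transpose (T ** psd_sqrt B))"
      by (rule std_gaussian_affine_eq_gaussian)
    also have "(T ** psd_sqrt B) ** transpose (T ** psd_sqrt B) = T ** (psd_sqrt B ** psd_sqrt B) ** T"
      using psd_symmetric[OF T(1)] psd_symmetric[OF psd_psd_sqrt[OF pB]]
      by (simp add: matrix_transpose_mul matrix_mul_assoc)
    also have "\<dots> = C" by (simp add: psd_sqrt_mult_self[OF pB] T(2))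
    finally show ?thesis .
  qed
  have "\<eta> = gaussian a C"
  proof (rule W2_eq_0_imp_eq[OF \<eta> gaussian_P2], rule W2_eq_0I)
    fix e :: real assume e: "0 < e"
    \<comment> \<open>The transport estimate will be at most trace T times e'. The added 1 keeps the
      quotient defined when the trace is 0 and the final bound strict.\<close>
    define e' where "e' = e / (trace T + 1)"
    have tT: "0 \<le> trace T" by (rule psd_trace_nonneg[OF T(1)])
    have e': "0 < e'" "trace T * e' < e" using e tT by (auto simp: e'_def field_simps)
    obtain \<pi> where \<pi>: "\<pi> \<in> couplings (gaussian b B) \<eta>" "transport_cost \<pi> < (W2 (gaussian b B) \<eta>)\<^sup>2 + e'"
      using W2_sq_approx[OF gaussian_P2 \<eta> e'(1)] by blast
    note c = couplingsD[OF \<pi>(1)] and s = couplings_sq_integrable[OF \<pi>(1) gaussian_P2 \<eta>]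
    define X Y where "X z = fst z - b" and "Y z = snd z - a" for z :: "(real^'n) \<times> (real^'n)"
    have X: "sq_integrable \<pi> X" and Y: "sq_integrable \<pi> Y"
      unfolding X_def[abs_def] Y_def[abs_def] by (rule coupling_centered[OF \<pi>(1) gaussian_P2 \<eta>])+
    have cX: "cross_moment \<pi> X X = B" and cY: "cross_moment \<pi> Y Y = C"
      using coupling_cov[OF \<pi>(1) gaussian_P2 \<eta>]
      by (simp_all add: X_def[abs_def] Y_def[abs_def] m mean_gaussian cov_matrix_gaussian[OF pB] C_def)
    have "transport_cost \<pi> = (norm (b - a))\<^sup>2 + trace B + trace C - 2 * (\<integral>z. X z \<bullet> Y z \<partial>\<pi>)"
      using coupling_cost_eq[OF \<pi>(1) gaussian_P2 \<eta>]
      by (simp add: X_def Y_def m mean_gaussian cov_matrix_gaussian[OF pB] C_def)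
    then have gap: "2 * (fidelity B C - (\<integral>z. X z \<bullet> Y z \<partial>\<pi>)) \<le> e'" using \<pi>(2) W by argo
    have "(\<integral>z. (norm (Y z - T *v X z))\<^sup>2 \<partial>\<pi>) \<le> 2 * trace T * (fidelity B C - (\<integral>z. X z \<bullet> Y z \<partial>\<pi>))"
      using expectation_dist_linear_map_le[OF X Y T(1)] by (simp add: cX cY T)
    also have "\<dots> = trace T * (2 * (fidelity B C - (\<integral>z. X z \<bullet> Y z \<partial>\<pi>)))" by simp
    also have "\<dots> \<le> trace T * e'" by (rule mult_left_mono[OF gap tT])
    also have "\<dots> < e" by (rule e'(2))
    finally have close: "(\<integral>z. (norm (snd z - f (fst z)))\<^sup>2 \<partial>\<pi>) < e"
      by (simp add: X_def Y_def f_def diff_diff_eq)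
    have fs: "sq_integrable \<pi> (\<lambda>z. f (fst z))"
      unfolding f_def using sq_integrable_matrix[OF X, of T] c(1)
      by (intro sq_integrable_add sq_integrable_const) (auto simp: X_def[abs_def] prob_space.finite_measure)
    have "f \<in> borel_measurable borel" unfolding f_def[abs_def] by measurable
    then have dT: "distr \<pi> borel (\<lambda>z. f (fst z)) = gaussian a C"
      unfolding push[symmetric] c(5)[symmetric] using c(3) by (simp add: distr_distr comp_def)
    show "(W2 \<eta> (gaussian a C))\<^sup>2 \<le> e"
      using W2_sq_le_expectation[OF c(1) s(2) fs] close by (simp add: dT c(6))
  qed
  then show ?thesis by (simp add: C_def)
qed

text \<open>In dimension 1 the quadratic form is the trace times a square, so the only singular case
  is a Dirac mass.\<close>

lemma card_1_psd_cases:
  fixes B :: "real^'n^'n"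
  assumes card: "CARD('n) = 1" and B: "psd B"
  shows "pos_def B \<or> B = 0"
proof -
  obtain i :: 'n where i: "UNIV = {i}" using card card_1_singletonE by metis
  have dot: "x \<bullet> (B *v x) = (x $ i)\<^sup>2 * trace B" for x
    by (simp add: inner_vec_def matrix_vector_mult_def trace_def i power2_eq_square)
  have ne: "x $ i \<noteq> 0" if "x \<noteq> 0" for x :: "real^'n"
    using that i by (auto simp: vec_eq_iff)
  show ?thesis
  proof (cases "trace B = 0")
    case True
    then show ?thesis using psd_trace_eq_0[OF B] by simp
  next
    case False
    then have "0 < trace B" using psd_trace_nonneg[OF B] by simp
    then show ?thesis using B ne by (auto simp: pos_def_def psd_def dot)
  qed
qed

lemma covariance_objective_zero: "covariance_objective 0 A = trace (A :: real^'n^'n)"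
proof -
  have "psd (0 :: real^'n^'n)" by (simp add: psd_def transpose_def vec_eq_iff)
  then have "psd_sqrt (0 :: real^'n^'n) = 0" by (intro psd_sqrt_eqI) auto
  then show ?thesis by (simp add: covariance_objective_def fidelity_def trace_def)
qed

text \<open>For a Dirac mass the objective is the trace, which is strictly monotone in the Loewner
  order because a positive semi-definite matrix of trace 0 vanishes.\<close>

lemma covariance_minimizer_zero:
  fixes A :: "real^'n^'n"
  assumes A: "psd A"
  shows "is_arg_min (covariance_objective 0) (\<lambda>\<Sigma>. psd \<Sigma> \<and> A \<preceq>\<^sub>L \<Sigma>) \<Sigma> \<longleftrightarrow> \<Sigma> = A"
proof -
  have le: "trace A \<le> trace \<Sigma>" if "A \<preceq>\<^sub>L \<Sigma>" for \<Sigma>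
    using psd_trace_nonneg[of "\<Sigma> - A"] that by (simp add: loewner_le_def trace_sub)
  have AA: "A \<preceq>\<^sub>L A" by (simp add: loewner_le_def psd_def transpose_def vec_eq_iff)
  have "\<Sigma> = A" if "A \<preceq>\<^sub>L \<Sigma>" "trace \<Sigma> \<le> trace A" for \<Sigma>
  proof -
    have "psd (\<Sigma> - A)" "trace (\<Sigma> - A) = 0" using that le[OF that(1)] by (auto simp: loewner_le_def trace_sub)
    then show ?thesis using psd_trace_eq_0 by fastforce
  qed
  then show ?thesis using A AA le by (auto simp: is_arg_min_def covariance_objective_zero not_less)
qed

lemma dominating_projection_gaussian_unique:
  fixes A B :: "real^'n^'n"
  assumes A: "psd A" and B: "psd B" and nd: "CARD('n) = 1 \<or> pos_def B"
    and proj: "is_dominating_projection (gaussian a A) (gaussian b B) \<eta>"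
  shows "\<eta> = gaussian a (cov_matrix \<eta>)"
proof (cases "pos_def B")
  case True
  then show ?thesis by (rule dominating_projection_pos_def_unique[OF A _ proj])
next
  case False
  then have card: "CARD('n) = 1" and "B = 0" using nd card_1_psd_cases[OF _ B] by auto
  have \<eta>: "\<eta> \<in> P2" "gaussian a A \<le>\<^sub>c\<^sub>x \<eta>"
    using proj by (auto simp: is_dominating_projection_def is_arg_min_def)
  have "cov_matrix \<eta> = A"
    using dominating_projection_gaussian_solves(2)[OF A B proj] covariance_minimizer_zero[OF A] \<open>B = 0\<close> by simp
  then show ?thesis
    using cx_le_same_cov_eq[OF card gaussian_P2 \<eta>] by (simp add: cov_matrix_gaussian[OF A])
qed

lemma covariance_minimizer_ex1:
  fixes A B :: "real^'n^'n"
  assumes A: "psd A" and B: "psd B" and nd: "CARD('n) = 1 \<or> pos_def B"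
  shows "\<exists>!\<Sigma>. is_arg_min (covariance_objective B) (\<lambda>\<Sigma>. psd \<Sigma> \<and> A \<preceq>\<^sub>L \<Sigma>) \<Sigma>"
proof (cases "pos_def B")
  case True
  then show ?thesis using covariance_minimizer_exists[OF B A] covariance_minimizer_unique[OF True] by blast
next
  case False
  then have "B = 0" using nd card_1_psd_cases[OF _ B] by auto
  then show ?thesis using covariance_minimizer_zero[OF A] by simp
qed

text \<open>The expression is a squared distance of two centred Gaussians. This bounds the real
  infimum over covariances from below, without which \<open>INF\<close> would carry no
  information.\<close>

lemma gelbrich_objective_nonneg:
  assumes "psd A" "psd B"
  shows "0 \<le> trace (A + B - 2 *\<^sub>R psd_sqrt (psd_sqrt A ** B ** psd_sqrt A))"
  using W2_gaussian[OF assms, of 0 0] zero_le_power2[of "W2 (gaussian 0 A) (gaussian 0 B)"]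
  by (simp add: fidelity_def trace_sub trace_add trace_scaleR)

text \<open>The predicate \<open>P\<close> stands for either Loewner constraint, so one bound serves
  both inequalities for general measures.\<close>

lemma gelbrich_bound_INF:
  fixes P :: "real^'n^'n \<Rightarrow> bool"
  assumes \<mu>: "\<mu> \<in> P2" and \<eta>: "\<eta> \<in> P2" and P: "P (cov_matrix \<eta>)" "\<And>\<Sigma>. P \<Sigma> \<Longrightarrow> psd \<Sigma>"
  shows "(norm (mean \<mu> - mean \<eta>))\<^sup>2 + (INF \<Sigma>\<in>{\<Sigma>. P \<Sigma>}. trace (cov_matrix \<mu> + \<Sigma> - 2 *\<^sub>R
      psd_sqrt (psd_sqrt (cov_matrix \<mu>) ** \<Sigma> ** psd_sqrt (cov_matrix \<mu>)))) \<le> (W2 \<mu> \<eta>)\<^sup>2"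
proof -
  define F where "F \<Sigma> = trace (cov_matrix \<mu> + \<Sigma> - 2 *\<^sub>R psd_sqrt (psd_sqrt (cov_matrix \<mu>) ** \<Sigma> ** psd_sqrt (cov_matrix \<mu>)))" for \<Sigma>
  have "bdd_below (F ` {\<Sigma>. P \<Sigma>})"
    using gelbrich_objective_nonneg[OF psd_cov_matrix[OF \<mu>] P(2)] by (auto intro!: bdd_belowI[of _ 0] simp: F_def)
  then have "(INF \<Sigma>\<in>{\<Sigma>. P \<Sigma>}. F \<Sigma>) \<le> F (cov_matrix \<eta>)" using P(1) by (intro cINF_lower) auto
  moreover have "F (cov_matrix \<eta>) = trace (cov_matrix \<mu>) + trace (cov_matrix \<eta>) - 2 * fidelity (cov_matrix \<mu>) (cov_matrix \<eta>)"
    by (simp add: F_def fidelity_def trace_sub trace_add trace_scaleR)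
  ultimately have "(norm (mean \<mu> - mean \<eta>))\<^sup>2 + (INF \<Sigma>\<in>{\<Sigma>. P \<Sigma>}. F \<Sigma>) \<le> (W2 \<mu> \<eta>)\<^sup>2"
    using gelbrich_bound[OF \<mu> \<eta>] by argo
  then show ?thesis unfolding F_def .
qed

theorem proposition3p1:
  fixes m\<^sub>\<mu> m\<^sub>\<nu> :: "real^'n" and \<Sigma>\<^sub>\<mu> \<Sigma>\<^sub>\<nu> :: "real^'n^'n"
  assumes "psd \<Sigma>\<^sub>\<mu>" and "psd \<Sigma>\<^sub>\<nu>"
  shows
    "(let solves = is_arg_min
           (\<lambda>\<Sigma>. trace (\<Sigma> - 2 *\<^sub>R psd_sqrt (psd_sqrt \<Sigma>\<^sub>\<mu> ** \<Sigma> ** psd_sqrt \<Sigma>\<^sub>\<mu>)))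
           (\<lambda>\<Sigma>. psd \<Sigma> \<and> \<Sigma> \<preceq>\<^sub>L \<Sigma>\<^sub>\<nu>)
      in (\<exists>!\<Sigma>. solves \<Sigma>) \<and>
         (\<forall>\<Sigma>\<^sub>I. solves \<Sigma>\<^sub>I \<longrightarrow>
            I2 (gaussian m\<^sub>\<mu> \<Sigma>\<^sub>\<mu>) (gaussian m\<^sub>\<nu> \<Sigma>\<^sub>\<nu>) = gaussian m\<^sub>\<nu> \<Sigma>\<^sub>I)) \<and>
     (let solves = is_arg_min
           (\<lambda>\<Sigma>. trace (\<Sigma> - 2 *\<^sub>R psd_sqrt (psd_sqrt \<Sigma>\<^sub>\<nu> ** \<Sigma> ** psd_sqrt \<Sigma>\<^sub>\<nu>)))
           (\<lambda>\<Sigma>. psd \<Sigma> \<and> \<Sigma>\<^sub>\<mu> \<preceq>\<^sub>L \<Sigma>);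
          proj = is_dominating_projection (gaussian m\<^sub>\<mu> \<Sigma>\<^sub>\<mu>) (gaussian m\<^sub>\<nu> \<Sigma>\<^sub>\<nu>)
      in (\<forall>\<eta>. proj \<eta> \<longrightarrow> mean \<eta> = m\<^sub>\<mu> \<and> solves (cov_matrix \<eta>)) \<and>
         (\<forall>\<Sigma>\<^sub>J. solves \<Sigma>\<^sub>J \<longrightarrow> proj (gaussian m\<^sub>\<mu> \<Sigma>\<^sub>J)) \<and>
         (CARD('n) = 1 \<or> pos_def \<Sigma>\<^sub>\<nu> \<longrightarrow>
            (\<exists>!\<Sigma>. solves \<Sigma>) \<and>
            (\<forall>\<Sigma>\<^sub>J. solves \<Sigma>\<^sub>J \<longrightarrow> (\<forall>\<eta>. proj \<eta> \<longleftrightarrow> \<eta> = gaussian m\<^sub>\<mu> \<Sigma>\<^sub>J)))) \<and>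
     (\<forall>\<mu>\<in>P2. \<forall>\<nu>\<in>P2.
        mean \<mu> = m\<^sub>\<mu> \<and> cov_matrix \<mu> = \<Sigma>\<^sub>\<mu> \<and> mean \<nu> = m\<^sub>\<nu> \<and> cov_matrix \<nu> = \<Sigma>\<^sub>\<nu> \<longrightarrow>
        (W2 \<mu> (I2 \<mu> \<nu>))\<^sup>2 \<ge> (norm (m\<^sub>\<mu> - m\<^sub>\<nu>))\<^sup>2 +
          (INF \<Sigma>\<in>{\<Sigma>. psd \<Sigma> \<and> \<Sigma> \<preceq>\<^sub>L \<Sigma>\<^sub>\<nu>}.
             trace (\<Sigma>\<^sub>\<mu> + \<Sigma> - 2 *\<^sub>R psd_sqrt (psd_sqrt \<Sigma>\<^sub>\<mu> ** \<Sigma> ** psd_sqrt \<Sigma>\<^sub>\<mu>))) \<and>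
        (INF \<eta>\<in>{\<eta>\<in>P2. \<mu> \<le>\<^sub>c\<^sub>x \<eta>}. (W2 \<nu> \<eta>)\<^sup>2) \<ge> (norm (m\<^sub>\<mu> - m\<^sub>\<nu>))\<^sup>2 +
          (INF \<Sigma>\<in>{\<Sigma>. psd \<Sigma> \<and> \<Sigma>\<^sub>\<mu> \<preceq>\<^sub>L \<Sigma>}.
             trace (\<Sigma>\<^sub>\<nu> + \<Sigma> - 2 *\<^sub>R psd_sqrt (psd_sqrt \<Sigma>\<^sub>\<nu> ** \<Sigma> ** psd_sqrt \<Sigma>\<^sub>\<nu>))))"
  unfolding Let_def covariance_objective_eq
proof (intro conjI ballI impI allI)
  note I = I2_gaussian[OF assms, of m\<^sub>\<mu> m\<^sub>\<nu>]
  show "\<exists>!\<Sigma>. is_arg_min (covariance_objective \<Sigma>\<^sub>\<mu>) (\<lambda>\<Sigma>. psd \<Sigma> \<and> \<Sigma> \<preceq>\<^sub>L \<Sigma>\<^sub>\<nu>) \<Sigma>"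
    using I by (rule conjunct1)
  show "I2 (gaussian m\<^sub>\<mu> \<Sigma>\<^sub>\<mu>) (gaussian m\<^sub>\<nu> \<Sigma>\<^sub>\<nu>) = gaussian m\<^sub>\<nu> \<Sigma>"
    if "is_arg_min (covariance_objective \<Sigma>\<^sub>\<mu>) (\<lambda>\<Sigma>. psd \<Sigma> \<and> \<Sigma> \<preceq>\<^sub>L \<Sigma>\<^sub>\<nu>) \<Sigma>" for \<Sigma>
    using conjunct2[OF I] that by blast
next
  let ?solves = "is_arg_min (covariance_objective \<Sigma>\<^sub>\<nu>) (\<lambda>\<Sigma>. psd \<Sigma> \<and> \<Sigma>\<^sub>\<mu> \<preceq>\<^sub>L \<Sigma>)"
  let ?proj = "is_dominating_projection (gaussian m\<^sub>\<mu> \<Sigma>\<^sub>\<mu>) (gaussian m\<^sub>\<nu> \<Sigma>\<^sub>\<nu>)"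
  show "mean \<eta> = m\<^sub>\<mu>" "?solves (cov_matrix \<eta>)" if "?proj \<eta>" for \<eta>
    using dominating_projection_gaussian_solves[OF assms that] by blast+
  show proj: "?proj (gaussian m\<^sub>\<mu> \<Sigma>)" if "?solves \<Sigma>" for \<Sigma>
    by (rule gaussian_dominating_projection[OF assms that])
  assume nd: "CARD('n) = 1 \<or> pos_def \<Sigma>\<^sub>\<nu>"
  show ex1: "\<exists>!\<Sigma>. ?solves \<Sigma>" by (rule covariance_minimizer_ex1[OF assms nd])
  show "?proj \<eta> \<longleftrightarrow> \<eta> = gaussian m\<^sub>\<mu> \<Sigma>" if "?solves \<Sigma>" for \<Sigma> \<eta>
  proof
    assume p: "?proj \<eta>"
    have "cov_matrix \<eta> = \<Sigma>" using ex1 that dominating_projection_gaussian_solves(2)[OF assms p] by blast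
    then show "\<eta> = gaussian m\<^sub>\<mu> \<Sigma>" using dominating_projection_gaussian_unique[OF assms nd p] by simp
  qed (use proj[OF that] in simp)
next
  fix \<mu> \<nu> :: "(real^'n) measure"
  assume \<mu>: "\<mu> \<in> P2" and \<nu>: "\<nu> \<in> P2"
    and "mean \<mu> = m\<^sub>\<mu> \<and> cov_matrix \<mu> = \<Sigma>\<^sub>\<mu> \<and> mean \<nu> = m\<^sub>\<nu> \<and> cov_matrix \<nu> = \<Sigma>\<^sub>\<nu>"
  then have mc: "mean \<mu> = m\<^sub>\<mu>" "cov_matrix \<mu> = \<Sigma>\<^sub>\<mu>" "mean \<nu> = m\<^sub>\<nu>" "cov_matrix \<nu> = \<Sigma>\<^sub>\<nu>" by auto
  have I: "I2 \<mu> \<nu> \<in> P2" "I2 \<mu> \<nu> \<le>\<^sub>c\<^sub>x \<nu>" using I2_is_arg_min[OF \<mu> \<nu>] by (auto simp: is_arg_min_def)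
  have "psd (cov_matrix (I2 \<mu> \<nu>)) \<and> cov_matrix (I2 \<mu> \<nu>) \<preceq>\<^sub>L \<Sigma>\<^sub>\<nu>"
    using psd_cov_matrix[OF I(1)] cx_le_cov_matrix[OF I(1) \<nu> I(2)] by (simp add: mc)
  from gelbrich_bound_INF[OF \<mu> I(1), where P = "\<lambda>\<Sigma>. psd \<Sigma> \<and> \<Sigma> \<preceq>\<^sub>L \<Sigma>\<^sub>\<nu>", OF this]
  show "(W2 \<mu> (I2 \<mu> \<nu>))\<^sup>2 \<ge> (norm (m\<^sub>\<mu> - m\<^sub>\<nu>))\<^sup>2 +
      (INF \<Sigma>\<in>{\<Sigma>. psd \<Sigma> \<and> \<Sigma> \<preceq>\<^sub>L \<Sigma>\<^sub>\<nu>}.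
         trace (\<Sigma>\<^sub>\<mu> + \<Sigma> - 2 *\<^sub>R psd_sqrt (psd_sqrt \<Sigma>\<^sub>\<mu> ** \<Sigma> ** psd_sqrt \<Sigma>\<^sub>\<mu>)))"
    by (simp add: mc cx_le_mean[OF I(1) \<nu> I(2)])
  show "(INF \<eta>\<in>{\<eta>\<in>P2. \<mu> \<le>\<^sub>c\<^sub>x \<eta>}. (W2 \<nu> \<eta>)\<^sup>2) \<ge> (norm (m\<^sub>\<mu> - m\<^sub>\<nu>))\<^sup>2 +
      (INF \<Sigma>\<in>{\<Sigma>. psd \<Sigma> \<and> \<Sigma>\<^sub>\<mu> \<preceq>\<^sub>L \<Sigma>}.
         trace (\<Sigma>\<^sub>\<nu> + \<Sigma> - 2 *\<^sub>R psd_sqrt (psd_sqrt \<Sigma>\<^sub>\<nu> ** \<Sigma> ** psd_sqrt \<Sigma>\<^sub>\<nu>)))"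
  proof (rule cINF_greatest)
    \<comment> \<open>The measure \<open>\<mu>\<close> dominates itself, so the real infimum is over
      a nonempty set.\<close>
    show "{\<eta> \<in> P2. \<mu> \<le>\<^sub>c\<^sub>x \<eta>} \<noteq> {}" using \<mu> cx_le_refl by blast
    fix \<eta> assume "\<eta> \<in> {\<eta> \<in> P2. \<mu> \<le>\<^sub>c\<^sub>x \<eta>}"
    then have \<eta>: "\<eta> \<in> P2" "\<mu> \<le>\<^sub>c\<^sub>x \<eta>" by auto
    have "psd (cov_matrix \<eta>) \<and> \<Sigma>\<^sub>\<mu> \<preceq>\<^sub>L cov_matrix \<eta>"
      using psd_cov_matrix[OF \<eta>(1)] cx_le_cov_matrix[OF \<mu> \<eta>] by (simp add: mc)
    from gelbrich_bound_INF[OF \<nu> \<eta>(1), where P = "\<lambda>\<Sigma>. psd \<Sigma> \<and> \<Sigma>\<^sub>\<mu> \<preceq>\<^sub>L \<Sigma>", OF this]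
    show "(norm (m\<^sub>\<mu> - m\<^sub>\<nu>))\<^sup>2 + (INF \<Sigma>\<in>{\<Sigma>. psd \<Sigma> \<and> \<Sigma>\<^sub>\<mu> \<preceq>\<^sub>L \<Sigma>}.
         trace (\<Sigma>\<^sub>\<nu> + \<Sigma> - 2 *\<^sub>R psd_sqrt (psd_sqrt \<Sigma>\<^sub>\<nu> ** \<Sigma> ** psd_sqrt \<Sigma>\<^sub>\<nu>))) \<le> (W2 \<nu> \<eta>)\<^sup>2"
      by (simp add: mc cx_le_mean[OF \<mu> \<eta>, symmetric] norm_minus_commute)
  qed
qed

end
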